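(* Let $(K,L,d)\mapsto(h_{K,L,d},\gamma_{K,L,d})$ be any numerically stable fixed-parameter BAOAB tuning rule, and write $h_\kappa=h_{1,\kappa,2}$, $\gamma_\kappa=\gamma_{1,\kappa,2}$. Let $C,c>0$ and $a,b\ge0$ be constants, let $\tau:(1,\infty)\to(0,\infty)$ satisfy $\tau(\kappa)=o(\kappa)$ as $\kappa\to\infty$, and let $\kappa_0>1$. Then there exist $\kappa\ge\kappa_0$ and $U\in\mathcal U_\kappa^2$ such that the BAOAB kernel $\widetilde Q_{h_\kappa,\gamma_\kappa}^U$ has a unique invariant law $\pi$, and there are $z\in\mathbb R^4$ and $n\in\mathbb N$ for which $$\bigl\|\delta_z(\widetilde Q_{h_\kappa,\gamma_\kappa}^U)^n-\pi\bigr\|_{\mathrm{TV}}>C\kappa^a\bigl(1+W_2(\delta_z,\pi)\bigr)^b\exp\!\left(-\frac{cn}{\tau(\kappa)}\right).$$ In particular, the assertion that the reverse inequality ($\le$) holds for all $\kappa\ge\kappa_0$, all $U\in\mathcal U_\kappa^2$ for which $\widetilde Q^U_{h_\kappa,\gamma_\kappa}$ has a unique invariant law $\pi$, all $z\in\mathbb R^4$ and all $n\in\mathbb N$ fails with $\tau(\kappa)=\kappa^\alpha$ for any $\alpha<1$.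
   Context: BAOAB chain. For a differentiable $U:\mathbb R^d\to\mathbb R$ and $h,\gamma>0$, put $\beta=e^{-\gamma h}$ and $\varsigma=(1-\beta^2)^{1/2}$. One BAOAB step, driven by a single $\xi\sim\mathcal N(0,\mathrm{Id}_d)$, maps $(x,v)\in\mathbb R^d\times\mathbb R^d$ to $(x^+,v^+)$ by $v^{(a)}=v-\frac h2\nabla U(x)$, $x^{(b)}=x+\frac h2v^{(a)}$, $v^{(c)}=\beta v^{(a)}+\varsigma\xi$, $x^+=x^{(b)}+\frac h2v^{(c)}$, $v^+=v^{(c)}-\frac h2\nabla U(x^+)$. Iterating with i.i.d. copies of $\xi$ defines a Markov chain with transition kernel $\widetilde Q_{h,\gamma}^U$. $\mathcal U_\kappa^d=\{U\in C^\infty(\mathbb R^d): \mathrm{Id}_d\preceq\nabla^2U(x)\preceq\kappa\,\mathrm{Id}_d\text{ for every }x\}$. A fixed-parameter tuning rule assigns to each triple $(K,L,d)$ with $0<K<L$ and integer $d\ge1$ a pair $(h_{K,L,d},\gamma_{K,L,d})\in(0,\infty)^2$. It is numerically stable (for BAOAB) if $0<h_{K,L,d}<2/\sqrt L$ for every $0<K<L$ and $d\ge1$. $\mathbb N=\{0,1,2,\dots\}$. $\|\nu-\widetilde\nu\|_{\mathrm{TV}}=\sup_A|\nu(A)-\widetilde\nu(A)|$; $W_2$ is the Euclidean $2$-Wasserstein distance; $\delta_z$ is the Dirac mass at $z$. *)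

theory Defs
  imports "HOL-Probability.Probability"
begin

section \<open>Smooth potentials\<close>

text \<open>
  \<open>C_k k f\<close>: \<open>f\<close> is \<open>k\<close> times continuously differentiable on the whole space, expressed by
  iterated directional derivatives.
\<close>

primrec C_k :: "nat \<Rightarrow> ('a::euclidean_space \<Rightarrow> real) \<Rightarrow> bool" where
  "C_k 0 f \<longleftrightarrow> continuous_on UNIV f"
| "C_k (Suc k) f \<longleftrightarrow>
     (\<forall>x. f differentiable (at x)) \<and> (\<forall>v. C_k k (\<lambda>x. frechet_derivative f (at x) v))"

definition C_infinity :: "('a::euclidean_space \<Rightarrow> real) \<Rightarrow> bool" where
  "C_infinity f \<longleftrightarrow> (\<forall>k. C_k k f)"

definition gradient :: "('a::euclidean_space \<Rightarrow> real) \<Rightarrow> 'a \<Rightarrow> 'a" where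
  "gradient U x = (THE g. GDERIV U x :> g)"

definition hessian :: "('a::euclidean_space \<Rightarrow> real) \<Rightarrow> 'a \<Rightarrow> 'a \<Rightarrow> 'a" where
  "hessian U x = frechet_derivative (gradient U) (at x)"

definition loewner_le :: "('a::euclidean_space \<Rightarrow> 'a) \<Rightarrow> ('a \<Rightarrow> 'a) \<Rightarrow> bool" where
  "loewner_le A B \<longleftrightarrow> (\<forall>v. v \<bullet> A v \<le> v \<bullet> B v)"

text \<open>The class of potentials with condition number at most \<open>\<kappa>\<close>; the dimension is that of \<open>'a\<close>.\<close>

definition potentials :: "real \<Rightarrow> ('a::euclidean_space \<Rightarrow> real) set" where
  "potentials \<kappa> = {U. C_infinity U \<and>
     (\<forall>x. loewner_le (\<lambda>v. v) (hessian U x) \<and> loewner_le (hessian U x) (\<lambda>v. \<kappa> *\<^sub>R v))}"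


section \<open>The BAOAB chain\<close>

definition std_gaussian :: "'a::euclidean_space measure" where
  "std_gaussian = density lborel (\<lambda>x. ennreal (\<Prod>i\<in>Basis. std_normal_density (x \<bullet> i)))"

definition baoab_step ::
  "real \<Rightarrow> real \<Rightarrow> ('a::euclidean_space \<Rightarrow> real) \<Rightarrow> 'a \<Rightarrow> 'a \<times> 'a \<Rightarrow> 'a \<times> 'a" where
  "baoab_step h \<gamma> U \<xi> = (\<lambda>(x, v).
     let \<beta> = exp (- \<gamma> * h);
         \<sigma> = sqrt (1 - \<beta>\<^sup>2);
         va = v - (h / 2) *\<^sub>R gradient U x;
         xb = x + (h / 2) *\<^sub>R va;
         vc = \<beta> *\<^sub>R va + \<sigma> *\<^sub>R \<xi>;
         x' = xb + (h / 2) *\<^sub>R vc;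
         v' = vc - (h / 2) *\<^sub>R gradient U x'
     in (x', v'))"

definition baoab_kernel ::
  "real \<Rightarrow> real \<Rightarrow> ('a::euclidean_space \<Rightarrow> real) \<Rightarrow> 'a \<times> 'a \<Rightarrow> ('a \<times> 'a) measure" where
  "baoab_kernel h \<gamma> U z = distr std_gaussian borel (\<lambda>\<xi>. baoab_step h \<gamma> U \<xi> z)"

text \<open>
  \<open>apply_kernel Q n \<nu>\<close> is \<open>\<nu> Q\<^sup>n\<close>. The monadic \<open>bind\<close> is the action \<open>\<nu> Q\<close> on measures provided
  that \<open>Q\<close> is measurable into \<open>subprob_algebra borel\<close>, which holds for the BAOAB kernel of
  every potential in the class above since its gradient is continuous.
\<close>

definition apply_kernel ::
  "('a::topological_space \<Rightarrow> 'a measure) \<Rightarrow> nat \<Rightarrow> 'a measure \<Rightarrow> 'a measure" where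
  "apply_kernel Q n \<nu> = ((\<lambda>\<mu>. \<mu> \<bind> Q) ^^ n) \<nu>"

definition invariant_law ::
  "('a::topological_space \<Rightarrow> 'a measure) \<Rightarrow> 'a measure \<Rightarrow> bool" where
  "invariant_law Q \<pi> \<longleftrightarrow> prob_space \<pi> \<and> sets \<pi> = sets borel \<and> \<pi> \<bind> Q = \<pi>"

definition unique_invariant_law ::
  "('a::topological_space \<Rightarrow> 'a measure) \<Rightarrow> 'a measure \<Rightarrow> bool" where
  "unique_invariant_law Q \<pi> \<longleftrightarrow> invariant_law Q \<pi> \<and> (\<forall>\<pi>'. invariant_law Q \<pi>' \<longrightarrow> \<pi>' = \<pi>)"

abbreviation dirac :: "'a::topological_space \<Rightarrow> 'a measure" where
  "dirac z \<equiv> return borel z"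


section \<open>Distances between laws\<close>

definition tv_dist :: "'a::topological_space measure \<Rightarrow> 'a measure \<Rightarrow> real" where
  "tv_dist \<mu> \<nu> = (SUP A\<in>sets borel. \<bar>measure \<mu> A - measure \<nu> A\<bar>)"

text \<open>
  Powers with real exponent \<open>p \<ge> 0\<close> on the extended nonnegative reals, with \<open>\<infinity>\<^sup>0 = 1\<close>.
  As \<open>powr\<close> has \<open>0 powr 0 = 0\<close>, the value at base \<open>0\<close> and exponent \<open>0\<close> is \<open>0\<close>; below, the
  exponent is positive or the base is at least \<open>1\<close>.
\<close>

definition epowr :: "ennreal \<Rightarrow> real \<Rightarrow> ennreal" where
  "epowr x p = (if x = \<infinity> then (if p = 0 then 1 else \<infinity>) else ennreal (enn2real x powr p))"

definition couplings ::
  "'a::topological_space measure \<Rightarrow> 'a measure \<Rightarrow> ('a \<times> 'a) measure set" where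
  "couplings \<mu> \<nu> = {\<Gamma>. sets \<Gamma> = sets (borel \<Otimes>\<^sub>M borel) \<and>
     distr \<Gamma> borel fst = \<mu> \<and> distr \<Gamma> borel snd = \<nu>}"

text \<open>
  The Wasserstein distance is infinite if no coupling has finite quadratic cost. On a product
  \<open>'a \<times> 'a\<close> of Euclidean spaces, \<open>dist\<close> is the Euclidean distance of the doubled dimension.
\<close>

definition W2 :: "'a::metric_space measure \<Rightarrow> 'a measure \<Rightarrow> ennreal" where
  "W2 \<mu> \<nu> = epowr (INF \<Gamma>\<in>couplings \<mu> \<nu>. \<integral>\<^sup>+ (x, y). ennreal ((dist x y)\<^sup>2) \<partial>\<Gamma>) (1 / 2)"


section \<open>Tuning rules\<close>

text \<open>Rules are total functions of \<open>K L d\<close>; only their values for \<open>0 < K < L\<close>, \<open>d \<ge> 1\<close> matter.\<close>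

definition tuning_rule ::
  "(real \<Rightarrow> real \<Rightarrow> nat \<Rightarrow> real) \<Rightarrow> (real \<Rightarrow> real \<Rightarrow> nat \<Rightarrow> real) \<Rightarrow> bool" where
  "tuning_rule h \<gamma> \<longleftrightarrow>
     (\<forall>K L d. 0 < K \<and> K < L \<and> 1 \<le> d \<longrightarrow> 0 < h K L d \<and> 0 < \<gamma> K L d)"

definition numerically_stable :: "(real \<Rightarrow> real \<Rightarrow> nat \<Rightarrow> real) \<Rightarrow> bool" where
  "numerically_stable h \<longleftrightarrow>
     (\<forall>K L d. 0 < K \<and> K < L \<and> 1 \<le> d \<longrightarrow> 0 < h K L d \<and> h K L d < 2 / sqrt L)"

end

theory Submission
  imports Defs "HOL-Computational_Algebra.Polynomial" "HOL-Real_Asymp.Real_Asymp"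
begin

text \<open>
  Without noise and after elimination of the velocity, a BAOAB step is the heavy-ball iteration
  \<open>x\<^sub>n\<^sub>+\<^sub>1 = x\<^sub>n + \<beta> (x\<^sub>n - x\<^sub>n\<^sub>-\<^sub>1) - \<alpha> \<nabla>U(x\<^sub>n)\<close> with \<open>\<beta> = exp (- \<gamma> h)\<close> and \<open>\<alpha> = h\<^sup>2 (1 + \<beta>) / 2\<close>, and numerical
  stability says that \<open>\<alpha> \<kappa> < 2 (1 + \<beta>)\<close>. Heavy-ball iterations cannot be accelerated uniformly over
  convex potentials, and the same obstruction slows down the noisy chain. Let \<open>C\<close> be a large universal
  constant.

  If \<open>\<alpha> \<kappa> \<le> C (1 - \<beta>)\<close>, the potential \<open>|x|\<^sup>2 / 2\<close> is already slow: its characteristic polynomial has a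
  root \<open>r\<close> with \<open>|r| \<ge> 1 - 8 C / \<kappa>\<close> (\<open>slow_root_exists\<close>). A chain started at distance of order
  \<open>|r|\<^sup>-\<^sup>n\<close> is far from equilibrium after \<open>n\<close> steps, and \<open>|r|\<^sup>-\<^sup>n\<close> is at most \<open>exp (16 C n / \<kappa>)\<close>
  (\<open>slow_mixing_small_step\<close>).

  If \<open>\<alpha> \<kappa> > C (1 - \<beta>)\<close>, the friction is weak compared with the step, and a small rotating force sustains
  a periodic orbit on a regular polygon. The potential is a quadratic whose frequency is in resonance
  with the rotation, plus small bumps at the vertices that supply the force. Near the orbit the
  gradient is linear plus a constant, so that the orbit attracts; and if the picture is enlarged by a
  factor of order \<open>sqrt n\<close>, the noise is too weak to leave the orbit within \<open>n\<close> steps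
  (\<open>slow_mixing_large_step\<close>).

  In both cases two orbits with disjoint neighbourhoods are tracked, and from one of them the law after
  \<open>n\<close> steps has distance at least \<open>1/4\<close> from equilibrium (\<open>slow_from_two_orbits\<close>), while the Wasserstein
  distance of the starting point is at most \<open>A n exp (16 C n / \<kappa>)\<close>. Its power \<open>b\<close> is beaten by
  \<open>exp (- c n / \<tau> \<kappa>)\<close> for large \<open>n\<close> as soon as \<open>\<tau> \<kappa>\<close> is a small fraction of \<open>\<kappa>\<close>, which happens for large
  \<open>\<kappa>\<close> (\<open>no_accelerated_bound\<close>).

  The potentials are quadratic outside a ball. A norm adapted to the linear part
  (\<open>adapted_norm_exists\<close>) gives a Lyapunov function, the Gaussian noise gives a minorisation for two
  steps (\<open>minorisation\<close>), and Harris' theorem (\<open>harris_theorem_two_step\<close>) yields the invariant law, its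
  uniqueness and its second moment (\<open>invariant_law_exists\<close>, \<open>W2_bound\<close>).
\<close>

section \<open>Markov kernels\<close>

lemma apply_kernel_0 [simp]: "apply_kernel Q 0 \<mu> = \<mu>"
  by (simp add: apply_kernel_def)

lemma apply_kernel_Suc: "apply_kernel Q (Suc n) \<mu> = apply_kernel Q n \<mu> \<bind> Q"
  by (simp add: apply_kernel_def)

lemma apply_kernel_Suc_shift: "apply_kernel Q (Suc n) \<mu> = apply_kernel Q n (\<mu> \<bind> Q)"
  by (induction n arbitrary: \<mu>) (simp_all add: apply_kernel_Suc)

lemma dirac_in_prob_algebra: "dirac z \<in> space (prob_algebra borel)"
  by (simp add: space_prob_algebra prob_space_return)

lemma bind_kernel_in_prob_algebra:
  assumes "Q \<in> borel \<rightarrow>\<^sub>M prob_algebra borel" "\<mu> \<in> space (prob_algebra borel)"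
  shows "\<mu> \<bind> Q \<in> space (prob_algebra borel)"
  using prob_space_bind'[OF assms(2,1)] sets_bind'[OF assms(2,1)] by (simp add: space_prob_algebra)

lemma apply_kernel_in_prob_algebra:
  assumes "Q \<in> borel \<rightarrow>\<^sub>M prob_algebra borel" "\<mu> \<in> space (prob_algebra borel)"
  shows "apply_kernel Q n \<mu> \<in> space (prob_algebra borel)"
  by (induction n) (auto simp: apply_kernel_Suc assms intro: bind_kernel_in_prob_algebra)

lemma measurable_apply_kernel_dirac:
  assumes Q: "Q \<in> borel \<rightarrow>\<^sub>M prob_algebra borel"
  shows "(\<lambda>z. apply_kernel Q n (dirac z)) \<in> borel \<rightarrow>\<^sub>M prob_algebra borel"
proof (induction n)
  case 0
  show ?case by simp
next
  case (Suc n)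
  show ?case
    unfolding apply_kernel_Suc by (rule measurable_bind_prob_space[OF Suc Q])
qed

text \<open>
  Chapman--Kolmogorov in the form needed below: it lets the first step of the chain be split off,
  although \<^const>\<open>apply_kernel\<close> is defined by appending steps at the end.
\<close>

lemma kernel_power_mixture:
  assumes Q: "Q \<in> borel \<rightarrow>\<^sub>M prob_algebra borel" and \<mu>: "\<mu> \<in> space (prob_algebra borel)"
  shows "\<mu> \<bind> (\<lambda>z. apply_kernel Q n (dirac z)) = apply_kernel Q n \<mu>"
proof (induction n)
  case 0
  show ?case
    using \<mu> by (simp add: bind_return'' space_prob_algebra)
next
  case (Suc n)
  have "(\<lambda>z. apply_kernel Q n (dirac z)) \<in> \<mu> \<rightarrow>\<^sub>M subprob_algebra borel"
    using measurable_apply_kernel_dirac[OF Q] \<mu>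
    by (auto simp: space_prob_algebra cong: measurable_cong_sets intro!: measurable_prob_algebraD)
  then show ?case
    unfolding apply_kernel_Suc
    by (subst bind_assoc[symmetric]) (auto intro: measurable_prob_algebraD Q simp: Suc)
qed

lemma measure_apply_kernel_Suc:
  assumes Q: "Q \<in> borel \<rightarrow>\<^sub>M prob_algebra borel" and A: "A \<in> sets borel"
  shows "measure (apply_kernel Q (Suc n) (dirac z)) A
    = (\<integral>y. measure (apply_kernel Q n (dirac y)) A \<partial>Q z)"
proof -
  have Qz: "Q z \<in> space (prob_algebra borel)"
    using measurable_space[OF Q] by simp
  then interpret prob_space "Q z" by (simp add: space_prob_algebra)
  have "apply_kernel Q (Suc n) (dirac z) = apply_kernel Q n (Q z)"
    using Q by (simp add: apply_kernel_Suc_shift bind_return[of _ _ borel] measurable_prob_algebraD)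
  also have "\<dots> = Q z \<bind> (\<lambda>y. apply_kernel Q n (dirac y))"
    using kernel_power_mixture[OF Q Qz] by simp
  finally show ?thesis
    using measure_bind[of "\<lambda>y. apply_kernel Q n (dirac y)" borel A] A Qz measurable_apply_kernel_dirac[OF Q]
    by (simp add: space_prob_algebra cong: measurable_cong_sets)
       (metis (no_types, lifting) measurable_cong_sets measurable_prob_algebraD)
qed

section \<open>Harris' theorem\<close>

text \<open>
  The core estimate of Harris' theorem. A test function whose oscillation is controlled by
  \<open>2 + b V x + b V y\<close> differs from a suitable constant \<open>k\<close> by at most \<open>w = c (1 + b V)\<close>. Then
  \<open>w - (\<phi> - k)\<close> and \<open>w + (\<phi> - k)\<close> are nonnegative, so their integrals decrease when \<open>M1\<close> and
  \<open>M2\<close> are replaced by the common lower bound \<open>\<nu>\<close>; their sum is \<open>2 w \<ge> 2 c\<close>, and this is the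
  gain \<open>2 c \<nu>(UNIV)\<close>. With \<open>\<nu> = 0\<close> the statement is the trivial bound without gain.
\<close>

lemma weighted_oscillation_minorised:
  fixes M1 M2 \<nu> :: "'a::topological_space measure" and \<phi> V :: "'a \<Rightarrow> real"
  assumes p: "prob_space M1" "prob_space M2"
    and s: "sets M1 = sets borel" "sets M2 = sets borel" "sets \<nu> = sets borel"
    and V: "V \<in> borel_measurable borel" "\<And>x. 0 \<le> V x" "integrable M1 V" "integrable M2 V"
    and \<phi>: "\<phi> \<in> borel_measurable borel" "\<And>x. \<bar>\<phi> x\<bar> \<le> d"
    and osc: "\<And>x y. \<bar>\<phi> x - \<phi> y\<bar> \<le> c * (2 + b * V x + b * V y)"
    and bc: "0 \<le> b" "0 \<le> c"
    and \<nu>: "\<And>A. A \<in> sets borel \<Longrightarrow> emeasure \<nu> A \<le> emeasure M1 A"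
           "\<And>A. A \<in> sets borel \<Longrightarrow> emeasure \<nu> A \<le> emeasure M2 A"
  shows "(\<integral>x. \<phi> x \<partial>M1) - (\<integral>x. \<phi> x \<partial>M2)
     \<le> c * (2 + b * (\<integral>x. V x \<partial>M1) + b * (\<integral>x. V x \<partial>M2)) - 2 * c * measure \<nu> UNIV"
proof -
  interpret M1: prob_space M1 by fact
  interpret M2: prob_space M2 by fact
  define w where "w x = c * (1 + b * V x)" for x
  have w0: "0 \<le> w x" for x using bc V by (auto simp: w_def)
  have le: "\<phi> x - w x \<le> \<phi> y + w y" for x y
    using osc[of x y] by (auto simp: w_def algebra_simps)
  \<comment> \<open>a centring constant that turns the bound on differences into a bound on values\<close>
  define k where "k = (SUP x. \<phi> x - w x)"
  have bdd: "bdd_above (range (\<lambda>x. \<phi> x - w x))"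
    using le by (auto intro!: bdd_aboveI2)
  have k1: "\<phi> x - w x \<le> k" for x
    unfolding k_def by (rule cSUP_upper[OF _ bdd]) auto
  have k2: "k \<le> \<phi> x + w x" for x
    unfolding k_def by (rule cSUP_least) (auto intro: le)
  have ms [measurable]: "\<phi> \<in> borel_measurable borel" "V \<in> borel_measurable borel" by fact+
  have [measurable]: "w \<in> borel_measurable borel" unfolding w_def by simp
  have i\<phi>: "integrable M1 \<phi>" "integrable M2 \<phi>"
    using \<phi> s by (auto intro!: M1.integrable_const_bound[where B=d] M2.integrable_const_bound[where B=d]
        cong: measurable_cong_sets)
  have iw: "integrable M1 w" "integrable M2 w"
    unfolding w_def using V by auto
  let ?g1 = "\<lambda>x. w x - (\<phi> x - k)" and ?g2 = "\<lambda>x. w x + (\<phi> x - k)"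
  have g: "0 \<le> ?g1 x" "0 \<le> ?g2 x" for x using k1[of x] k2[of x] by auto
  have ig: "integrable M1 ?g1" "integrable M2 ?g2" using i\<phi> iw by auto
  have lem: "\<nu> \<le> M1" "\<nu> \<le> M2"
    using \<nu> s by (auto simp: le_measure)
  have "ennreal (2 * c) * emeasure \<nu> UNIV = (\<integral>\<^sup>+x. ennreal (2 * c) \<partial>\<nu>)"
    using s sets_eq_imp_space_eq[of \<nu> borel] by (simp add: nn_integral_const)
  also have "\<dots> \<le> (\<integral>\<^sup>+x. ennreal (?g1 x) + ennreal (?g2 x) \<partial>\<nu>)"
  proof (rule nn_integral_mono)
    fix x
    have "c \<le> w x" using bc V(2)[of x] by (simp add: w_def algebra_simps)
    then show "ennreal (2 * c) \<le> ennreal (?g1 x) + ennreal (?g2 x)"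
      using g[of x] by (subst ennreal_plus[symmetric]) (auto intro!: ennreal_leI)
  qed
  also have "\<dots> = (\<integral>\<^sup>+x. ennreal (?g1 x) \<partial>\<nu>) + (\<integral>\<^sup>+x. ennreal (?g2 x) \<partial>\<nu>)"
    using s by (intro nn_integral_add) (auto cong: measurable_cong_sets)
  also have "\<dots> \<le> (\<integral>\<^sup>+x. ennreal (?g1 x) \<partial>M1) + (\<integral>\<^sup>+x. ennreal (?g2 x) \<partial>M2)"
    using s lem by (intro add_mono nn_integral_mono_measure) auto
  also have "\<dots> = ennreal ((\<integral>x. ?g1 x \<partial>M1) + (\<integral>x. ?g2 x \<partial>M2))"
    using g ig by (subst (1 2) nn_integral_eq_integral) (auto simp: ennreal_plus[symmetric] simp del: ennreal_plus)
  finally have *: "ennreal (2 * c) * emeasure \<nu> UNIV \<le> ennreal ((\<integral>x. ?g1 x \<partial>M1) + (\<integral>x. ?g2 x \<partial>M2))" .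
  have "emeasure \<nu> UNIV \<le> 1"
    using \<nu>(1)[of UNIV] M1.emeasure_le_1[of UNIV] by simp
  then have "emeasure \<nu> UNIV = ennreal (measure \<nu> UNIV)"
    by (metis emeasure_eq_ennreal_measure ennreal_one_less_top leD top.not_eq_extremum)
  with * have "2 * c * measure \<nu> UNIV \<le> (\<integral>x. ?g1 x \<partial>M1) + (\<integral>x. ?g2 x \<partial>M2)"
    using bc g Bochner_Integration.integral_nonneg[of M1 ?g1] Bochner_Integration.integral_nonneg[of M2 ?g2]
    by (simp add: ennreal_mult[symmetric] ennreal_le_iff del: ennreal_plus)
  also have "(\<integral>x. ?g1 x \<partial>M1) = c * (1 + b * (\<integral>x. V x \<partial>M1)) - (\<integral>x. \<phi> x \<partial>M1) + k"
    using i\<phi> iw V unfolding w_def by (simp add: M1.prob_space)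
  also have "(\<integral>x. ?g2 x \<partial>M2) = c * (1 + b * (\<integral>x. V x \<partial>M2)) + (\<integral>x. \<phi> x \<partial>M2) - k"
    using i\<phi> iw V unfolding w_def by (simp add: M2.prob_space)
  finally show ?thesis by (simp add: algebra_simps)
qed


lemma geometric_steps_converge:
  fixes f :: "nat \<Rightarrow> real"
  assumes "\<And>n. \<bar>f (Suc n) - f n\<bar> \<le> C * r ^ n" "0 \<le> r" "r < 1"
  shows "convergent f" "\<bar>f n - lim f\<bar> \<le> C / (1 - r) * r ^ n"
proof -
  have sm: "summable (\<lambda>n. C * r ^ n)" using assms by (intro summable_mult summable_geometric) auto
  have s: "summable (\<lambda>n. f (Suc n) - f n)"
    by (rule summable_comparison_test'[OF sm, of 0]) (use assms in auto)
  have lims: "(\<lambda>n. f 0 + (\<Sum>i<n. f (Suc i) - f i)) \<longlonglongrightarrow> f 0 + (\<Sum>i. f (Suc i) - f i)"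
    by (intro tendsto_intros summable_LIMSEQ s)
  have eq: "(\<lambda>n. f 0 + (\<Sum>i<n. f (Suc i) - f i)) = f"
    by (auto simp: sum_lessThan_telescope)
  have lf: "f \<longlonglongrightarrow> f 0 + (\<Sum>i. f (Suc i) - f i)" using lims unfolding eq .
  then show cv: "convergent f" by (auto simp: convergent_def)
  have step: "\<bar>f m - f n\<bar> \<le> C / (1 - r) * (r ^ n - r ^ m)" if "n \<le> m" for m
    using that
  proof (induction m rule: dec_induct)
    case (step m)
    have "\<bar>f (Suc m) - f n\<bar> \<le> C * r ^ m + C / (1 - r) * (r ^ n - r ^ m)"
      using assms(1)[of m] step.IH by linarith
    also have "\<dots> = C / (1 - r) * (r ^ n - r ^ Suc m)"
      using assms(3) by (simp add: field_simps)
    finally show ?case .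
  qed simp
  have C0: "0 \<le> C" using assms(1)[of 0] by simp
  have "\<bar>f m - f n\<bar> \<le> C / (1 - r) * r ^ n" if "n \<le> m" for m
    using step[OF that] assms C0
    by (smt (verit) divide_nonneg_pos mult_left_mono zero_le_power)
  moreover have "(\<lambda>m. \<bar>f m - f n\<bar>) \<longlonglongrightarrow> \<bar>lim f - f n\<bar>"
    using cv by (intro tendsto_intros) (simp add: convergent_LIMSEQ_iff)
  ultimately have "\<bar>lim f - f n\<bar> \<le> C / (1 - r) * r ^ n"
    by (intro LIMSEQ_le_const2) auto
  then show "\<bar>f n - lim f\<bar> \<le> C / (1 - r) * r ^ n" by (simp add: abs_minus_commute)
qed

text \<open>
  Countable additivity survives because the convergence is uniform over all events: for a sequence
  of events decreasing to the empty set, the limit in \<open>n\<close> may be taken first.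
\<close>

lemma uniform_setwise_limit_is_prob:
  fixes \<mu> :: "nat \<Rightarrow> 'a::topological_space measure" and q :: "'a set \<Rightarrow> real"
  assumes \<mu>: "\<And>n. prob_space (\<mu> n)" "\<And>n. sets (\<mu> n) = sets borel"
    and lim: "\<And>n A. A \<in> sets borel \<Longrightarrow> \<bar>measure (\<mu> n) A - q A\<bar> \<le> e n" and e: "e \<longlonglongrightarrow> 0"
  obtains \<pi> where "prob_space \<pi>" "sets \<pi> = sets (borel :: 'a measure)"
    "\<And>A. A \<in> sets borel \<Longrightarrow> measure \<pi> A = q A"
proof -
  have tends: "(\<lambda>n. measure (\<mu> n) A) \<longlonglongrightarrow> q A" if A: "A \<in> sets borel" for A
  proof -
    have "(\<lambda>n. measure (\<mu> n) A - q A) \<longlonglongrightarrow> 0"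
      by (rule Lim_null_comparison[OF _ e]) (use lim[OF A] in auto)
    then show ?thesis by (simp add: LIM_zero_iff)
  qed
  have q0: "0 \<le> q A" if "A \<in> sets borel" for A
    by (rule LIMSEQ_le_const[OF tends[OF that]]) auto
  have q1: "q UNIV = 1"
  proof (rule LIMSEQ_unique[OF tends])
    have "measure (\<mu> n) UNIV = 1" for n
      using prob_space.prob_space[OF \<mu>(1)[of n]] sets_eq_imp_space_eq[OF \<mu>(2)[of n]] by simp
    then show "(\<lambda>n. measure (\<mu> n) UNIV) \<longlonglongrightarrow> 1" by simp
  qed simp
  have qe: "q {} = 0"
    using LIMSEQ_unique[OF tends[of "{}"], of 0] by simp
  have qadd: "q (A \<union> B) = q A + q B" if "A \<in> sets borel" "B \<in> sets borel" "A \<inter> B = {}" for A B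
  proof (rule LIMSEQ_unique[OF tends])
    have "measure (\<mu> n) (A \<union> B) = measure (\<mu> n) A + measure (\<mu> n) B" for n
      using that \<mu> by (intro finite_measure.finite_measure_Union) (auto simp: prob_space_def)
    then show "(\<lambda>n. measure (\<mu> n) (A \<union> B)) \<longlonglongrightarrow> q A + q B"
      using that by (auto intro!: tendsto_add tends)
  qed (use that in auto)
  interpret sb: sigma_algebra UNIV "sets (borel :: 'a measure)"
    by (metis sets.sigma_algebra_axioms space_borel)
  have pos: "positive (sets borel) (\<lambda>A. ennreal (q A))"
    using qe by (simp add: positive_def)
  have ca: "countably_additive (sets (borel :: 'a measure)) (\<lambda>A. ennreal (q A))"
  proof (rule sb.empty_continuous_imp_countably_additive[OF pos])
    show "additive (sets borel) (\<lambda>A. ennreal (q A))"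
      by (auto simp: additive_def qadd q0)
    show "\<forall>A\<in>sets borel. ennreal (q A) \<noteq> \<infinity>" by simp
    fix A :: "nat \<Rightarrow> 'a set" assume A: "range A \<subseteq> sets borel" "decseq A" "(\<Inter>i. A i) = {}"
    have Ai: "A i \<in> sets borel" for i using A(1) by auto
    have "(\<lambda>i. q (A i)) \<longlonglongrightarrow> 0"
    proof (rule LIMSEQ_I)
      fix r :: real assume r: "0 < r"
      then obtain n where n: "\<bar>e n\<bar> < r / 2"
        using LIMSEQ_D[OF e, of "r / 2"] by auto
      have "(\<lambda>i. measure (\<mu> n) (A i)) \<longlonglongrightarrow> measure (\<mu> n) (\<Inter>i. A i)"
        using A \<mu> by (intro finite_measure.finite_Lim_measure_decseq) (auto simp: prob_space_def)
      then have "(\<lambda>i. measure (\<mu> n) (A i)) \<longlonglongrightarrow> 0" using A(3) by simp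
      then obtain N where N: "\<And>i. i \<ge> N \<Longrightarrow> \<bar>measure (\<mu> n) (A i)\<bar> < r / 2"
        using LIMSEQ_D[of _ 0 "r / 2"] r by (metis diff_zero half_gt_zero real_norm_def)
      show "\<exists>N. \<forall>i\<ge>N. norm (q (A i) - 0) < r"
      proof (intro exI allI impI)
        fix i assume "N \<le> i"
        then show "norm (q (A i) - 0) < r"
          using N[of i] n lim[OF Ai, of n i] unfolding real_norm_def by linarith
      qed
    qed
    then show "(\<lambda>i. ennreal (q (A i))) \<longlonglongrightarrow> 0"
      using tendsto_ennrealI by fastforce
  qed
  define \<pi> where "\<pi> = measure_of UNIV (sets (borel :: 'a measure)) (\<lambda>A. ennreal (q A))"
  have s: "sets \<pi> = sets borel"
    unfolding \<pi>_def by (metis sb.sets_measure_of_eq)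
  have em: "emeasure \<pi> A = ennreal (q A)" if "A \<in> sets borel" for A
    unfolding \<pi>_def using that
    by (rule emeasure_measure_of_sigma[OF sb.sigma_algebra_axioms pos ca])
  have "prob_space \<pi>"
    using em[of UNIV] q1 sets_eq_imp_space_eq[OF s] by (intro prob_spaceI) simp
  moreover have "measure \<pi> A = q A" if "A \<in> sets borel" for A
    using em[OF that] q0[OF that] by (simp add: measure_def)
  ultimately show ?thesis using s that by blast
qed

text \<open>
  Setwise convergence passes to integrals of bounded functions, by uniform approximation with
  staircase functions. It is used to see that the limit law is invariant and inherits the moment
  bounds of the chain.
\<close>

lemma setwise_limit_integral:
  fixes \<mu> :: "nat \<Rightarrow> 'a::topological_space measure"
  assumes \<mu>: "\<And>n. prob_space (\<mu> n)" "\<And>n. sets (\<mu> n) = sets borel"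
    and \<pi>: "prob_space \<pi>" "sets \<pi> = sets borel"
    and lim: "\<And>A. A \<in> sets borel \<Longrightarrow> (\<lambda>n. measure (\<mu> n) A) \<longlonglongrightarrow> measure \<pi> A"
    and g: "g \<in> borel_measurable borel" "\<And>x. 0 \<le> g x" "\<And>x. g x \<le> (1::real)"
  shows "(\<lambda>n. \<integral>x. g x \<partial>\<mu> n) \<longlonglongrightarrow> (\<integral>x. g x \<partial>\<pi>)"
proof -
  have ms [measurable]: "g \<in> borel_measurable borel" by fact
  define G where "G m x = (\<Sum>i=1..m. indicator {y. real i \<le> real m * g y} x) / real m" for m :: nat and x
  have Gm: "{y. real i \<le> real m * g y} \<in> sets borel" for i m by measurable
  \<comment> \<open>the staircase below \<open>g\<close> with steps of height \<open>1/m\<close>\<close>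
  have G: "\<bar>g x - G m x\<bar> \<le> 1 / real m" if m: "m > 0" for m x
  proof -
    have "{i \<in> {1..m}. real i \<le> real m * g x} = {1..nat \<lfloor>real m * g x\<rfloor>}"
    proof -
      have "real m * g x \<le> real m * 1" by (rule mult_left_mono) (use g in auto)
      then have "nat \<lfloor>real m * g x\<rfloor> \<le> m" by linarith
      have eq: "real i \<le> real m * g x \<longleftrightarrow> i \<le> nat \<lfloor>real m * g x\<rfloor>" for i
        using g(2)[of x] le_nat_floor[of i "real m * g x"] of_nat_floor[of "real m * g x"] 
        by (meson mult_nonneg_nonneg of_nat_0_le_iff of_nat_le_iff order_trans)
      show ?thesis unfolding eq using \<open>nat \<lfloor>real m * g x\<rfloor> \<le> m\<close>
        by (intro set_eqI) (simp only: mem_Collect_eq atLeastAtMost_iff, metis order_trans)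
    qed
    then have "(\<Sum>i=1..m. indicator {y. real i \<le> real m * g y} x) = real (nat \<lfloor>real m * g x\<rfloor>)"
      by (simp add: indicator_def sum.If_cases Int_def)
    then have "G m x = real (nat \<lfloor>real m * g x\<rfloor>) / real m" by (simp add: G_def)
    moreover have "\<bar>real m * g x - real (nat \<lfloor>real m * g x\<rfloor>)\<bar> \<le> 1"
    proof -
      have "0 \<le> real m * g x" using g(2)[of x] by simp
      then have "real (nat \<lfloor>real m * g x\<rfloor>) = of_int \<lfloor>real m * g x\<rfloor>" by simp
      then show ?thesis by linarith
    qed
    ultimately show ?thesis using m by (simp add: field_simps abs_le_iff)
  qed
  have iG: "integrable M (G m)" "integrable M g" "(\<integral>x. G m x \<partial>M) = (\<Sum>i=1..m. measure M {y. real i \<le> real m * g y}) / real m"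
    if M: "prob_space M" "sets M = sets borel" for M m
  proof -
    interpret prob_space M by fact
    have [measurable]: "{y. real i \<le> real m * g y} \<in> sets M" for i using M Gm by simp
    have i1: "integrable M (indicator {y. real i \<le> real m * g y} :: _ \<Rightarrow> real)" for i
      by (rule integrable_real_indicator) (auto simp: emeasure_eq_measure)
    show "integrable M (G m)" unfolding G_def by (intro integrable_divide_zero Bochner_Integration.integrable_sum i1)
    show "integrable M g" using g M by (intro integrable_const_bound[where B=1]) (auto cong: measurable_cong_sets)
    show "(\<integral>x. G m x \<partial>M) = (\<Sum>i=1..m. measure M {y. real i \<le> real m * g y}) / real m"
      unfolding G_def integral_divide_zero by (subst Bochner_Integration.integral_sum[OF i1]) simp
  qed
  have close: "\<bar>(\<integral>x. g x \<partial>M) - (\<integral>x. G m x \<partial>M)\<bar> \<le> 1 / real m"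
    if M: "prob_space M" "sets M = sets borel" and m: "m > 0" for M m
  proof -
    interpret prob_space M by fact
    have "(\<integral>x. g x \<partial>M) - (\<integral>x. G m x \<partial>M) = (\<integral>x. g x - G m x \<partial>M)"
      using iG[OF M] by simp
    also have "\<bar>\<dots>\<bar> \<le> (\<integral>x. \<bar>g x - G m x\<bar> \<partial>M)" by (rule integral_abs_bound)
    also have "\<dots> \<le> (\<integral>x. 1 / real m \<partial>M)"
      using iG(1)[OF M, of m] iG(2)[OF M] G[OF m] by (intro integral_mono) auto
    finally show ?thesis by (simp add: prob_space)
  qed
  show ?thesis
  proof (rule LIMSEQ_I)
    fix r :: real assume r: "0 < r"
    obtain k where "inverse (real (Suc k)) < r / 3"
      using reals_Archimedean[of "r / 3"] r by auto
    then have m: "Suc k > 0" "1 / real (Suc k) < r / 3" by (simp_all add: inverse_eq_divide)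
    have "(\<lambda>n. \<integral>x. G (Suc k) x \<partial>\<mu> n) \<longlonglongrightarrow> (\<integral>x. G (Suc k) x \<partial>\<pi>)"
      using m unfolding iG(3)[OF \<mu>] iG(3)[OF \<pi>] by (intro tendsto_intros lim Gm) auto
    then obtain N where N: "\<And>n. n \<ge> N \<Longrightarrow> \<bar>(\<integral>x. G (Suc k) x \<partial>\<mu> n) - (\<integral>x. G (Suc k) x \<partial>\<pi>)\<bar> < r / 3"
      using LIMSEQ_D[of _ _ "r / 3"] r by (metis divide_pos_pos real_norm_def zero_less_numeral)
    show "\<exists>N. \<forall>n\<ge>N. norm ((\<integral>x. g x \<partial>\<mu> n) - (\<integral>x. g x \<partial>\<pi>)) < r"
    proof (intro exI allI impI)
      fix n assume "N \<le> n"
      then show "norm ((\<integral>x. g x \<partial>\<mu> n) - (\<integral>x. g x \<partial>\<pi>)) < r"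
        using N[of n] close[OF \<mu>, of "Suc k" n] close[OF \<pi>, of "Suc k"] m unfolding real_norm_def by linarith
    qed
  qed
qed

text \<open>
  Harris' theorem after Hairer and Mattingly. The kernel contracts the seminorm
  \<open>sup |\<phi> x - \<phi> y| / (2 + b V x + b V y)\<close> by a factor \<open>r < 1\<close>: if \<open>V x + V y\<close> is large, the drift
  alone shrinks the weight; otherwise \<open>V x\<close> and \<open>V y\<close> are at most \<open>R\<close> and the minorisation gains
  more than the drift constant loses, provided that \<open>b\<close> is small. Applied to indicators, the
  contraction shows that the transition probabilities converge geometrically and uniformly over
  events to a limit that does not depend on the starting point.

  The invariant law is obtained from this limit, so no compactness of laws is involved. The moment
  bound follows from iterating the drift inequality from a zero \<open>z0\<close> of \<open>V\<close>, truncating \<open>V\<close> and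
  passing to the limit.
\<close>

lemma harris_theorem:
  fixes Q :: "'a::topological_space \<Rightarrow> 'a measure" and V :: "'a \<Rightarrow> real"
  assumes Q: "Q \<in> borel \<rightarrow>\<^sub>M prob_algebra borel"
    and V: "V \<in> borel_measurable borel" "\<And>x. 0 \<le> V x"
    and drift: "\<And>z. (\<integral>\<^sup>+y. ennreal (V y) \<partial>Q z) \<le> ennreal (\<rho> * V z + K)"
    and \<rho>: "0 \<le> \<rho>" "\<rho> < 1" and K: "0 \<le> K" and R: "2 * K / (1 - \<rho>) < R"
    and \<nu>: "sets \<nu> = sets borel" "0 < measure \<nu> UNIV"
    and minor: "\<And>z A. V z \<le> R \<Longrightarrow> A \<in> sets borel \<Longrightarrow> emeasure \<nu> A \<le> emeasure (Q z) A"
    and z0: "V z0 = 0"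
  shows "\<exists>\<pi>. unique_invariant_law Q \<pi> \<and> (\<integral>\<^sup>+y. ennreal (V y) \<partial>\<pi>) \<le> ennreal (K / (1 - \<rho>))"
proof -
  have Vm [measurable]: "V \<in> borel_measurable borel" by fact
  have Qp: "prob_space (Q z)" and Qs: "sets (Q z) = sets borel" for z
    using measurable_space[OF Q, of z] by (auto simp: space_prob_algebra)
  have QV: "integrable (Q z) V" "(\<integral>y. V y \<partial>Q z) \<le> \<rho> * V z + K" for z
  proof -
    have "(\<integral>\<^sup>+y. ennreal (V y) \<partial>Q z) < \<infinity>"
      using drift[of z] by (auto simp: less_top[symmetric] top_unique)
    then show i: "integrable (Q z) V"
      using V Qs by (intro integrableI_nonneg) (auto cong: measurable_cong_sets)
    have "ennreal (\<integral>y. V y \<partial>Q z) \<le> ennreal (\<rho> * V z + K)"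
      using drift[of z] nn_integral_eq_integral[OF i] V by simp
    then show "(\<integral>y. V y \<partial>Q z) \<le> \<rho> * V z + K"
      using \<rho> K V(2)[of z] by (simp add: ennreal_le_iff del: ennreal_plus)
  qed
  define m where "m = measure \<nu> UNIV"
  have m: "0 < m" using \<nu> by (simp add: m_def)
  \<comment> \<open>the drift constant then costs at most half of the gain \<open>2 m\<close> from the minorisation\<close>
  define b where "b = m / (2 * K + 1)"
  have b: "0 < b" "2 * b * K \<le> m"
    using m K by (auto simp: b_def field_simps)
  have R0: "0 < R" using R K \<rho> by (smt (verit) divide_nonneg_pos)
  define r where "r = Max {\<rho>, 1 - m / 2, (2 + 2 * b * K + b * \<rho> * R) / (2 + b * R)}"
  have r: "\<rho> \<le> r" "1 - m / 2 \<le> r" "(2 + 2 * b * K + b * \<rho> * R) / (2 + b * R) \<le> r"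
    by (auto simp: r_def)
  have r1: "r < 1"
  proof -
    have "2 * K < (1 - \<rho>) * R" using R \<rho> by (simp add: field_simps)
    then have "b * (2 * K) < b * ((1 - \<rho>) * R)" using b(1) by simp
    moreover have "0 < 2 + b * R" using b R0 by (simp add: add_pos_pos)
    ultimately show ?thesis using \<rho> m by (auto simp: r_def field_simps)
  qed
  have r0: "0 \<le> r" using \<rho> r by simp
  define osc where "osc c \<phi> \<longleftrightarrow> (\<forall>x y. \<bar>\<phi> x - \<phi> y\<bar> \<le> c * (2 + b * V x + b * V y))" for c and \<phi> :: "'a \<Rightarrow> real"
  have null: "sets (null_measure (borel::'a measure)) = sets borel" by simp
  have contraction: "osc (r * c) (\<lambda>z. \<integral>y. \<phi> y \<partial>Q z)"
    if \<phi>: "\<phi> \<in> borel_measurable borel" "\<And>x. \<bar>\<phi> x\<bar> \<le> 1" and o: "osc c \<phi>" and c: "0 \<le> c" for c \<phi>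
  proof -
    have o': "\<bar>\<phi> x - \<phi> y\<bar> \<le> c * (2 + b * V x + b * V y)" for x y
      using o by (simp add: osc_def)
    have one: "(\<integral>y. \<phi> y \<partial>Q z) - (\<integral>y. \<phi> y \<partial>Q z') \<le> r * c * (2 + b * V z + b * V z')" for z z'
    proof -
      let ?S = "V z + V z'"
      have S0: "0 \<le> ?S" using V by (simp add: add_nonneg_nonneg)
      have int: "b * (\<integral>x. V x \<partial>Q z) + b * (\<integral>x. V x \<partial>Q z') \<le> 2 * b * K + b * \<rho> * ?S"
        using mult_left_mono[OF QV(2)[of z], of b] mult_left_mono[OF QV(2)[of z'], of b] b
        by (simp add: algebra_simps)
      show ?thesis
      proof (cases "?S \<le> R")
        case True
        then have Vz: "V z \<le> R" "V z' \<le> R" using V(2)[of z] V(2)[of z'] by auto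
        have "(\<integral>y. \<phi> y \<partial>Q z) - (\<integral>y. \<phi> y \<partial>Q z') \<le>
            c * (2 + b * (\<integral>x. V x \<partial>Q z) + b * (\<integral>x. V x \<partial>Q z')) - 2 * c * measure \<nu> UNIV"
          by (rule weighted_oscillation_minorised[OF Qp Qp Qs Qs \<nu>(1) V QV(1) QV(1) \<phi> o' less_imp_le[OF b(1)] c])
             (use minor Vz in auto)
        also have "\<dots> = c * (2 + (b * (\<integral>x. V x \<partial>Q z) + b * (\<integral>x. V x \<partial>Q z')) - 2 * m)"
          by (simp add: m_def algebra_simps)
        also have "\<dots> \<le> c * (2 * (1 - m / 2) + \<rho> * (b * ?S))"
          using int b by (intro mult_left_mono c) (simp add: algebra_simps)
        also have "\<dots> \<le> c * (2 * r + r * (b * ?S))"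
          using r S0 b by (intro mult_left_mono c add_mono mult_right_mono) auto
        finally show ?thesis by (simp add: algebra_simps)
      next
        case False
        have "(\<integral>y. \<phi> y \<partial>Q z) - (\<integral>y. \<phi> y \<partial>Q z') \<le>
            c * (2 + b * (\<integral>x. V x \<partial>Q z) + b * (\<integral>x. V x \<partial>Q z')) - 2 * c * measure (null_measure (borel::'a measure)) UNIV"
          by (rule weighted_oscillation_minorised[OF Qp Qp Qs Qs null V QV(1) QV(1) \<phi> o' less_imp_le[OF b(1)] c])
             auto
        also have "\<dots> = c * (2 + (b * (\<integral>x. V x \<partial>Q z) + b * (\<integral>x. V x \<partial>Q z')))"
          by (simp add: measure_def)
        also have "\<dots> \<le> c * ((2 + 2 * b * K + b * \<rho> * R) + b * \<rho> * (?S - R))"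
          using int by (intro mult_left_mono c) (simp add: algebra_simps)
        also have "\<dots> \<le> c * (r * (2 + b * R) + b * r * (?S - R))"
        proof (intro mult_left_mono c add_mono mult_right_mono)
          show "2 + 2 * b * K + b * \<rho> * R \<le> r * (2 + b * R)"
            using r(3) b R0 by (simp add: divide_le_eq add_pos_pos)
        qed (use r b False in auto)
        finally show ?thesis by (simp add: algebra_simps)
      qed
    qed
    show ?thesis
      unfolding osc_def
    proof (intro allI)
      fix x y
      show "\<bar>(\<integral>y. \<phi> y \<partial>Q x) - (\<integral>z. \<phi> z \<partial>Q y)\<bar> \<le> r * c * (2 + b * V x + b * V y)"
        using one[of x y] one[of y x] by (simp add: abs_le_iff algebra_simps)
    qed
  qed
  define p where "p n A z = measure (apply_kernel Q n (dirac z)) A" for n A z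
  have AK: "apply_kernel Q n (dirac z) \<in> space (prob_algebra borel)" for n z
    by (rule apply_kernel_in_prob_algebra[OF Q dirac_in_prob_algebra])
  have AKp: "prob_space (apply_kernel Q n (dirac z))" and AKs: "sets (apply_kernel Q n (dirac z)) = sets borel" for n z
    using AK[of n z] by (auto simp: space_prob_algebra)
  have pm: "p n A \<in> borel_measurable borel" if "A \<in> sets borel" for n A
    unfolding p_def using measurable_apply_kernel_dirac[OF Q, of n] that
    by (rule measurable_compose[OF _ measurable_measure_prob_algebra])
  have pb: "0 \<le> p n A z" "p n A z \<le> 1" for n A z
    using prob_space.prob_le_1[OF AKp] by (auto simp: p_def)
  have pSuc: "p (Suc n) A = (\<lambda>z. \<integral>y. p n A y \<partial>Q z)" if "A \<in> sets borel" for n A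
    unfolding p_def using measure_apply_kernel_Suc[OF Q that] by auto
  have posc: "osc (r ^ n) (p n A)" if A: "A \<in> sets borel" for n A
  proof (induction n)
    case 0
    have "\<bar>p 0 A x - p 0 A y\<bar> \<le> 2 + b * V x + b * V y" for x y
    proof -
      have "\<bar>p 0 A x - p 0 A y\<bar> \<le> 1" using pb[of 0 A x] pb[of 0 A y] by (simp add: abs_le_iff)
      moreover have "0 \<le> b * V x" "0 \<le> b * V y" using b V by auto
      ultimately show ?thesis by linarith
    qed
    then show ?case by (simp add: osc_def)
  next
    case (Suc n)
    show ?case
      unfolding pSuc[OF A] power_Suc
      by (rule contraction[OF pm[OF A] _ Suc]) (use pb r0 in auto)
  qed
  define C where "C = 2 + b * K"
  have stp: "\<bar>p (Suc n) A z0 - p n A z0\<bar> \<le> C * r ^ n" if A: "A \<in> sets borel" for n A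
  proof -
    interpret prob_space "Q z0" by (rule Qp)
    have ip: "integrable (Q z0) (p n A)"
      using pm[OF A] pb Qs by (intro integrable_const_bound[where B=1]) (auto cong: measurable_cong_sets)
    have "p (Suc n) A z0 - p n A z0 = (\<integral>y. p n A y - p n A z0 \<partial>Q z0)"
      unfolding pSuc[OF A] using ip by (simp add: prob_space)
    also have "\<bar>\<dots>\<bar> \<le> (\<integral>y. \<bar>p n A y - p n A z0\<bar> \<partial>Q z0)" by (rule integral_abs_bound)
    also have "\<dots> \<le> (\<integral>y. r ^ n * (2 + b * V y + b * V z0) \<partial>Q z0)"
      using posc[OF A, of n] ip QV(1)[of z0] by (intro integral_mono) (auto simp: osc_def)
    also have "\<dots> = r ^ n * (2 + b * (\<integral>y. V y \<partial>Q z0))"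
      using QV(1)[of z0] z0 by (simp add: prob_space)
    also have "\<dots> \<le> r ^ n * C"
      using QV(2)[of z0] b r0 z0 by (intro mult_left_mono) (auto simp: C_def)
    finally show ?thesis by (simp add: mult.commute)
  qed
  define q where "q A = lim (\<lambda>n. p n A z0)" for A
  have pq: "\<bar>p n A z0 - q A\<bar> \<le> C / (1 - r) * r ^ n" if "A \<in> sets borel" for n A
    unfolding q_def by (rule geometric_steps_converge[OF stp[OF that] r0 r1])
  have rn: "(\<lambda>n. r ^ n) \<longlonglongrightarrow> 0" using r0 r1 by (intro LIMSEQ_realpow_zero) auto
  have e: "(\<lambda>n. C / (1 - r) * r ^ n) \<longlonglongrightarrow> 0"
    using tendsto_mult_right_zero[OF rn, of "C / (1 - r)"] by simp
  obtain \<pi> where \<pi>: "prob_space \<pi>" "sets \<pi> = sets borel" "\<And>A. A \<in> sets borel \<Longrightarrow> measure \<pi> A = q A"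
    using uniform_setwise_limit_is_prob[OF AKp[of _ z0] AKs[of _ z0] pq[unfolded p_def] e] by metis
  have \<pi>P: "\<pi> \<in> space (prob_algebra borel)" using \<pi> by (simp add: space_prob_algebra)
  have lim0: "(\<lambda>n. measure (apply_kernel Q n (dirac z0)) A) \<longlonglongrightarrow> measure \<pi> A" if "A \<in> sets borel" for A
  proof -
    have "(\<lambda>n. p n A z0 - q A) \<longlonglongrightarrow> 0"
      by (rule Lim_null_comparison[OF _ e]) (use pq[OF that] in auto)
    then show ?thesis using \<pi>(3)[OF that] by (simp add: LIM_zero_iff p_def)
  qed
  have limz: "(\<lambda>n. p n A z) \<longlonglongrightarrow> measure \<pi> A" if A: "A \<in> sets borel" for A z
  proof -
    have "(\<lambda>n. p n A z - p n A z0) \<longlonglongrightarrow> 0"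
    proof (rule Lim_null_comparison)
      show "\<forall>\<^sub>F n in sequentially. norm (p n A z - p n A z0) \<le> r ^ n * (2 + b * V z + b * V z0)"
        using posc[OF A] by (auto simp: osc_def)
      show "(\<lambda>n. r ^ n * (2 + b * V z + b * V z0)) \<longlonglongrightarrow> 0"
        by (rule tendsto_mult_left_zero[OF rn])
    qed
    from tendsto_add[OF this lim0[OF A]] show ?thesis by (simp add: p_def)
  qed
  have inv: "\<pi> \<bind> Q = \<pi>"
  proof (rule measure_eqI)
    show "sets (\<pi> \<bind> Q) = sets \<pi>" using sets_bind'[OF \<pi>P Q] \<pi>(2) by simp
    fix A assume "A \<in> sets (\<pi> \<bind> Q)"
    then have A: "A \<in> sets borel" using sets_bind'[OF \<pi>P Q] by simp
    interpret \<pi>: prob_space \<pi> by fact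
    interpret \<pi>Q: prob_space "\<pi> \<bind> Q" by (rule prob_space_bind'[OF \<pi>P Q])
    have Qm: "(\<lambda>y. measure (Q y) A) \<in> borel_measurable borel"
      by (rule measurable_compose[OF Q measurable_measure_prob_algebra[OF A]])
    have QN: "Q \<in> N \<rightarrow>\<^sub>M subprob_algebra borel" if "sets N = sets borel" for N :: "'a measure"
      using measurable_prob_algebraD[OF Q] that by (simp cong: measurable_cong_sets)
    have "(\<lambda>n. \<integral>y. measure (Q y) A \<partial>apply_kernel Q n (dirac z0)) \<longlonglongrightarrow> (\<integral>y. measure (Q y) A \<partial>\<pi>)"
      by (rule setwise_limit_integral[OF AKp AKs \<pi>(1,2) lim0 Qm]) (auto simp: prob_space.prob_le_1[OF Qp])
    also have "(\<lambda>n. \<integral>y. measure (Q y) A \<partial>apply_kernel Q n (dirac z0)) = (\<lambda>n. p (Suc n) A z0)"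
      unfolding p_def apply_kernel_Suc
      by (intro ext subprob_space.measure_bind[OF _ QN A, symmetric] prob_space_imp_subprob_space AKp AKs)
    finally have "measure \<pi> A = (\<integral>y. measure (Q y) A \<partial>\<pi>)"
      using LIMSEQ_unique[OF LIMSEQ_Suc[OF limz[OF A, of z0]]] by blast
    also have "\<dots> = measure (\<pi> \<bind> Q) A"
      by (intro subprob_space.measure_bind[OF _ QN A, symmetric] prob_space_imp_subprob_space \<pi>)
    finally show "emeasure (\<pi> \<bind> Q) A = emeasure \<pi> A"
      by (simp add: \<pi>.emeasure_eq_measure \<pi>Q.emeasure_eq_measure)
  qed
  have uniq: "\<pi>' = \<pi>" if "invariant_law Q \<pi>'" for \<pi>'
  proof (rule measure_eqI)
    have \<pi>': "prob_space \<pi>'" "sets \<pi>' = sets borel" "\<pi>' \<bind> Q = \<pi>'"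
      using that by (auto simp: invariant_law_def)
    then have \<pi>'P: "\<pi>' \<in> space (prob_algebra borel)" by (simp add: space_prob_algebra)
    show "sets \<pi>' = sets \<pi>" using \<pi> \<pi>' by simp
    fix A assume "A \<in> sets \<pi>'"
    then have A: "A \<in> sets borel" using \<pi>' by simp
    interpret \<pi>: prob_space \<pi> by fact
    interpret \<pi>': prob_space \<pi>' by fact
    have it: "apply_kernel Q n \<pi>' = \<pi>'" for n by (induction n) (simp_all add: apply_kernel_Suc \<pi>')
    have KN: "(\<lambda>z. apply_kernel Q n (dirac z)) \<in> \<pi>' \<rightarrow>\<^sub>M subprob_algebra borel" for n
      using measurable_prob_algebraD[OF measurable_apply_kernel_dirac[OF Q]] \<pi>' by (simp cong: measurable_cong_sets)
    have c: "(\<integral>z. p n A z \<partial>\<pi>') = measure \<pi>' A" for n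
      using \<pi>'.measure_bind[OF KN[of n] A] kernel_power_mixture[OF Q \<pi>'P, of n] it[of n] by (simp add: p_def)
    have "(\<lambda>n. \<integral>z. p n A z \<partial>\<pi>') \<longlonglongrightarrow> (\<integral>z. measure \<pi> A \<partial>\<pi>')"
      by (rule integral_dominated_convergence[where w="\<lambda>_. 1"])
         (use pm[OF A] \<pi>' limz[OF A] pb in \<open>auto cong: measurable_cong_sets\<close>)
    then have "measure \<pi>' A = measure \<pi> A"
      unfolding c by (simp add: LIMSEQ_const_iff \<pi>'.prob_space)
    then show "emeasure \<pi>' A = emeasure \<pi> A"
      by (simp add: \<pi>.emeasure_eq_measure \<pi>'.emeasure_eq_measure)
  qed
  have driftn: "(\<integral>\<^sup>+y. ennreal (V y) \<partial>apply_kernel Q n (dirac z0)) \<le> ennreal (K / (1 - \<rho>))" for n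
  proof (induction n)
    case 0
    show ?case by (simp add: nn_integral_return z0)
  next
    case (Suc n)
    have QN: "Q \<in> apply_kernel Q n (dirac z0) \<rightarrow>\<^sub>M subprob_algebra borel"
      using measurable_prob_algebraD[OF Q] AKs by (simp cong: measurable_cong_sets)
    have Vn: "(\<lambda>y. ennreal (V y)) \<in> borel_measurable (apply_kernel Q n (dirac z0))"
      using AKs by (simp cong: measurable_cong_sets)
    interpret AK: prob_space "apply_kernel Q n (dirac z0)" by (rule AKp)
    have "(\<integral>\<^sup>+y. ennreal (V y) \<partial>apply_kernel Q (Suc n) (dirac z0))
        = (\<integral>\<^sup>+z. \<integral>\<^sup>+y. ennreal (V y) \<partial>Q z \<partial>apply_kernel Q n (dirac z0))"
      unfolding apply_kernel_Suc by (rule nn_integral_bind[OF _ QN]) simp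
    also have "\<dots> \<le> (\<integral>\<^sup>+z. ennreal \<rho> * ennreal (V z) + ennreal K \<partial>apply_kernel Q n (dirac z0))"
      using drift \<rho> K V by (intro nn_integral_mono) (auto simp: ennreal_mult[symmetric] ennreal_plus[symmetric] simp del: ennreal_plus)
    also have "\<dots> = ennreal \<rho> * (\<integral>\<^sup>+z. ennreal (V z) \<partial>apply_kernel Q n (dirac z0)) + ennreal K"
      using Vn by (simp add: nn_integral_add nn_integral_cmult AK.emeasure_space_1)
    also have "\<dots> \<le> ennreal \<rho> * ennreal (K / (1 - \<rho>)) + ennreal K"
      by (intro add_mono mult_left_mono Suc) auto
    also have "\<dots> = ennreal (\<rho> * (K / (1 - \<rho>)) + K)"
      using \<rho> K by (simp add: ennreal_mult[symmetric] ennreal_plus[symmetric] del: ennreal_plus)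
    also have "\<rho> * (K / (1 - \<rho>)) + K = K / (1 - \<rho>)"
      using \<rho> by (simp add: field_simps)
    finally show ?case .
  qed
  have moment: "(\<integral>\<^sup>+y. ennreal (V y) \<partial>\<pi>) \<le> ennreal (K / (1 - \<rho>))"
  proof -
    interpret \<pi>: prob_space \<pi> by fact
    have trunc: "(\<integral>\<^sup>+y. ennreal (min (V y) (real i)) \<partial>\<pi>) \<le> ennreal (K / (1 - \<rho>))" for i :: nat
    proof (cases "i = 0")
      case True
      then show ?thesis using V by (simp add: min_absorb2)
    next
      case False
      let ?g = "\<lambda>y. min (V y) (real i) / real i"
      have g: "?g \<in> borel_measurable borel" "0 \<le> ?g y" "?g y \<le> 1" for y
        using False V by (auto simp: divide_le_eq)
      have ig: "integrable N ?g" if "prob_space N" "sets N = sets borel" for N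
      proof (rule finite_measure.integrable_const_bound[where B=1])
        show "finite_measure N" using that by (simp add: prob_space_def)
        show "AE y in N. norm (?g y) \<le> 1" using g V by (intro AE_I2) (simp only: real_norm_def abs_le_iff, smt (verit))
        show "?g \<in> borel_measurable N" using g that by (simp cong: measurable_cong_sets)
      qed
      have iN: "ennreal (real i * (\<integral>y. ?g y \<partial>N)) = (\<integral>\<^sup>+y. ennreal (real i * ?g y) \<partial>N)"
        if "prob_space N" "sets N = sets borel" for N
        using nn_integral_eq_integral[OF integrable_mult_right[OF ig[OF that], of "real i"] AE_I2[OF mult_nonneg_nonneg[OF of_nat_0_le_iff g(2)]]]
        by (simp only: integral_mult_right_zero)
      have "real i * (\<integral>y. ?g y \<partial>apply_kernel Q n (dirac z0)) \<le> K / (1 - \<rho>)" for n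
      proof -
        have "ennreal (real i * (\<integral>y. ?g y \<partial>apply_kernel Q n (dirac z0))) = (\<integral>\<^sup>+y. ennreal (real i * ?g y) \<partial>apply_kernel Q n (dirac z0))"
          using iN[OF AKp AKs] .
        also have "\<dots> \<le> (\<integral>\<^sup>+y. ennreal (V y) \<partial>apply_kernel Q n (dirac z0))"
          using False by (intro nn_integral_mono ennreal_leI) auto
        also note driftn[of n]
        finally show ?thesis using K \<rho> by (simp add: ennreal_le_iff)
      qed
      moreover have "(\<lambda>n. real i * (\<integral>y. ?g y \<partial>apply_kernel Q n (dirac z0))) \<longlonglongrightarrow> real i * (\<integral>y. ?g y \<partial>\<pi>)"
        by (intro tendsto_mult_left setwise_limit_integral[OF AKp AKs \<pi>(1,2) lim0 g]) auto
      ultimately have "real i * (\<integral>y. ?g y \<partial>\<pi>) \<le> K / (1 - \<rho>)"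
        by (intro LIMSEQ_le_const2) auto
      moreover have "(\<integral>\<^sup>+y. ennreal (min (V y) (real i)) \<partial>\<pi>) = ennreal (real i * (\<integral>y. ?g y \<partial>\<pi>))"
      proof -
        have "ennreal (real i * (\<integral>y. ?g y \<partial>\<pi>)) = (\<integral>\<^sup>+y. ennreal (real i * ?g y) \<partial>\<pi>)"
          using iN[OF \<pi>(1,2)] .
        then show ?thesis using False by simp
      qed
      ultimately show ?thesis by (simp add: ennreal_leI)
    qed
    have "(\<integral>\<^sup>+y. ennreal (V y) \<partial>\<pi>) = (\<integral>\<^sup>+y. (SUP i. ennreal (min (V y) (real i))) \<partial>\<pi>)"
    proof (rule nn_integral_cong)
      fix y
      show "ennreal (V y) = (SUP i. ennreal (min (V y) (real i)))"
      proof (rule antisym)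
        obtain i where "V y \<le> real i" using real_arch_simple by blast
        then show "ennreal (V y) \<le> (SUP i. ennreal (min (V y) (real i)))"
          by (intro SUP_upper2[of i]) auto
      qed (auto intro!: SUP_least ennreal_leI)
    qed
    also have "\<dots> = (SUP i. \<integral>\<^sup>+y. ennreal (min (V y) (real i)) \<partial>\<pi>)"
    proof (rule nn_integral_monotone_convergence_SUP)
      show "incseq (\<lambda>i y. ennreal (min (V y) (real i)))"
        by (intro incseq_SucI le_funI ennreal_leI min.mono) auto
      show "(\<lambda>y. ennreal (min (V y) (real i))) \<in> borel_measurable \<pi>" for i :: nat
        unfolding measurable_cong_sets[OF \<pi>(2) refl] by simp
    qed
    also have "\<dots> \<le> ennreal (K / (1 - \<rho>))" by (rule SUP_least) (rule trunc)
    finally show ?thesis .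
  qed
  have "unique_invariant_law Q \<pi>"
    using \<pi>(1,2) inv uniq unfolding unique_invariant_law_def invariant_law_def by blast
  with moment show ?thesis by blast
qed

text \<open>
  One step of a chain driven by noise in half of the coordinates has a singular law, so the
  minorisation is only available for two steps. Uniqueness for the squared kernel transfers
  invariance back to the kernel itself.
\<close>

lemma harris_theorem_two_step:
  fixes Q :: "'a::topological_space \<Rightarrow> 'a measure" and V :: "'a \<Rightarrow> real"
  assumes Q: "Q \<in> borel \<rightarrow>\<^sub>M prob_algebra borel"
    and V: "V \<in> borel_measurable borel" "\<And>x. 0 \<le> V x"
    and drift: "\<And>z. (\<integral>\<^sup>+y. ennreal (V y) \<partial>Q z) \<le> ennreal (\<rho> * V z + K)"
    and \<rho>: "0 \<le> \<rho>" "\<rho> < 1" and K: "0 \<le> K"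
    and minor: "\<And>R. \<exists>\<nu>. sets \<nu> = sets borel \<and> 0 < measure \<nu> UNIV \<and>
      (\<forall>z A. V z \<le> R \<longrightarrow> A \<in> sets borel \<longrightarrow> emeasure \<nu> A \<le> emeasure (Q z \<bind> Q) A)"
    and z0: "V z0 = 0"
  shows "\<exists>\<pi>. unique_invariant_law Q \<pi> \<and> (\<integral>\<^sup>+y. ennreal (V y) \<partial>\<pi>) \<le> ennreal (K / (1 - \<rho>))"
proof -
  let ?Q2 = "\<lambda>z. Q z \<bind> Q"
  have Vm [measurable]: "V \<in> borel_measurable borel" by fact
  have Qz: "Q z \<in> space (prob_algebra borel)" for z using measurable_space[OF Q, of z] by simp
  have Q2: "?Q2 \<in> borel \<rightarrow>\<^sub>M prob_algebra borel"
    by (rule measurable_bind_prob_space[OF Q Q])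
  have QN: "Q \<in> N \<rightarrow>\<^sub>M subprob_algebra borel" if "sets N = sets borel" for N :: "'a measure"
    using measurable_prob_algebraD[OF Q] that by (simp cong: measurable_cong_sets)
  have drift2: "(\<integral>\<^sup>+y. ennreal (V y) \<partial>?Q2 z) \<le> ennreal (\<rho>\<^sup>2 * V z + (1 + \<rho>) * K)" for z
  proof -
    interpret Qz: prob_space "Q z" using Qz by (simp add: space_prob_algebra)
    have Qs: "sets (Q z) = sets borel" using Qz by (simp add: space_prob_algebra)
    have "(\<integral>\<^sup>+y. ennreal (V y) \<partial>?Q2 z) = (\<integral>\<^sup>+x. \<integral>\<^sup>+y. ennreal (V y) \<partial>Q x \<partial>Q z)"
      by (rule nn_integral_bind[OF _ QN[OF Qs]]) simp
    also have "\<dots> \<le> (\<integral>\<^sup>+x. ennreal \<rho> * ennreal (V x) + ennreal K \<partial>Q z)"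
      using drift \<rho> K V by (intro nn_integral_mono) (auto simp: ennreal_mult[symmetric] ennreal_plus[symmetric] simp del: ennreal_plus)
    also have "\<dots> = ennreal \<rho> * (\<integral>\<^sup>+x. ennreal (V x) \<partial>Q z) + ennreal K"
      using Qs by (simp add: nn_integral_add nn_integral_cmult Qz.emeasure_space_1 cong: measurable_cong_sets)
    also have "\<dots> \<le> ennreal \<rho> * ennreal (\<rho> * V z + K) + ennreal K"
      by (intro add_mono mult_left_mono drift) auto
    also have "\<dots> = ennreal (\<rho> * (\<rho> * V z + K) + K)"
      using \<rho> K V(2)[of z] by (simp add: ennreal_mult[symmetric] ennreal_plus[symmetric] del: ennreal_plus)
    finally show ?thesis by (simp add: algebra_simps power2_eq_square)
  qed
  obtain \<nu> where \<nu>: "sets \<nu> = sets borel" "0 < measure \<nu> UNIV"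
    "\<And>z A. V z \<le> 2 * ((1 + \<rho>) * K) / (1 - \<rho>\<^sup>2) + 1 \<Longrightarrow> A \<in> sets borel \<Longrightarrow> emeasure \<nu> A \<le> emeasure (?Q2 z) A"
    using minor by metis
  have \<rho>2: "0 \<le> \<rho>\<^sup>2" "\<rho>\<^sup>2 < 1" using \<rho> by (auto simp: power_less_one_iff abs_square_less_1)
  have K2: "0 \<le> (1 + \<rho>) * K" using \<rho> K by simp
  obtain \<pi> where \<pi>: "unique_invariant_law ?Q2 \<pi>" "(\<integral>\<^sup>+y. ennreal (V y) \<partial>\<pi>) \<le> ennreal ((1 + \<rho>) * K / (1 - \<rho>\<^sup>2))"
    using harris_theorem[OF Q2 V drift2 \<rho>2 K2 less_add_one[of "2 * ((1 + \<rho>) * K) / (1 - \<rho>\<^sup>2)"] \<nu> z0] by blast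
  have eq: "(1 + \<rho>) * K / (1 - \<rho>\<^sup>2) = K / (1 - \<rho>)"
  proof -
    have "1 - \<rho>\<^sup>2 = (1 + \<rho>) * (1 - \<rho>)" by (simp add: algebra_simps power2_eq_square)
    then show ?thesis using \<rho> by simp
  qed
  have bb: "\<mu> \<bind> ?Q2 = (\<mu> \<bind> Q) \<bind> Q" if "sets \<mu> = sets borel" for \<mu>
    by (rule bind_assoc[symmetric, OF QN[OF that] measurable_prob_algebraD[OF Q]])
  have \<pi>i: "prob_space \<pi>" "sets \<pi> = sets borel" "\<pi> \<bind> ?Q2 = \<pi>"
    using \<pi> by (auto simp: unique_invariant_law_def invariant_law_def)
  have "invariant_law ?Q2 (\<pi> \<bind> Q)"
  proof -
    have P: "\<pi> \<in> space (prob_algebra borel)" using \<pi>i by (simp add: space_prob_algebra)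
    have s: "sets (\<pi> \<bind> Q) = sets borel" using sets_bind'[OF P Q] by simp
    have "(\<pi> \<bind> Q) \<bind> ?Q2 = ((\<pi> \<bind> Q) \<bind> Q) \<bind> Q" by (rule bb[OF s])
    also have "(\<pi> \<bind> Q) \<bind> Q = \<pi>" using bb[OF \<pi>i(2)] \<pi>i(3) by simp
    finally show ?thesis using prob_space_bind'[OF P Q] s by (simp add: invariant_law_def)
  qed
  then have "\<pi> \<bind> Q = \<pi>" using \<pi>(1) unfolding unique_invariant_law_def by blast
  moreover have "\<pi>' = \<pi>" if "invariant_law Q \<pi>'" for \<pi>'
  proof -
    have "invariant_law ?Q2 \<pi>'"
      using that bb[of \<pi>'] by (simp add: invariant_law_def)
    then show ?thesis using \<pi>(1) unfolding unique_invariant_law_def by blast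
  qed
  ultimately have "unique_invariant_law Q \<pi>"
    using \<pi>i(1,2) unfolding unique_invariant_law_def invariant_law_def by blast
  then show ?thesis using \<pi>(2) eq by auto
qed

section \<open>The standard Gaussian\<close>

lemma sets_std_gaussian [simp, measurable_cong]: "sets std_gaussian = sets borel"
  and space_std_gaussian [simp]: "space std_gaussian = UNIV"
  by (simp_all add: std_gaussian_def)

lemma nn_integral_std_normal_density: "(\<integral>\<^sup>+x. ennreal (std_normal_density x) \<partial>lborel) = 1"
proof -
  interpret prob_space "density lborel (\<lambda>x. ennreal (std_normal_density x))"
    by (rule prob_space_normal_density) simp
  show ?thesis using emeasure_space_1 by (simp add: emeasure_density)
qed

lemma nn_integral_std_normal_square:
  "(\<integral>\<^sup>+x. ennreal (std_normal_density x * x\<^sup>2) \<partial>lborel) = 1"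
proof -
  have "has_bochner_integral lborel (\<lambda>x. std_normal_density x * x\<^sup>2) 1"
    using std_normal_moment_even[of 1] by (simp add: numeral_2_eq_2)
  then show ?thesis
    by (subst nn_integral_eq_integral) (auto simp: has_bochner_integral_iff)
qed

abbreviation (input) gauss :: "'a::euclidean_space \<Rightarrow> ennreal" where
  "gauss x \<equiv> \<Prod>b\<in>Basis. ennreal (std_normal_density (x \<bullet> b))"

lemma nn_integral_std_gaussian:
  assumes "g \<in> borel_measurable borel"
  shows "(\<integral>\<^sup>+x. g x \<partial>std_gaussian)
    = (\<integral>\<^sup>+x. gauss x * g x \<partial>lborel)"
  using assms unfolding std_gaussian_def
  by (subst nn_integral_density) (auto simp: prod_ennreal)

lemma prob_space_std_gaussian: "prob_space (std_gaussian :: 'a::euclidean_space measure)"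
proof (rule prob_spaceI)
  have "emeasure (std_gaussian :: 'a measure) UNIV = (\<integral>\<^sup>+x. 1 \<partial>(std_gaussian :: 'a measure))" by simp
  also have "\<dots> = 1"
    using nn_integral_lborel_prod[of "\<lambda>(_::'a) x. ennreal (std_normal_density x)"]
    by (subst nn_integral_std_gaussian) (simp_all add: nn_integral_std_normal_density)
  finally show "emeasure (std_gaussian :: 'a measure) (space std_gaussian) = 1" by simp
qed

lemma std_gaussian_second_moment:
  "(\<integral>\<^sup>+x. ennreal ((norm x)\<^sup>2) \<partial>(std_gaussian :: 'a::euclidean_space measure)) = ennreal (real DIM('a))"
proof -
  let ?f = "\<lambda>i (b::'a) y. ennreal (if b = i then std_normal_density y * y\<^sup>2 else std_normal_density y)"
  have "(\<integral>\<^sup>+x. ennreal ((norm x)\<^sup>2) \<partial>(std_gaussian :: 'a measure))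
      = (\<integral>\<^sup>+x. gauss x * ennreal ((norm x)\<^sup>2) \<partial>(lborel :: 'a measure))"
    by (rule nn_integral_std_gaussian) simp
  also have "\<dots> = (\<integral>\<^sup>+x. (\<Sum>i\<in>Basis. \<Prod>b\<in>Basis. ?f i b (x \<bullet> b)) \<partial>(lborel :: 'a measure))"
  proof (rule nn_integral_cong)
    fix x :: 'a
    have "(norm x)\<^sup>2 = (\<Sum>i\<in>Basis. (x \<bullet> i)\<^sup>2)"
      unfolding power2_norm_eq_inner by (subst euclidean_inner) (simp add: power2_eq_square)
    then have n2: "ennreal ((norm x)\<^sup>2) = (\<Sum>i\<in>Basis. ennreal ((x \<bullet> i)\<^sup>2))"
      by (simp only: sum_ennreal[OF zero_le_power2])
    have "gauss x * ennreal ((norm x)\<^sup>2)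
        = (\<Sum>i\<in>Basis. gauss x * ennreal ((x \<bullet> i)\<^sup>2))"
      unfolding n2 by (rule sum_distrib_left)
    also have "\<dots> = (\<Sum>i\<in>Basis. \<Prod>b\<in>Basis. ?f i b (x \<bullet> b))"
    proof (rule sum.cong[OF refl])
      fix i :: 'a assume i: "i \<in> Basis"
      show "gauss x * ennreal ((x \<bullet> i)\<^sup>2) = (\<Prod>b\<in>Basis. ?f i b (x \<bullet> b))"
        using i by (simp add: prod.remove[OF finite_Basis i] ennreal_mult mult_ac)
    qed
    finally show "gauss x * ennreal ((norm x)\<^sup>2) = \<dots>" .
  qed
  also have "\<dots> = (\<Sum>i\<in>(Basis::'a set). \<integral>\<^sup>+x. (\<Prod>b\<in>Basis. ?f i b (x \<bullet> b)) \<partial>(lborel :: 'a measure))"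
    by (rule nn_integral_sum) simp
  also have "\<dots> = (\<Sum>i\<in>(Basis::'a set). 1)"
  proof (rule sum.cong[OF refl])
    fix i :: 'a assume i: "i \<in> Basis"
    have "(\<integral>\<^sup>+x. (\<Prod>b\<in>Basis. ?f i b (x \<bullet> b)) \<partial>(lborel :: 'a measure))
      = (\<Prod>b\<in>(Basis::'a set). \<integral>\<^sup>+y. ?f i b y \<partial>lborel)"
      by (rule nn_integral_lborel_prod) auto
    also have "\<dots> = (\<Prod>b\<in>(Basis::'a set). 1)"
    proof (rule prod.cong[OF refl])
      fix b :: 'a
      show "(\<integral>\<^sup>+y. ?f i b y \<partial>lborel) = 1"
        by (cases "b = i") (simp_all add: nn_integral_std_normal_density nn_integral_std_normal_square)
    qed
    finally show "(\<integral>\<^sup>+x. (\<Prod>b\<in>Basis. ?f i b (x \<bullet> b)) \<partial>(lborel :: 'a measure)) = 1"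
      by simp
  qed
  finally show ?thesis by (simp add: ennreal_of_nat_eq_real_of_nat)
qed

lemma std_gaussian_tail:
  assumes "0 < R"
  shows "measure (std_gaussian :: 'a::euclidean_space measure) {\<xi>. R \<le> norm \<xi>} \<le> real DIM('a) / R\<^sup>2"
proof -
  interpret prob_space "std_gaussian :: 'a measure" by (rule prob_space_std_gaussian)
  have "emeasure (std_gaussian :: 'a measure) {\<xi>. R \<le> norm \<xi>}
      = (\<integral>\<^sup>+\<xi>. indicator {\<xi>. R \<le> norm \<xi>} \<xi> \<partial>(std_gaussian :: 'a measure))"
    by (rule nn_integral_indicator[symmetric]) simp
  also have "\<dots> \<le> (\<integral>\<^sup>+\<xi>. ennreal (1 / R\<^sup>2) * ennreal ((norm \<xi>)\<^sup>2) \<partial>(std_gaussian :: 'a measure))"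
  proof (rule nn_integral_mono)
    fix \<xi> :: 'a
    show "indicator {\<xi>. R \<le> norm \<xi>} \<xi> \<le> ennreal (1 / R\<^sup>2) * ennreal ((norm \<xi>)\<^sup>2)"
    proof (cases "R \<le> norm \<xi>")
      case True
      then have "R\<^sup>2 \<le> (norm \<xi>)\<^sup>2" using assms by (intro power_mono) auto
      then have "1 \<le> 1 / R\<^sup>2 * (norm \<xi>)\<^sup>2" using assms by (simp add: field_simps)
      then show ?thesis using True by (simp add: ennreal_mult[symmetric] flip: ennreal_1)
    qed simp
  qed
  also have "\<dots> = ennreal (1 / R\<^sup>2) * ennreal (real DIM('a))"
    by (subst nn_integral_cmult) (auto simp: std_gaussian_second_moment)
  also have "\<dots> = ennreal (real DIM('a) / R\<^sup>2)" by (simp add: ennreal_mult[symmetric])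
  finally show ?thesis by (simp add: emeasure_eq_measure ennreal_le_iff)
qed

text \<open>
  Affine images of the Gaussian have a density that is bounded below on a given ball, uniformly as
  long as the mean stays bounded. This is the only information on the noise that enters the
  minorisation.
\<close>

lemma std_gaussian_affine_lower_bound:
  fixes X :: "'a::euclidean_space"
  assumes t: "t \<noteq> 0"
  shows "\<exists>\<epsilon>>0. \<forall>m g. norm m \<le> M \<longrightarrow> g \<in> borel_measurable borel \<longrightarrow>
     ennreal \<epsilon> * (\<integral>\<^sup>+y. g y * indicator (ball X r) y \<partial>lborel) \<le> (\<integral>\<^sup>+\<xi>. g (m + t *\<^sub>R \<xi>) \<partial>std_gaussian)"
proof -
  define M' where "M' = (norm X + \<bar>r\<bar> + M) / \<bar>t\<bar>"
  define \<delta> where "\<delta> = (std_normal_density M') ^ DIM('a)"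
  have \<delta>: "0 < \<delta>" by (simp add: \<delta>_def normal_density_pos)
  show ?thesis
  proof (intro exI conjI allI impI)
    show "0 < \<delta> / \<bar>t\<bar> ^ DIM('a)" using \<delta> t by simp
    fix m :: 'a and g :: "'a \<Rightarrow> ennreal" assume m: "norm m \<le> M" and g [measurable]: "g \<in> borel_measurable borel"
    have [measurable]: "ball X r \<in> sets borel" by simp
    have dens: "ennreal \<delta> * indicator (ball X r) (m + t *\<^sub>R x) \<le> gauss x" for x
    proof (cases "m + t *\<^sub>R x \<in> ball X r")
      case True
      have "\<bar>t\<bar> * norm x = norm ((m + t *\<^sub>R x - X) + (X - m))" by simp
      also have "\<dots> \<le> norm (m + t *\<^sub>R x - X) + (norm X + norm m)"
        by (intro norm_triangle_le add_mono norm_triangle_ineq4) auto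
      also have "\<dots> \<le> norm X + \<bar>r\<bar> + M" using True m by (simp add: dist_norm norm_minus_commute)
      finally have x: "norm x \<le> M'" using t by (simp add: M'_def pos_le_divide_eq mult.commute)
      have "\<delta> = (\<Prod>b\<in>(Basis::'a set). std_normal_density M')" by (simp add: \<delta>_def)
      also have "\<dots> \<le> (\<Prod>b\<in>Basis. std_normal_density (x \<bullet> b))"
      proof (rule prod_mono, safe)
        fix b :: 'a assume "b \<in> Basis"
        then have "\<bar>x \<bullet> b\<bar> \<le> M'" using Basis_le_norm[of b x] x by simp
        then have "(x \<bullet> b)\<^sup>2 \<le> M'\<^sup>2" using abs_le_square_iff[of "x \<bullet> b" M'] by simp
        then show "std_normal_density M' \<le> std_normal_density (x \<bullet> b)"
          by (simp add: std_normal_density_def divide_right_mono)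
      qed simp
      finally have "ennreal \<delta> \<le> ennreal (\<Prod>b\<in>Basis. std_normal_density (x \<bullet> b))" by (rule ennreal_leI)
      then show ?thesis using True by (simp add: prod_ennreal)
    qed simp
    have "(\<integral>\<^sup>+y. g y * indicator (ball X r) y \<partial>lborel)
        = (\<integral>\<^sup>+y. g y * indicator (ball X r) y \<partial>density (distr lborel borel (\<lambda>x. m + t *\<^sub>R x)) (\<lambda>_. \<bar>t\<bar>^DIM('a)))"
      using lborel_affine[OF t, of m] by simp
    also have "\<dots> = (\<integral>\<^sup>+y. ennreal (\<bar>t\<bar>^DIM('a)) * (g y * indicator (ball X r) y) \<partial>distr lborel borel (\<lambda>x. m + t *\<^sub>R x))"
      by (rule nn_integral_density) measurable
    also have "\<dots> = (\<integral>\<^sup>+x. ennreal (\<bar>t\<bar>^DIM('a)) * (g (m + t *\<^sub>R x) * indicator (ball X r) (m + t *\<^sub>R x)) \<partial>lborel)"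
      by (rule nn_integral_distr) measurable
    finally have eq: "(\<integral>\<^sup>+y. g y * indicator (ball X r) y \<partial>lborel)
       = (\<integral>\<^sup>+x. ennreal (\<bar>t\<bar>^DIM('a)) * (g (m + t *\<^sub>R x) * indicator (ball X r) (m + t *\<^sub>R x)) \<partial>lborel)" .
    have "ennreal (\<delta> / \<bar>t\<bar> ^ DIM('a)) * (\<integral>\<^sup>+y. g y * indicator (ball X r) y \<partial>lborel)
       = (\<integral>\<^sup>+x. ennreal (\<delta> / \<bar>t\<bar> ^ DIM('a)) * (ennreal (\<bar>t\<bar>^DIM('a)) * (g (m + t *\<^sub>R x) * indicator (ball X r) (m + t *\<^sub>R x))) \<partial>lborel)"
      unfolding eq by (rule nn_integral_cmult[symmetric]) simp
    also have "\<dots> = (\<integral>\<^sup>+x. (ennreal \<delta> * indicator (ball X r) (m + t *\<^sub>R x)) * g (m + t *\<^sub>R x) \<partial>lborel)"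
    proof (rule nn_integral_cong)
      fix x
      have "ennreal (\<delta> / \<bar>t\<bar> ^ DIM('a)) * ennreal (\<bar>t\<bar>^DIM('a)) = ennreal \<delta>"
        using t \<delta> by (simp add: ennreal_mult[symmetric])
      then show "ennreal (\<delta> / \<bar>t\<bar> ^ DIM('a)) * (ennreal (\<bar>t\<bar>^DIM('a)) * (g (m + t *\<^sub>R x) * indicator (ball X r) (m + t *\<^sub>R x)))
        = (ennreal \<delta> * indicator (ball X r) (m + t *\<^sub>R x)) * g (m + t *\<^sub>R x)"
        by (simp only: mult.assoc[symmetric]) (simp only: mult.assoc mult.commute[of "g _"])
    qed
    also have "\<dots> \<le> (\<integral>\<^sup>+x. gauss x * g (m + t *\<^sub>R x) \<partial>lborel)"
      by (intro nn_integral_mono mult_right_mono dens) auto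
    also have "\<dots> = (\<integral>\<^sup>+\<xi>. g (m + t *\<^sub>R \<xi>) \<partial>std_gaussian)"
      by (rule nn_integral_std_gaussian[symmetric]) simp
    finally show "ennreal (\<delta> / \<bar>t\<bar> ^ DIM('a)) * (\<integral>\<^sup>+y. g y * indicator (ball X r) y \<partial>lborel)
        \<le> (\<integral>\<^sup>+\<xi>. g (m + t *\<^sub>R \<xi>) \<partial>std_gaussian)" .
  qed
qed

section \<open>A norm contracted by the linear part\<close>

text \<open>
  The linear map \<open>(u, x) \<mapsto> (x, T x - \<beta> u)\<close> is the heavy-ball recursion for a quadratic potential.
  Its characteristic polynomial \<open>r\<^sup>2 - T r + \<beta>\<close> has both roots inside the unit disc exactly if
  \<open>|\<beta>| < 1\<close> and \<open>|T| < 1 + \<beta>\<close>. Under this condition the discrete Lyapunov equation has an explicit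
  solution: the quadratic form \<open>N\<^sup>2\<close> below decreases by exactly \<open>D/2 (|u|\<^sup>2 + |x|\<^sup>2)\<close>. Completing the
  square, \<open>N\<^sup>2 = |x + b u|\<^sup>2 + p |u|\<^sup>2\<close>, shows that \<open>N\<close> is a norm.
\<close>

lemma adapted_norm_exists:
  assumes \<beta>: "0 < \<beta>" "\<beta> < 1" and T: "\<bar>T\<bar> < 1 + \<beta>"
  shows "\<exists>N \<rho> c. 0 < \<rho> \<and> \<rho> < 1 \<and> (1::real) \<le> c \<and> continuous_on UNIV N \<and>
    (\<forall>e. 0 \<le> N e) \<and> (\<forall>e f. N (e + f) \<le> N e + N f) \<and>
    (\<forall>e. N e \<le> c * norm e) \<and> (\<forall>e. norm e \<le> c * N e) \<and>
    (\<forall>u (x::'a::euclidean_space). N (x, T *\<^sub>R x - \<beta> *\<^sub>R u) \<le> \<rho> * N (u, x))"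
proof -
  \<comment> \<open>coefficients of the quadratic form \<open>a u\<^sup>2 + 2 b u x + x\<^sup>2\<close>\<close>
  define D where "D = (1 - \<beta>) / (1 + \<beta>) * ((1 + \<beta>)\<^sup>2 - T\<^sup>2)"
  define b where "b = - T * \<beta> / (1 + \<beta>)"
  define p where "p = \<beta>\<^sup>2 + D / 2 - b\<^sup>2"
  have TT: "T\<^sup>2 < (1 + \<beta>)\<^sup>2" using T \<beta> by (metis abs_le_square_iff abs_of_nonneg add_nonneg_nonneg less_le_not_le linorder_not_le zero_le_one)
  then have D: "0 < D" using \<beta> by (simp add: D_def)
  have "b\<^sup>2 = \<beta>\<^sup>2 * (T\<^sup>2 / (1 + \<beta>)\<^sup>2)" by (simp add: b_def power_divide power_mult_distrib)
  also have "\<dots> \<le> \<beta>\<^sup>2 * 1" using TT \<beta> by (intro mult_left_mono) (auto simp: divide_le_eq)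
  finally have p: "0 < p" using D by (simp add: p_def)
  define S where "S = (\<lambda>(u::'a, x::'a). (sqrt p *\<^sub>R u, x + b *\<^sub>R u))"
  define N where "N e = norm (S e)" for e
  have S: "S (e + f) = S e + S f" for e f by (cases e; cases f) (simp add: S_def algebra_simps)
  have Ncont: "continuous_on UNIV N"
    unfolding N_def S_def case_prod_beta by (intro continuous_intros)
  have N2: "(N (u, x))\<^sup>2 = (\<beta>\<^sup>2 + D / 2) * (u \<bullet> u) + 2 * b * (u \<bullet> x) + x \<bullet> x" for u x
  proof -
    have "(N (u, x))\<^sup>2 = (sqrt p * sqrt p) * (u \<bullet> u) + (x + b *\<^sub>R u) \<bullet> (x + b *\<^sub>R u)"
      by (simp add: N_def S_def power2_norm_eq_inner)
    also have "sqrt p * sqrt p = p" using p by simp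
    finally show ?thesis by (simp add: p_def inner_add algebra_simps inner_commute power2_eq_square)
  qed
  define c where "c = 1 + D + sqrt p + 2 * (1 + \<bar>b\<bar>) * (1 + 1 / sqrt p)"
  have sp: "0 < sqrt p" using p by simp
  have c1: "1 \<le> c" using D sp by (simp add: c_def)
  have upper: "N e \<le> c * norm e" for e
  proof (cases e)
    case (Pair u x)
    have "N e \<le> norm (sqrt p *\<^sub>R u) + norm (x + b *\<^sub>R u)"
      unfolding Pair N_def S_def by (simp only: prod.case norm_Pair_le)
    also have "\<dots> \<le> sqrt p * norm u + (norm x + \<bar>b\<bar> * norm u)"
      using p norm_triangle_ineq[of x "b *\<^sub>R u"] by simp
    also have "\<dots> \<le> sqrt p * norm e + (norm e + \<bar>b\<bar> * norm e)"
      using sp norm_fst_le[where x=u and y=x] norm_snd_le[where x=u and y=x] by (intro add_mono mult_left_mono) (auto simp: Pair)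
    also have "\<dots> = (sqrt p + (1 + \<bar>b\<bar>)) * norm e" by (simp add: algebra_simps)
    also have "\<dots> \<le> c * norm e"
    proof (rule mult_right_mono)
      have "1 + \<bar>b\<bar> \<le> 2 * (1 + \<bar>b\<bar>) * (1 + 1 / sqrt p)" 
        using sp by (simp add: algebra_simps add_nonneg_nonneg)
      then show "sqrt p + (1 + \<bar>b\<bar>) \<le> c" using D by (simp add: c_def)
    qed simp
    finally show ?thesis .
  qed
  have lower: "norm e \<le> c * N e" for e
  proof (cases e)
    case (Pair u x)
    have u: "norm u \<le> N e / sqrt p"
      using norm_fst_le[where x="sqrt p *\<^sub>R u" and y="x + b *\<^sub>R u"] sp by (simp add: Pair N_def S_def field_simps)
    have "norm x \<le> norm (x + b *\<^sub>R u) + norm (b *\<^sub>R u)" using norm_triangle_ineq4[of "x + b *\<^sub>R u" "b *\<^sub>R u"] by simp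
    also have "\<dots> \<le> N e + \<bar>b\<bar> * (N e / sqrt p)"
      using norm_snd_le[where x="sqrt p *\<^sub>R u" and y="x + b *\<^sub>R u"] mult_left_mono[OF u abs_ge_zero[of b]]
      by (intro add_mono) (auto simp: Pair N_def S_def)
    finally have "norm e \<le> N e / sqrt p + (N e + \<bar>b\<bar> * (N e / sqrt p))"
      using u norm_Pair_le[of u x] Pair by simp
    also have "\<dots> = (1 + (1 + \<bar>b\<bar>) * (1 / sqrt p)) * N e" by (simp add: algebra_simps add_divide_distrib)
    also have "\<dots> \<le> c * N e"
    proof (rule mult_right_mono)
      define y where "y = 1 / sqrt p"
      have "0 \<le> \<bar>b\<bar> * y" "0 \<le> y" using sp by (simp_all add: y_def)
      then show "1 + (1 + \<bar>b\<bar>) * (1 / sqrt p) \<le> c"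
        using D sp unfolding c_def y_def[symmetric] distrib_left distrib_right by linarith
    qed (simp add: N_def)
    finally show ?thesis .
  qed
  define \<rho> where "\<rho> = sqrt (1 - D / (2 * c\<^sup>2))"
  have "D < 2 * c\<^sup>2"
  proof -
    have "D \<le> c" using sp by (simp add: c_def)
    also have "c \<le> c * c" using c1 by simp
    finally have "D \<le> c * c" .
    moreover have "1 \<le> c * c" using c1 mult_mono[of 1 c 1 c] by simp
    ultimately show ?thesis unfolding power2_eq_square by linarith
  qed
  then have "0 < 1 - D / (2 * c\<^sup>2)" "1 - D / (2 * c\<^sup>2) < 1" using D c1 by auto
  then have \<rho>: "0 < \<rho>" "\<rho> < 1" "\<rho>\<^sup>2 = 1 - D / (2 * c\<^sup>2)" by (auto simp: \<rho>_def)
  have contr: "N (x, T *\<^sub>R x - \<beta> *\<^sub>R u) \<le> \<rho> * N (u, x)" for u x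
  proof -
    have b1: "b * (1 + \<beta>) = - T * \<beta>" using \<beta> by (simp add: b_def)
    have coef: "1 - (\<beta>\<^sup>2 + D / 2) - 2 * b * T - T\<^sup>2 = D / 2"
    proof -
      have "(1 + \<beta>) * (1 - \<beta>\<^sup>2 - 2 * b * T - T\<^sup>2) = (1 + \<beta>) * (1 - \<beta>\<^sup>2) - 2 * T * (b * (1 + \<beta>)) - T\<^sup>2 * (1 + \<beta>)"
        by (simp add: algebra_simps)
      also have "\<dots> = (1 + \<beta>) * (1 - \<beta>\<^sup>2) - T\<^sup>2 * (1 - \<beta>)"
        unfolding b1 by (simp add: algebra_simps power2_eq_square)
      also have "\<dots> = (1 - \<beta>) * ((1 + \<beta>)\<^sup>2 - T\<^sup>2)"
        by (simp add: algebra_simps power2_eq_square)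
      also have "\<dots> = (1 + \<beta>) * D" using \<beta> by (simp add: D_def)
      finally show ?thesis using \<beta> by simp
    qed
    have "(N (x, T *\<^sub>R x - \<beta> *\<^sub>R u))\<^sup>2 =
        ((\<beta>\<^sup>2 + D / 2) + 2 * b * T + T\<^sup>2) * (x \<bullet> x) - 2 * \<beta> * (b + T) * (u \<bullet> x) + \<beta>\<^sup>2 * (u \<bullet> u)"
      unfolding N2 by (simp add: inner_diff algebra_simps inner_commute power2_eq_square)
    also have "\<beta> * (b + T) = - b" using b1 by (simp add: algebra_simps)
    then have "2 * \<beta> * (b + T) = - 2 * b" by simp
    also have "((\<beta>\<^sup>2 + D / 2) + 2 * b * T + T\<^sup>2) = 1 - D / 2" using coef by simp
    finally have "(N (x, T *\<^sub>R x - \<beta> *\<^sub>R u))\<^sup>2 = (N (u, x))\<^sup>2 - D / 2 * (norm (u, x))\<^sup>2"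
      unfolding N2 by (simp add: norm_prod_def power2_norm_eq_inner algebra_simps)
    also have "\<dots> \<le> (N (u, x))\<^sup>2 - D / 2 * ((N (u, x))\<^sup>2 / c\<^sup>2)"
    proof -
      have "(N (u, x))\<^sup>2 \<le> (c * norm (u, x))\<^sup>2" using upper[of "(u, x)"] by (intro power_mono) (auto simp: N_def)
      then have "(N (u, x))\<^sup>2 / c\<^sup>2 \<le> (norm (u, x))\<^sup>2"
        using c1 by (simp add: divide_le_eq power_mult_distrib mult.commute)
      then show ?thesis using D by (intro diff_left_mono mult_left_mono) auto
    qed
    also have "\<dots> = (\<rho> * N (u, x))\<^sup>2" unfolding power_mult_distrib \<rho>(3) by (simp add: algebra_simps)
    finally show ?thesis by (rule power2_le_imp_le) (use \<rho> in \<open>auto simp: N_def\<close>)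
  qed
  show ?thesis
    by (rule exI[of _ N], rule exI[of _ \<rho>], rule exI[of _ c])
       (use \<rho> c1 Ncont upper lower contr in \<open>auto simp: N_def S norm_triangle_ineq\<close>)
qed

section \<open>BAOAB as a noisy heavy-ball iteration\<close>

text \<open>
  The friction enters through \<open>\<beta>\<close>, and \<open>\<alpha>\<close> is the step size of the corresponding heavy-ball
  iteration; \<open>T\<close> is the trace of its recursion for a potential with Hessian \<open>L\<close>. The auxiliary
  coordinate is scaled by \<open>q\<close>.
\<close>

locale baoab_params =
  fixes h \<gamma> L :: real
  assumes h: "0 < h" and \<gamma>: "0 < \<gamma>" and L: "0 < L" and stable: "h\<^sup>2 * L < 4"
begin

definition "\<beta> = exp (- \<gamma> * h)"
definition "\<sigma> = sqrt (1 - \<beta>\<^sup>2)"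
definition "\<alpha> = h\<^sup>2 * (1 + \<beta>) / 2"
definition "q = h / 2 * (1 + 1 / \<beta>)"
definition "T = 1 + \<beta> - \<alpha> * L"
abbreviation "tu \<equiv> h / 2 * \<sigma> / \<beta>"
abbreviation "tx \<equiv> h / 2 * \<sigma>"
definition "\<kappa>\<^sub>1 = tu + tx"

lemma \<beta>: "0 < \<beta>" "\<beta> < 1"
  using h \<gamma> by (auto simp: \<beta>_def)

lemma \<sigma>: "0 < \<sigma>"
  using \<beta> by (simp add: \<sigma>_def abs_square_less_1)

lemma q: "0 < q" using h \<beta> by (simp add: q_def add_pos_pos)

lemma \<alpha>: "0 < \<alpha>" using h \<beta> by (simp add: \<alpha>_def)

lemma \<kappa>\<^sub>1: "0 < \<kappa>\<^sub>1" using h \<beta> \<sigma> by (simp add: \<kappa>\<^sub>1_def add_pos_pos)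

text \<open>
  Numerical stability \<open>h\<^sup>2 L < 4\<close> is exactly the stability of the heavy-ball recursion.
\<close>

lemma T: "\<bar>T\<bar> < 1 + \<beta>"
proof -
  have "\<alpha> * L = (1 + \<beta>) * (h\<^sup>2 * L / 2)" by (simp add: \<alpha>_def)
  also have "\<dots> < (1 + \<beta>) * 2" using stable \<beta> by (intro mult_strict_left_mono) auto
  finally have "\<alpha> * L < 2 * (1 + \<beta>)" by simp
  moreover have "0 < \<alpha> * L" using \<alpha> L by simp
  ultimately show ?thesis by (simp add: T_def abs_less_iff)
qed

end

locale baoab_norm = baoab_params +
  fixes N :: "'a::euclidean_space \<times> 'a \<Rightarrow> real" and \<rho> c :: real
  assumes \<rho>: "0 < \<rho>" "\<rho> < 1" and c: "1 \<le> c"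
    and N_cont: "continuous_on UNIV N"
    and N_nonneg: "0 \<le> N e"
    and N_triangle: "N (e + f) \<le> N e + N f"
    and N_upper: "N e \<le> c * norm e"
    and N_lower: "norm e \<le> c * N e"
    and N_contract: "N (x, T *\<^sub>R x - \<beta> *\<^sub>R u) \<le> \<rho> * N (u, x)"
begin

lemma N_measurable [measurable]: "N \<in> borel_measurable borel"
  using N_cont by (rule borel_measurable_continuous_onI)

text \<open>
  All constants that measure the chain depend on the parameters and on the norm only, not on the
  potential. This is what allows the potential to be rescaled with the number of steps later.
\<close>

definition "K\<^sub>1 = 2 * c\<^sup>2 * (\<alpha>\<^sup>2 + \<kappa>\<^sub>1\<^sup>2 * DIM('a)) / (1 - \<rho>)"
definition "c\<^sub>1 = 1 + 2 / q + h / 2 * L"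
definition "M\<^sub>W = sqrt (3 * (c\<^sub>1\<^sup>2 + c\<^sub>1\<^sup>2 * c\<^sup>2 * (K\<^sub>1 / (1 - \<rho>)) + 4 * (h / 2)\<^sup>2))"
definition "M\<^sub>T = DIM('a) * c ^ 4 * \<kappa>\<^sub>1\<^sup>2 / (1 - \<rho>)\<^sup>2"

lemma K\<^sub>1: "0 \<le> K\<^sub>1" using \<rho> by (simp add: K\<^sub>1_def)
lemma c\<^sub>1: "0 \<le> c\<^sub>1" using q h L by (simp add: c\<^sub>1_def)
lemma M\<^sub>T: "0 \<le> M\<^sub>T" using c by (simp add: M\<^sub>T_def)

lemma norm_noise: "norm (- (tu) *\<^sub>R \<xi>, (tx) *\<^sub>R (\<xi>::'a)) \<le> \<kappa>\<^sub>1 * norm \<xi>"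
proof -
  have "norm (- (tu) *\<^sub>R \<xi>, (tx) *\<^sub>R \<xi>) \<le> norm (- (tu) *\<^sub>R \<xi>) + norm ((tx) *\<^sub>R \<xi>)"
    by (rule norm_Pair_le)
  also have "\<dots> = \<kappa>\<^sub>1 * norm \<xi>"
    using h \<sigma> \<beta> by (simp add: \<kappa>\<^sub>1_def algebra_simps abs_mult)
  finally show ?thesis .
qed

end

text \<open>
  The potentials considered are quadratic up to a bounded perturbation \<open>B\<close> of the gradient that
  vanishes outside a ball. The linear part decides about contraction; the ball leaves room at
  infinity where the chain is exactly Gaussian.
\<close>

locale baoab_chain = baoab_norm h \<gamma> L N
  for h \<gamma> L and N :: "'a::euclidean_space \<times> 'a \<Rightarrow> real" +
  fixes U :: "'a \<Rightarrow> real" and B :: "'a \<Rightarrow> 'a" and \<Lambda> R\<^sub>0 :: real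
  assumes grad: "gradient U x = L *\<^sub>R x + B x"
    and B_meas [measurable]: "B \<in> borel_measurable borel"
    and B_bound: "norm (B x) \<le> \<Lambda>"
    and B_supp: "R\<^sub>0 \<le> norm x \<Longrightarrow> B x = 0"
begin

abbreviation "Q \<equiv> baoab_kernel h \<gamma> U"

text \<open>
  In the coordinates \<open>(u, x) = \<Phi> (x, v)\<close> the chain becomes a noisy heavy-ball iteration. Here
  \<open>v + h/2 \<nabla>U(x)\<close> is the velocity before the last half kick, and \<open>u\<close> is the position from which the
  iteration without noise would have arrived at \<open>x\<close>.
\<close>

definition \<Phi> :: "'a \<times> 'a \<Rightarrow> 'a \<times> 'a" where
  "\<Phi> = (\<lambda>(x, v). (x - q *\<^sub>R (v + (h / 2) *\<^sub>R gradient U x), x))"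

definition \<Psi> :: "'a \<times> 'a \<Rightarrow> 'a \<times> 'a" where
  "\<Psi> = (\<lambda>(u, x). (x, (1 / q) *\<^sub>R (x - u) - (h / 2) *\<^sub>R gradient U x))"

definition hb :: "'a \<Rightarrow> 'a \<times> 'a \<Rightarrow> 'a \<times> 'a" where
  "hb \<xi> = (\<lambda>(u, x). (x - (tu) *\<^sub>R \<xi>,
     x + \<beta> *\<^sub>R (x - u) - \<alpha> *\<^sub>R gradient U x + (tx) *\<^sub>R \<xi>))"

lemma \<Lambda>: "0 \<le> \<Lambda>" using B_bound[of 0] norm_ge_zero order_trans by blast

lemma grad_meas [measurable]: "gradient U \<in> borel_measurable borel"
  unfolding grad[abs_def] by measurable

lemma \<Psi>\<Phi> [simp]: "\<Psi> (\<Phi> z) = z"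
  using q by (cases z) (simp add: \<Phi>_def \<Psi>_def)

lemma \<Phi>\<Psi> [simp]: "\<Phi> (\<Psi> e) = e"
  using q by (cases e) (simp add: \<Phi>_def \<Psi>_def)

lemma snd_\<Phi>: "snd (\<Phi> z) = fst z"
  by (cases z) (simp add: \<Phi>_def)

lemma \<Phi>_meas [measurable]: "\<Phi> \<in> borel_measurable borel"
  unfolding \<Phi>_def borel_prod[symmetric] by measurable

lemma \<Psi>_meas [measurable]: "\<Psi> \<in> borel_measurable borel"
  unfolding \<Psi>_def borel_prod[symmetric] by measurable

lemma hb_meas: "(\<lambda>(\<xi>, e). hb \<xi> e) \<in> borel \<Otimes>\<^sub>M borel \<rightarrow>\<^sub>M borel"
  unfolding hb_def borel_prod[symmetric] by measurable

lemma step_conj: "baoab_step h \<gamma> U \<xi> z = \<Psi> (hb \<xi> (\<Phi> z))"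
proof -
  obtain x v where z: "z = (x, v)" by (cases z)
  define g where "g = gradient U x"
  define w where "w = v - (h / 2) *\<^sub>R g"
  define vc where "vc = \<beta> *\<^sub>R w + \<sigma> *\<^sub>R \<xi>"
  define x' where "x' = x + (h / 2) *\<^sub>R w + (h / 2) *\<^sub>R vc"
  have st: "baoab_step h \<gamma> U \<xi> z = (x', vc - (h / 2) *\<^sub>R gradient U x')"
    by (simp only: baoab_step_def z Let_def prod.case x'_def vc_def w_def g_def \<beta>_def[symmetric] \<sigma>_def[symmetric])
  have b: "q * \<beta> = h / 2 * (\<beta> + 1)" using \<beta> by (simp add: q_def field_simps)
  have a: "\<alpha> = h * (q * \<beta>)" unfolding b by (simp add: \<alpha>_def power2_eq_square algebra_simps)
  have "\<Phi> (baoab_step h \<gamma> U \<xi> z) = (x' - q *\<^sub>R vc, x')"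
    by (simp add: st \<Phi>_def)
  also have "x' - q *\<^sub>R vc = x - (tu) *\<^sub>R \<xi>"
  proof -
    have "x' - q *\<^sub>R vc = x + (h / 2) *\<^sub>R w + (h / 2 - q) *\<^sub>R vc"
      by (simp add: x'_def algebra_simps)
    also have "h / 2 - q = - (h / 2 / \<beta>)" by (simp add: q_def algebra_simps)
    also have "x + (h / 2) *\<^sub>R w + (- (h / 2 / \<beta>)) *\<^sub>R vc = x - (tu) *\<^sub>R \<xi>"
      using \<beta> by (simp add: vc_def algebra_simps)
    finally show ?thesis .
  qed
  also have "x' = x + \<beta> *\<^sub>R (x - fst (\<Phi> z)) - \<alpha> *\<^sub>R g + (tx) *\<^sub>R \<xi>"
  proof -
    have "x' = x + (h / 2 * (\<beta> + 1)) *\<^sub>R w + (tx) *\<^sub>R \<xi>"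
      by (simp add: x'_def vc_def algebra_simps add_divide_distrib)
    also have "\<dots> = x + (q * \<beta>) *\<^sub>R w + (tx) *\<^sub>R \<xi>"
      unfolding b ..
    also have "\<dots> = x + \<beta> *\<^sub>R (x - fst (\<Phi> z)) - \<alpha> *\<^sub>R g + (tx) *\<^sub>R \<xi>"
      unfolding a by (simp add: w_def z \<Phi>_def g_def[symmetric] algebra_simps)
        (simp flip: scaleR_add_left)
    finally show ?thesis .
  qed
  finally have "\<Phi> (baoab_step h \<gamma> U \<xi> z) = hb \<xi> (\<Phi> z)"
    by (simp add: hb_def z \<Phi>_def g_def)
  then show ?thesis by (metis \<Psi>\<Phi>)
qed

lemma step_meas: "(\<lambda>(z, \<xi>). baoab_step h \<gamma> U \<xi> z) \<in> borel \<Otimes>\<^sub>M borel \<rightarrow>\<^sub>M borel"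
proof -
  note hb_meas[measurable]
  have "(\<lambda>(z, \<xi>). \<Psi> (case (\<xi>, \<Phi> z) of (\<xi>, e) \<Rightarrow> hb \<xi> e)) \<in> (borel :: ('a \<times> 'a) measure) \<Otimes>\<^sub>M borel \<rightarrow>\<^sub>M borel"
    by measurable
  then show ?thesis by (simp add: step_conj)
qed

lemma step_meas1 [measurable]: "(\<lambda>\<xi>. baoab_step h \<gamma> U \<xi> z) \<in> borel \<rightarrow>\<^sub>M borel"
  using measurable_compose[OF measurable_Pair1' step_meas, of z] by simp

lemma Q_kernel: "Q \<in> borel \<rightarrow>\<^sub>M prob_algebra borel"
  unfolding baoab_kernel_def[abs_def]
proof (rule measurable_distr_prob_space2[where M=borel])
  show "(\<lambda>_. std_gaussian) \<in> (borel :: ('a \<times> 'a) measure) \<rightarrow>\<^sub>M prob_algebra (borel :: 'a measure)"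
    using prob_space_std_gaussian by (intro measurable_const) (auto simp: space_prob_algebra)
qed (rule step_meas)

lemma nn_integral_Q:
  assumes "g \<in> borel_measurable borel"
  shows "(\<integral>\<^sup>+y. g y \<partial>Q z) = (\<integral>\<^sup>+\<xi>. g (\<Psi> (hb \<xi> (\<Phi> z))) \<partial>std_gaussian)"
proof -
  have "(\<lambda>\<xi>. baoab_step h \<gamma> U \<xi> z) \<in> std_gaussian \<rightarrow>\<^sub>M borel"
    using step_meas1 by (simp cong: measurable_cong_sets)
  then show ?thesis
    unfolding baoab_kernel_def using assms by (subst nn_integral_distr) (auto simp: step_conj)
qed

lemma hb_split: "hb \<xi> (u, x) = (x, T *\<^sub>R x - \<beta> *\<^sub>R u) + (0, - \<alpha> *\<^sub>R B x)
    + (- (tu) *\<^sub>R \<xi>, (tx) *\<^sub>R \<xi>)"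
  by (simp add: hb_def grad T_def algebra_simps)

lemma N_noise: "N (- (tu) *\<^sub>R \<xi>, (tx) *\<^sub>R \<xi>) \<le> c * \<kappa>\<^sub>1 * norm \<xi>"
proof -
  have "N (- (tu) *\<^sub>R \<xi>, (tx) *\<^sub>R \<xi>) \<le> c * norm (- (tu) *\<^sub>R \<xi>, (tx) *\<^sub>R \<xi>)"
    by (rule N_upper)
  also have "\<dots> \<le> c * (\<kappa>\<^sub>1 * norm \<xi>)"
    using c by (intro mult_left_mono norm_noise) auto
  finally show ?thesis by simp
qed

definition V :: "'a \<times> 'a \<Rightarrow> real" where "V z = (N (\<Phi> z))\<^sup>2"

lemma V_meas [measurable]: "V \<in> borel_measurable borel"
  unfolding V_def by measurable

text \<open>
  The adapted norm gives the Lyapunov function. Convexity of the square turns the contraction of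
  the norm by \<open>\<rho>\<close>, up to an additive error, into a contraction of its square by \<open>\<rho>\<close>.
\<close>

lemma drift: "(\<integral>\<^sup>+y. ennreal (V y) \<partial>Q z) \<le> ennreal (\<rho> * V z + K\<^sub>1 * (1 + \<Lambda>\<^sup>2))"
proof -
  obtain u x where ux: "\<Phi> z = (u, x)" by (cases "\<Phi> z")
  interpret G: prob_space "std_gaussian :: 'a measure" by (rule prob_space_std_gaussian)
  let ?A = "\<rho> * V z + 2 * c\<^sup>2 * \<alpha>\<^sup>2 * \<Lambda>\<^sup>2 / (1 - \<rho>)" and ?B = "2 * c\<^sup>2 * \<kappa>\<^sub>1\<^sup>2 / (1 - \<rho>)"
  have A: "0 \<le> ?A" using \<rho> by (simp add: V_def)
  have B: "0 \<le> ?B" using \<rho> by simp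
  have split: "ennreal (a + b * y) = ennreal a + ennreal b * ennreal y" if "0 \<le> a" "0 \<le> b" "0 \<le> y" for a b y
    using that by (simp add: ennreal_mult)
  have pt: "V (\<Psi> (hb \<xi> (\<Phi> z))) \<le> ?A + ?B * (norm \<xi>)\<^sup>2" for \<xi>
  proof -
    let ?p = "c * \<alpha> * \<Lambda> + c * \<kappa>\<^sub>1 * norm \<xi>"
    have "N (hb \<xi> (u, x)) \<le> N (x, T *\<^sub>R x - \<beta> *\<^sub>R u) + N (0, - \<alpha> *\<^sub>R B x)
        + N (- (tu) *\<^sub>R \<xi>, (tx) *\<^sub>R \<xi>)"
      unfolding hb_split by (intro order_trans[OF N_triangle] add_right_mono N_triangle)
    also have "\<dots> \<le> \<rho> * N (u, x) + c * (\<alpha> * \<Lambda>) + c * \<kappa>\<^sub>1 * norm \<xi>"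
    proof (intro add_mono N_contract N_noise)
      have "N (0, - \<alpha> *\<^sub>R B x) \<le> c * norm (0 :: 'a, - \<alpha> *\<^sub>R B x)" by (rule N_upper)
      also have "\<dots> \<le> c * (\<alpha> * \<Lambda>)"
        using c \<alpha> B_bound by (intro mult_left_mono) (auto simp: norm_Pair)
      finally show "N (0, - \<alpha> *\<^sub>R B x) \<le> c * (\<alpha> * \<Lambda>)" .
    qed
    finally have "N (hb \<xi> (u, x)) \<le> \<rho> * N (u, x) + ?p" by simp
    then have "(N (hb \<xi> (u, x)))\<^sup>2 \<le> (\<rho> * N (u, x) + ?p)\<^sup>2"
      by (intro power_mono N_nonneg)
    \<comment> \<open>convexity of the square with weights \<open>\<rho>\<close> and \<open>1 - \<rho>\<close>\<close>
    also have "\<dots> \<le> \<rho> * (N (u, x))\<^sup>2 + ?p\<^sup>2 / (1 - \<rho>)"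
    proof -
      have "\<rho> * (N (u, x))\<^sup>2 + ?p\<^sup>2 / (1 - \<rho>) - (\<rho> * N (u, x) + ?p)\<^sup>2
        = \<rho> / (1 - \<rho>) * ((1 - \<rho>) * N (u, x) - ?p)\<^sup>2"
        using \<rho> by (simp add: field_simps power2_eq_square)
      moreover have "0 \<le> \<rho> / (1 - \<rho>) * ((1 - \<rho>) * N (u, x) - ?p)\<^sup>2" using \<rho> by simp
      ultimately show ?thesis by linarith
    qed
    also have "?p\<^sup>2 / (1 - \<rho>) \<le> (2 * (c * \<alpha> * \<Lambda>)\<^sup>2 + 2 * (c * \<kappa>\<^sub>1 * norm \<xi>)\<^sup>2) / (1 - \<rho>)"
      using \<rho> sum_squares_bound[of "c * \<alpha> * \<Lambda>" "c * \<kappa>\<^sub>1 * norm \<xi>"]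
      by (intro divide_right_mono) (auto simp: power2_sum)
    also have "\<rho> * (N (u, x))\<^sup>2 + (2 * (c * \<alpha> * \<Lambda>)\<^sup>2 + 2 * (c * \<kappa>\<^sub>1 * norm \<xi>)\<^sup>2) / (1 - \<rho>) = ?A + ?B * (norm \<xi>)\<^sup>2"
      by (simp add: V_def ux add_divide_distrib power_mult_distrib)
    finally show ?thesis by (simp add: V_def ux)
  qed
  have "(\<integral>\<^sup>+y. ennreal (V y) \<partial>Q z) = (\<integral>\<^sup>+\<xi>. ennreal (V (\<Psi> (hb \<xi> (\<Phi> z)))) \<partial>std_gaussian)"
    by (rule nn_integral_Q) simp
  also have "\<dots> \<le> (\<integral>\<^sup>+\<xi>. ennreal ?A + ennreal ?B * ennreal ((norm (\<xi>::'a))\<^sup>2) \<partial>std_gaussian)"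
  proof (rule nn_integral_mono)
    fix \<xi> :: 'a
    have "ennreal (V (\<Psi> (hb \<xi> (\<Phi> z)))) \<le> ennreal (?A + ?B * (norm \<xi>)\<^sup>2)" by (rule ennreal_leI[OF pt])
    also have "\<dots> = ennreal ?A + ennreal ?B * ennreal ((norm \<xi>)\<^sup>2)"
      by (rule split[OF A B]) simp
    finally show "ennreal (V (\<Psi> (hb \<xi> (\<Phi> z)))) \<le> \<dots>" .
  qed
  also have "\<dots> = ennreal ?A + ennreal ?B * ennreal (real DIM('a))"
    by (subst nn_integral_add, simp, simp, subst nn_integral_cmult) (auto simp: std_gaussian_second_moment G.emeasure_space_1[simplified])
  also have "\<dots> = ennreal (?A + ?B * real DIM('a))"
    by (rule split[OF A B, symmetric]) simp
  also have "\<dots> \<le> ennreal (\<rho> * V z + K\<^sub>1 * (1 + \<Lambda>\<^sup>2))"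
  proof (rule ennreal_leI)
    have "?A + ?B * real DIM('a) = \<rho> * V z + 2 * c\<^sup>2 / (1 - \<rho>) * (\<alpha>\<^sup>2 * \<Lambda>\<^sup>2 + \<kappa>\<^sub>1\<^sup>2 * DIM('a))"
      by (simp add: algebra_simps add_divide_distrib)
    also have "\<dots> \<le> \<rho> * V z + 2 * c\<^sup>2 / (1 - \<rho>) * ((\<alpha>\<^sup>2 + \<kappa>\<^sub>1\<^sup>2 * DIM('a)) * (1 + \<Lambda>\<^sup>2))"
      using \<rho> by (intro add_left_mono mult_left_mono) (auto simp: algebra_simps)
    finally show "?A + ?B * real DIM('a) \<le> \<rho> * V z + K\<^sub>1 * (1 + \<Lambda>\<^sup>2)" by (simp add: K\<^sub>1_def)
  qed
  finally show ?thesis .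
qed

end

section \<open>Existence, uniqueness and moments of the invariant law\<close>

lemma (in baoab_norm) M\<^sub>W: "0 \<le> M\<^sub>W"
proof -
  have "0 \<le> K\<^sub>1 / (1 - \<rho>)" using K\<^sub>1 \<rho> by simp
  then show ?thesis
    unfolding M\<^sub>W_def
    by (intro real_sqrt_ge_zero mult_nonneg_nonneg add_nonneg_nonneg zero_le_power2) simp_all
qed

context baoab_chain begin

lemma emeasure_two_steps:
  assumes A: "A \<in> sets borel"
  shows "emeasure (Q z \<bind> Q) A =
    (\<integral>\<^sup>+\<xi>\<^sub>1. \<integral>\<^sup>+\<xi>\<^sub>2. indicator A (\<Psi> (hb \<xi>\<^sub>2 (hb \<xi>\<^sub>1 (\<Phi> z)))) \<partial>std_gaussian \<partial>std_gaussian)"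
proof -
  have Qz: "Q z \<in> space (prob_algebra borel)" using measurable_space[OF Q_kernel, of z] by simp
  have Qm: "(\<lambda>y. emeasure (Q y) A) \<in> borel_measurable borel"
    using measurable_compose[OF measurable_prob_algebraD[OF Q_kernel] measurable_emeasure_subprob_algebra[OF A]] .
  have "emeasure (Q z \<bind> Q) A = (\<integral>\<^sup>+y. emeasure (Q y) A \<partial>Q z)"
    by (rule emeasure_bind_prob_algebra[OF Qz Q_kernel A])
  also have "\<dots> = (\<integral>\<^sup>+\<xi>\<^sub>1. emeasure (Q (\<Psi> (hb \<xi>\<^sub>1 (\<Phi> z)))) A \<partial>std_gaussian)"
    by (rule nn_integral_Q[OF Qm])
  also have "\<dots> = (\<integral>\<^sup>+\<xi>\<^sub>1. \<integral>\<^sup>+\<xi>\<^sub>2. indicator A (\<Psi> (hb \<xi>\<^sub>2 (hb \<xi>\<^sub>1 (\<Phi> z)))) \<partial>std_gaussian \<partial>std_gaussian)"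
  proof (rule nn_integral_cong)
    fix \<xi>\<^sub>1 :: 'a
    let ?y = "\<Psi> (hb \<xi>\<^sub>1 (\<Phi> z))"
    have "emeasure (Q ?y) A = (\<integral>\<^sup>+w. indicator A w \<partial>Q ?y)"
      using A by (simp add: baoab_kernel_def)
    also have "\<dots> = (\<integral>\<^sup>+\<xi>\<^sub>2. indicator A (\<Psi> (hb \<xi>\<^sub>2 (\<Phi> ?y))) \<partial>std_gaussian)"
      using A by (intro nn_integral_Q) simp
    finally show "emeasure (Q ?y) A = (\<integral>\<^sup>+\<xi>\<^sub>2. indicator A (\<Psi> (hb \<xi>\<^sub>2 (hb \<xi>\<^sub>1 (\<Phi> z)))) \<partial>std_gaussian)"
      by simp
  qed
  finally show ?thesis .
qed

text \<open>
  Let \<open>(u\<^sub>i, x\<^sub>i)\<close> be the states after \<open>i\<close> steps. The combination \<open>s = x\<^sub>2 + \<beta> u\<^sub>2\<close> does not contain the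
  second noise, while \<open>u\<^sub>2\<close> is \<open>x\<^sub>1\<close> plus a multiple of it. On the event that \<open>x\<^sub>1\<close> lies outside the
  ball carrying the perturbation, \<open>s\<close> is an affine function of the first noise. So, restricted to
  this event, the law of \<open>(s, u\<^sub>2)\<close> is bounded below by a multiple of Lebesgue measure on a product of
  unit balls, uniformly for starting points in a sublevel set of \<open>V\<close>. The centre \<open>S\<close> of the first ball is chosen so far away that \<open>s\<close> near \<open>S\<close>
  forces \<open>x\<^sub>1\<close> to be outside.
\<close>

lemma minorisation:
  "\<exists>\<nu>. sets \<nu> = sets borel \<and> 0 < measure \<nu> UNIV \<and>
    (\<forall>z A. V z \<le> R \<longrightarrow> A \<in> sets borel \<longrightarrow> emeasure \<nu> A \<le> emeasure (Q z \<bind> Q) A)"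
proof -
  define r where "r = c * sqrt (max 0 R)"
  have r: "0 \<le> r" using c by (simp add: r_def)
  have \<Phi>r: "norm (\<Phi> z) \<le> r" if "V z \<le> R" for z
  proof -
    have "N (\<Phi> z) = sqrt (V z)" using N_nonneg by (simp add: V_def)
    also have "\<dots> \<le> sqrt (max 0 R)" using that by simp
    finally have "c * N (\<Phi> z) \<le> r" using c by (simp add: r_def mult_left_mono)
    then show ?thesis using N_lower[of "\<Phi> z"] by simp
  qed
  define c\<^sub>2 where "c\<^sub>2 = T + 1 + \<beta>"
  have c\<^sub>2: "0 < c\<^sub>2" using T by (simp add: c\<^sub>2_def abs_less_iff)
  define F where "F = (1 + 2 * \<beta> + \<alpha> * L) * r + \<alpha> * \<Lambda>"
  define e where "e = (SOME i::'a. i \<in> Basis)"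
  have e: "norm e = 1" using norm_Basis SOME_Basis by (auto simp: e_def)
  define S where "S = (c\<^sub>2 * \<bar>R\<^sub>0\<bar> + 1 + (r + F)) *\<^sub>R e"
  have F0: "0 \<le> F" using r \<beta> \<alpha> L \<Lambda> by (simp add: F_def)
  have normS: "norm S = c\<^sub>2 * \<bar>R\<^sub>0\<bar> + 1 + (r + F)"
    using e c\<^sub>2 r F0 by (simp add: S_def)
  have t1: "c\<^sub>2 * (tx) \<noteq> 0" using c\<^sub>2 h \<sigma> by simp
  have t2: "- (tu) \<noteq> 0" using \<beta> h \<sigma> by simp
  obtain \<epsilon>\<^sub>1 where \<epsilon>\<^sub>1: "0 < \<epsilon>\<^sub>1" and low1: "\<forall>m g. norm m \<le> (c\<^sub>2 * F + (r + F)) \<longrightarrow> g \<in> borel_measurable borel \<longrightarrow>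
     ennreal \<epsilon>\<^sub>1 * (\<integral>\<^sup>+y. g y * indicator (ball S 1) y \<partial>lborel) \<le> (\<integral>\<^sup>+\<xi>. g (m + (c\<^sub>2 * (tx)) *\<^sub>R \<xi>) \<partial>std_gaussian)"
    using std_gaussian_affine_lower_bound[OF t1, of "c\<^sub>2 * F + (r + F)" S 1] by (elim exE conjE) (rule that)
  obtain \<epsilon>\<^sub>2 where \<epsilon>\<^sub>2: "0 < \<epsilon>\<^sub>2" and low2: "\<forall>m g. norm m \<le> (norm S + 1 + (r + F)) / c\<^sub>2 \<longrightarrow> g \<in> borel_measurable borel \<longrightarrow>
     ennreal \<epsilon>\<^sub>2 * (\<integral>\<^sup>+y. g y * indicator (ball (0::'a) 1) y \<partial>lborel) \<le> (\<integral>\<^sup>+\<xi>. g (m + (- (tu)) *\<^sub>R \<xi>) \<partial>std_gaussian)"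
    using std_gaussian_affine_lower_bound[OF t2, of "(norm S + 1 + (r + F)) / c\<^sub>2" 0 1] by (elim exE conjE) (rule that)
  let ?P = "lborel \<Otimes>\<^sub>M lborel :: ('a \<times> 'a) measure"
  let ?w = "\<lambda>(s, u). ennreal (\<epsilon>\<^sub>1 * \<epsilon>\<^sub>2) * (indicator (ball S 1) s * indicator (ball 0 1) u)"
  let ?psi = "\<lambda>(s, u). \<Psi> (u, s - \<beta> *\<^sub>R u)"
  define \<nu> where "\<nu> = distr (density ?P ?w) borel ?psi"
  have [measurable]: "ball S 1 \<in> sets borel" "ball (0::'a) 1 \<in> sets borel" by auto
  have [measurable]: "?w \<in> borel_measurable ?P" by measurable
  have psi [measurable]: "?psi \<in> ?P \<rightarrow>\<^sub>M borel" by measurable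
  have em\<nu>: "emeasure \<nu> A = ennreal \<epsilon>\<^sub>1 * (\<integral>\<^sup>+s. (ennreal \<epsilon>\<^sub>2 * (\<integral>\<^sup>+u. indicator A (?psi (s, u)) * indicator (ball 0 1) u \<partial>lborel)) * indicator (ball S 1) s \<partial>lborel)"
    if [measurable]: "A \<in> sets borel" for A
  proof -
    have "emeasure \<nu> A = emeasure (density ?P ?w) (?psi -` A \<inter> space ?P)"
      unfolding \<nu>_def by (subst emeasure_distr) (auto cong: measurable_cong_sets)
    also have "\<dots> = (\<integral>\<^sup>+p. ?w p * indicator (?psi -` A \<inter> space ?P) p \<partial>?P)"
      by (rule emeasure_density) (use measurable_sets[OF psi that] in auto)
    also have "\<dots> = (\<integral>\<^sup>+p. ?w p * indicator A (?psi p) \<partial>?P)"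
      by (rule nn_integral_cong) (auto simp: indicator_def space_pair_measure)
    also have "\<dots> = (\<integral>\<^sup>+s. \<integral>\<^sup>+u. ?w (s, u) * indicator A (?psi (s, u)) \<partial>lborel \<partial>lborel)"
      by (rule lborel.nn_integral_fst[symmetric]) measurable
    also have "\<dots> = (\<integral>\<^sup>+s. ennreal \<epsilon>\<^sub>1 * ((ennreal \<epsilon>\<^sub>2 * (\<integral>\<^sup>+u. indicator A (?psi (s, u)) * indicator (ball 0 1) u \<partial>lborel)) * indicator (ball S 1) s) \<partial>lborel)"
    proof (rule nn_integral_cong)
      fix s :: 'a
      have "(\<integral>\<^sup>+u. ?w (s, u) * indicator A (?psi (s, u)) \<partial>lborel) =
        (\<integral>\<^sup>+u. (ennreal \<epsilon>\<^sub>1 * (ennreal \<epsilon>\<^sub>2 * indicator (ball S 1) s)) * (indicator A (?psi (s, u)) * indicator (ball 0 1) u) \<partial>lborel)"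
        using \<epsilon>\<^sub>1 \<epsilon>\<^sub>2 by (intro nn_integral_cong) (simp add: ennreal_mult mult_ac)
      also have "\<dots> = (ennreal \<epsilon>\<^sub>1 * (ennreal \<epsilon>\<^sub>2 * indicator (ball S 1) s)) * (\<integral>\<^sup>+u. indicator A (?psi (s, u)) * indicator (ball 0 1) u \<partial>lborel)"
        by (rule nn_integral_cmult) measurable
      finally show "(\<integral>\<^sup>+u. ?w (s, u) * indicator A (?psi (s, u)) \<partial>lborel) =
        ennreal \<epsilon>\<^sub>1 * ((ennreal \<epsilon>\<^sub>2 * (\<integral>\<^sup>+u. indicator A (?psi (s, u)) * indicator (ball 0 1) u \<partial>lborel)) * indicator (ball S 1) s)"
        by (simp only: mult_ac)
    qed
    also have "\<dots> = ennreal \<epsilon>\<^sub>1 * (\<integral>\<^sup>+s. (ennreal \<epsilon>\<^sub>2 * (\<integral>\<^sup>+u. indicator A (?psi (s, u)) * indicator (ball 0 1) u \<partial>lborel)) * indicator (ball S 1) s \<partial>lborel)"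
      by (rule nn_integral_cmult) measurable
    finally show ?thesis .
  qed
  have tot: "emeasure \<nu> UNIV = ennreal (\<epsilon>\<^sub>1 * \<epsilon>\<^sub>2 * (measure lborel (ball (0::'a) 1) * measure lborel (ball S 1)))"
  proof -
    have fin: "emeasure lborel (ball X 1) = ennreal (measure lborel (ball X 1))" for X :: 'a
      by (rule emeasure_eq_ennreal_measure) (use emeasure_lborel_ball_finite[of X 1] in simp)
    show ?thesis
      using \<epsilon>\<^sub>1 \<epsilon>\<^sub>2 by (subst em\<nu>) (simp_all add: nn_integral_cmult nn_integral_multc fin ennreal_mult mult.assoc)
  qed
  show ?thesis
  proof (intro exI conjI allI impI)
    show "sets \<nu> = sets borel" by (simp add: \<nu>_def)
    have "0 < measure lborel (ball X 1)" for X :: 'a by (rule content_ball_pos) simp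
    then show "0 < measure \<nu> UNIV"
      using \<epsilon>\<^sub>1 \<epsilon>\<^sub>2 by (simp add: measure_def[of \<nu>] tot)
  next
    fix z A assume Vz: "V z \<le> R" and A [measurable]: "A \<in> sets (borel :: ('a \<times> 'a) measure)"
    obtain u x where ux: "\<Phi> z = (u, x)" by (cases "\<Phi> z")
    have u: "norm u \<le> r" "norm x \<le> r"
      using \<Phi>r[OF Vz] norm_fst_le[where x=u and y=x] norm_snd_le[where x=u and y=x] unfolding ux by linarith+
    define f where "f = x + \<beta> *\<^sub>R (x - u) - \<alpha> *\<^sub>R gradient U x"
    have f: "norm f \<le> F"
    proof -
      have "norm f = norm ((1 + \<beta>) *\<^sub>R x + - \<beta> *\<^sub>R u + - (\<alpha> * L) *\<^sub>R x + - \<alpha> *\<^sub>R B x)"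
        by (simp add: f_def grad algebra_simps)
      also have "\<dots> \<le> norm ((1 + \<beta>) *\<^sub>R x) + norm (- \<beta> *\<^sub>R u) + norm (- (\<alpha> * L) *\<^sub>R x) + norm (- \<alpha> *\<^sub>R B x)"
        by (intro order_trans[OF norm_triangle_ineq] add_right_mono norm_triangle_ineq)
      also have "\<dots> = (1 + \<beta>) * norm x + \<beta> * norm u + (\<alpha> * L) * norm x + \<alpha> * norm (B x)"
        using \<beta> \<alpha> L by simp
      also have "\<dots> \<le> (1 + \<beta>) * r + \<beta> * r + (\<alpha> * L) * r + \<alpha> * \<Lambda>"
        using \<beta> \<alpha> L u B_bound by (intro add_mono mult_left_mono) auto
      finally show ?thesis by (simp add: F_def algebra_simps)
    qed
    define m where "m = \<beta> *\<^sub>R x + f"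
    have m: "norm m \<le> r + F"
    proof -
      have "norm m \<le> \<beta> * norm x + norm f" using norm_triangle_ineq[of "\<beta> *\<^sub>R x" f] \<beta> by (simp add: m_def)
      also have "\<beta> * norm x \<le> 1 * r" using \<beta> u by (intro mult_mono) auto
      finally show ?thesis using f by simp
    qed
    \<comment> \<open>position after the first step, and the combination of the second state free of the second noise\<close>
    define x\<^sub>1 where "x\<^sub>1 \<xi> = f + (tx) *\<^sub>R \<xi>" for \<xi>
    define s where "s \<xi> = (c\<^sub>2 *\<^sub>R f - m) + (c\<^sub>2 * (tx)) *\<^sub>R \<xi>" for \<xi>
    have sx: "s \<xi> = c\<^sub>2 *\<^sub>R x\<^sub>1 \<xi> - m" for \<xi> by (simp add: s_def x\<^sub>1_def algebra_simps)
    have step1: "hb \<xi> (\<Phi> z) = (x - (tu) *\<^sub>R \<xi>, x\<^sub>1 \<xi>)" for \<xi>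
      by (simp add: hb_def ux f_def x\<^sub>1_def)
    have far: "B (x\<^sub>1 \<xi>) = 0 \<and> norm (x\<^sub>1 \<xi>) \<le> (norm S + 1 + (r + F)) / c\<^sub>2" if "s \<xi> \<in> ball S 1" for \<xi>
    proof -
      have d: "norm (s \<xi> - S) \<le> 1" using that by (simp add: dist_norm norm_minus_commute)
      have x1: "c\<^sub>2 *\<^sub>R x\<^sub>1 \<xi> = S + ((s \<xi> - S) + m)" by (simp add: sx)
      have d2: "norm ((s \<xi> - S) + m) \<le> 1 + (r + F)" by (intro norm_triangle_le add_mono d m)
      have "norm S - norm ((s \<xi> - S) + m) \<le> c\<^sub>2 * norm (x\<^sub>1 \<xi>)"
        using norm_diff_ineq[of S "(s \<xi> - S) + m"] x1[symmetric] c\<^sub>2 by simp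
      then have "c\<^sub>2 * \<bar>R\<^sub>0\<bar> \<le> c\<^sub>2 * norm (x\<^sub>1 \<xi>)" using d2 normS by simp
      then have "R\<^sub>0 \<le> norm (x\<^sub>1 \<xi>)" using c\<^sub>2 by simp
      moreover have "c\<^sub>2 * norm (x\<^sub>1 \<xi>) \<le> norm S + (1 + (r + F))"
        using norm_triangle_ineq[of S "(s \<xi> - S) + m"] d2 x1[symmetric] c\<^sub>2 by simp
      ultimately show ?thesis using B_supp c\<^sub>2 by (simp add: pos_le_divide_eq mult.commute)
    qed
    let ?J = "\<lambda>s. ennreal \<epsilon>\<^sub>2 * (\<integral>\<^sup>+u. indicator A (?psi (s, u)) * indicator (ball 0 1) u \<partial>lborel)"
    have inner: "?J (s \<xi>) * indicator (ball S 1) (s \<xi>) \<le> (\<integral>\<^sup>+\<xi>\<^sub>2. indicator A (\<Psi> (hb \<xi>\<^sub>2 (hb \<xi> (\<Phi> z)))) \<partial>std_gaussian)" for \<xi>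
    proof (cases "s \<xi> \<in> ball S 1")
      case True
      have hb2: "hb \<xi>\<^sub>2 (hb \<xi> (\<Phi> z)) = (let u = x\<^sub>1 \<xi> + (- (tu)) *\<^sub>R \<xi>\<^sub>2 in (u, s \<xi> - \<beta> *\<^sub>R u))" for \<xi>\<^sub>2
      proof -
        have b: "\<beta> * (tu) = tx" using \<beta> by simp
        have gx: "gradient U (x\<^sub>1 \<xi>) = L *\<^sub>R x\<^sub>1 \<xi>" using far[OF True] by (simp add: grad)
        have "s \<xi> - \<beta> *\<^sub>R (x\<^sub>1 \<xi> + (- (tu)) *\<^sub>R \<xi>\<^sub>2) =
          (c\<^sub>2 - \<beta>) *\<^sub>R x\<^sub>1 \<xi> - m + (\<beta> * (tu)) *\<^sub>R \<xi>\<^sub>2"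
          by (simp add: sx algebra_simps)
        also have "\<dots> = (1 + T) *\<^sub>R x\<^sub>1 \<xi> - m + (tx) *\<^sub>R \<xi>\<^sub>2"
          unfolding b by (simp add: c\<^sub>2_def)
        also have "\<dots> = x\<^sub>1 \<xi> + \<beta> *\<^sub>R (x\<^sub>1 \<xi> - (x - (tu) *\<^sub>R \<xi>)) - \<alpha> *\<^sub>R gradient U (x\<^sub>1 \<xi>) + (tx) *\<^sub>R \<xi>\<^sub>2"
        proof -
          have "\<beta> *\<^sub>R ((tu) *\<^sub>R \<xi>) = x\<^sub>1 \<xi> - f"
            unfolding scaleR_scaleR b by (simp add: x\<^sub>1_def)
          then have "\<beta> *\<^sub>R (x\<^sub>1 \<xi> - (x - (tu) *\<^sub>R \<xi>)) = \<beta> *\<^sub>R x\<^sub>1 \<xi> - \<beta> *\<^sub>R x + (x\<^sub>1 \<xi> - f)"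
            by (simp only: scaleR_diff_right) simp
          then show ?thesis unfolding gx by (simp only:) (simp add: m_def T_def scaleR_2 algebra_simps)
        qed
        finally show ?thesis by (simp add: step1 Let_def) (simp add: hb_def)
      qed
      define g where "g u = (indicator A (?psi (s \<xi>, u)) :: ennreal)" for u
      have [measurable]: "g \<in> borel_measurable borel" unfolding g_def by measurable
      have "?J (s \<xi>) * indicator (ball S 1) (s \<xi>) = ennreal \<epsilon>\<^sub>2 * (\<integral>\<^sup>+u. g u * indicator (ball 0 1) u \<partial>lborel)"
        using True by (simp add: g_def)
      also have "\<dots> \<le> (\<integral>\<^sup>+\<xi>\<^sub>2. g (x\<^sub>1 \<xi> + (- (tu)) *\<^sub>R \<xi>\<^sub>2) \<partial>std_gaussian)"
        using far[OF True] by (intro low2[rule_format]) auto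
      finally show ?thesis by (simp add: hb2 g_def Let_def)
    qed simp
    have cf: "norm (c\<^sub>2 *\<^sub>R f - m) \<le> c\<^sub>2 * F + (r + F)"
      using norm_triangle_ineq4[of "c\<^sub>2 *\<^sub>R f" m] c\<^sub>2 f m by (smt (verit) mult_left_mono norm_scaleR)
    let ?g1 = "\<lambda>s. ?J s * indicator (ball S 1) s"
    have g1: "?g1 \<in> borel_measurable borel" by measurable
    have "emeasure \<nu> A \<le> ennreal \<epsilon>\<^sub>1 * (\<integral>\<^sup>+s. ?g1 s * indicator (ball S 1) s \<partial>lborel)"
      unfolding em\<nu>[OF A] by (intro mult_left_mono nn_integral_mono) (auto simp: indicator_def)
    also have "\<dots> \<le> (\<integral>\<^sup>+\<xi>. ?g1 (s \<xi>) \<partial>std_gaussian)"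
      unfolding s_def by (rule low1[rule_format, OF cf g1])
    also have "\<dots> \<le> (\<integral>\<^sup>+\<xi>. \<integral>\<^sup>+\<xi>\<^sub>2. indicator A (\<Psi> (hb \<xi>\<^sub>2 (hb \<xi> (\<Phi> z)))) \<partial>std_gaussian \<partial>std_gaussian)"
      by (rule nn_integral_mono) (rule inner)
    also have "\<dots> = emeasure (Q z \<bind> Q) A" by (rule emeasure_two_steps[OF A, symmetric])
    finally show "emeasure \<nu> A \<le> emeasure (Q z \<bind> Q) A" .
  qed
qed

lemma invariant_law_exists:
  "\<exists>\<pi>. unique_invariant_law Q \<pi> \<and> (\<integral>\<^sup>+y. ennreal (V y) \<partial>\<pi>) \<le> ennreal (K\<^sub>1 * (1 + \<Lambda>\<^sup>2) / (1 - \<rho>))"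
proof (rule harris_theorem_two_step[where ?z0.0="\<Psi> (0, 0)"])
  show "V (\<Psi> (0, 0)) = 0"
    using N_upper[of "(0, 0)"] N_nonneg[of "(0, 0)"] by (simp add: V_def zero_prod_def[symmetric])
qed (use Q_kernel V_meas drift \<rho> K\<^sub>1 minorisation in \<open>auto simp: V_def\<close>)

lemma norm_\<Psi>: "norm (\<Psi> e) \<le> c\<^sub>1 * norm e + h / 2 * \<Lambda>"
proof -
  obtain u x where e: "e = (u, x)" by (cases e)
  have ux: "norm u \<le> norm e" "norm x \<le> norm e"
    using norm_fst_le[where x=u and y=x] norm_snd_le[where x=u and y=x] by (auto simp: e)
  have "norm (\<Psi> e) \<le> norm x + norm ((1 / q) *\<^sub>R (x - u) - (h / 2) *\<^sub>R gradient U x)"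
    unfolding e \<Psi>_def by (simp add: norm_Pair_le)
  also have "norm ((1 / q) *\<^sub>R (x - u) - (h / 2) *\<^sub>R gradient U x) \<le> norm ((1 / q) *\<^sub>R (x - u)) + norm ((h / 2) *\<^sub>R gradient U x)"
    by (rule norm_triangle_ineq4)
  also have "norm ((1 / q) *\<^sub>R (x - u)) \<le> 1 / q * (norm e + norm e)"
    using q ux norm_triangle_ineq4[of x u] by (simp add: divide_right_mono)
  also have "norm ((h / 2) *\<^sub>R gradient U x) \<le> h / 2 * (L * norm e + \<Lambda>)"
  proof -
    have "norm (gradient U x) \<le> norm (L *\<^sub>R x) + norm (B x)" unfolding grad by (rule norm_triangle_ineq)
    also have "\<dots> \<le> L * norm e + \<Lambda>" using L ux B_bound by (intro add_mono) auto
    finally show ?thesis using h by simp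
  qed
  finally show ?thesis using ux by (simp add: c\<^sub>1_def algebra_simps)
qed

text \<open>
  The coupling of a Dirac mass with \<open>\<pi>\<close> is their product, so the distance is controlled by the second
  moment of \<open>\<pi>\<close>. The bound is linear in the starting point and in the size \<open>\<Lambda>\<close> of the perturbation,
  with a constant that is independent of the potential.
\<close>

lemma W2_bound:
  assumes \<pi>: "unique_invariant_law Q \<pi>" "(\<integral>\<^sup>+y. ennreal (V y) \<partial>\<pi>) \<le> ennreal (K\<^sub>1 * (1 + \<Lambda>\<^sup>2) / (1 - \<rho>))"
  shows "W2 (dirac z) \<pi> \<le> ennreal (M\<^sub>W * (1 + norm (\<Phi> z) + \<Lambda>))"
proof -
  have p: "prob_space \<pi>" and s [measurable_cong]: "sets \<pi> = sets borel"
    using \<pi> by (auto simp: unique_invariant_law_def invariant_law_def)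
  interpret prob_space \<pi> by fact
  define \<Gamma> where "\<Gamma> = distr \<pi> (borel \<Otimes>\<^sub>M borel) (\<lambda>y. (z, y))"
  have m [measurable]: "(\<lambda>y. (z, y)) \<in> \<pi> \<rightarrow>\<^sub>M borel \<Otimes>\<^sub>M borel" by measurable
  have "\<Gamma> \<in> couplings (dirac z) \<pi>"
  proof -
    have "distr \<Gamma> borel fst = distr \<pi> borel (\<lambda>_. z)"
      unfolding \<Gamma>_def by (subst distr_distr[OF measurable_fst m]) (simp add: comp_def)
    also have "\<dots> = dirac z" by (rule distr_const) simp
    finally have 1: "distr \<Gamma> borel fst = dirac z" .
    have "distr \<Gamma> borel snd = distr \<pi> borel (\<lambda>y. y)"
      unfolding \<Gamma>_def by (subst distr_distr[OF measurable_snd m]) (simp add: comp_def)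
    also have "\<dots> = \<pi>" by (rule distr_id2) (rule s[symmetric])
    finally show ?thesis using 1 by (simp add: couplings_def \<Gamma>_def)
  qed
  let ?a = "3 * (c\<^sub>1\<^sup>2 * (norm (\<Phi> z))\<^sup>2 + 4 * (h / 2)\<^sup>2 * \<Lambda>\<^sup>2)" and ?b = "3 * (c\<^sub>1\<^sup>2 * c\<^sup>2)"
  have pt: "(dist z y)\<^sup>2 \<le> ?a + ?b * V y" for y
  proof -
    have "dist z y \<le> norm z + norm y" by (simp add: dist_norm norm_triangle_ineq4)
    also have "norm z \<le> c\<^sub>1 * norm (\<Phi> z) + h / 2 * \<Lambda>" using norm_\<Psi>[of "\<Phi> z"] by simp
    also have "norm y \<le> c\<^sub>1 * norm (\<Phi> y) + h / 2 * \<Lambda>" using norm_\<Psi>[of "\<Phi> y"] by simp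
    also have "c\<^sub>1 * norm (\<Phi> y) \<le> c\<^sub>1 * (c * N (\<Phi> y))" using c\<^sub>1 N_lower by (intro mult_left_mono) auto
    finally have "dist z y \<le> c\<^sub>1 * norm (\<Phi> z) + c\<^sub>1 * c * N (\<Phi> y) + 2 * (h / 2) * \<Lambda>" by (simp add: algebra_simps)
    then have "(dist z y)\<^sup>2 \<le> (c\<^sub>1 * norm (\<Phi> z) + c\<^sub>1 * c * N (\<Phi> y) + 2 * (h / 2) * \<Lambda>)\<^sup>2"
      by (intro power_mono) auto
    also have "\<dots> \<le> 3 * ((c\<^sub>1 * norm (\<Phi> z))\<^sup>2 + (c\<^sub>1 * c * N (\<Phi> y))\<^sup>2 + (2 * (h / 2) * \<Lambda>)\<^sup>2)"
    proof -
      have "(p + q + r)\<^sup>2 \<le> 3 * (p\<^sup>2 + q\<^sup>2 + r\<^sup>2)" for p q r :: real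
        using sum_squares_bound[of p q] sum_squares_bound[of q r] sum_squares_bound[of p r]
        by (simp add: power2_eq_square algebra_simps)
      then show ?thesis .
    qed
    finally show ?thesis by (simp add: V_def power_mult_distrib power_divide algebra_simps)
  qed
  have a0: "0 \<le> ?a" and b0: "0 \<le> ?b" by simp_all
  have Vi: "(\<integral>\<^sup>+y. ennreal (V y) \<partial>\<pi>) \<le> ennreal (K\<^sub>1 / (1 - \<rho>) * (1 + \<Lambda>\<^sup>2))" using \<pi>(2) by simp
  have K0: "0 \<le> K\<^sub>1 / (1 - \<rho>)" using K\<^sub>1 \<rho> by simp
  have "(INF \<Gamma>\<in>couplings (dirac z) \<pi>. \<integral>\<^sup>+ (x, y). ennreal ((dist x y)\<^sup>2) \<partial>\<Gamma>) \<le> (\<integral>\<^sup>+ (x, y). ennreal ((dist x y)\<^sup>2) \<partial>\<Gamma>)"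
    by (rule INF_lower) fact
  also have "\<dots> = (\<integral>\<^sup>+y. ennreal ((dist z y)\<^sup>2) \<partial>\<pi>)"
    unfolding \<Gamma>_def by (subst nn_integral_distr[OF m]) auto
  also have "\<dots> \<le> (\<integral>\<^sup>+y. ennreal ?a + ennreal ?b * ennreal (V y) \<partial>\<pi>)"
  proof (rule nn_integral_mono)
    fix y
    have "ennreal ((dist z y)\<^sup>2) \<le> ennreal (?a + ?b * V y)" by (rule ennreal_leI[OF pt])
    also have "\<dots> = ennreal ?a + ennreal ?b * ennreal (V y)"
      by (subst ennreal_plus) (use a0 b0 in \<open>auto simp: V_def ennreal_mult[symmetric]\<close>)
    finally show "ennreal ((dist z y)\<^sup>2) \<le> \<dots>" .
  qed
  also have "\<dots> = ennreal ?a + ennreal ?b * (\<integral>\<^sup>+y. ennreal (V y) \<partial>\<pi>)"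
    by (subst nn_integral_add, simp, simp, subst nn_integral_cmult) (auto simp: emeasure_space_1)
  also have "\<dots> \<le> ennreal ?a + ennreal ?b * ennreal (K\<^sub>1 / (1 - \<rho>) * (1 + \<Lambda>\<^sup>2))"
    by (intro add_left_mono mult_left_mono Vi) auto
  also have "\<dots> = ennreal (?a + ?b * (K\<^sub>1 / (1 - \<rho>) * (1 + \<Lambda>\<^sup>2)))"
  proof -
    have "0 \<le> K\<^sub>1 / (1 - \<rho>) * (1 + \<Lambda>\<^sup>2)" by (intro mult_nonneg_nonneg K0) simp
    then show ?thesis using a0 b0 by (simp only: ennreal_mult[OF b0, symmetric] ennreal_plus[symmetric] mult_nonneg_nonneg)
  qed
  also have "\<dots> \<le> ennreal ((M\<^sub>W * (1 + norm (\<Phi> z) + \<Lambda>))\<^sup>2)"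
  proof (rule ennreal_leI)
    let ?x = "norm (\<Phi> z)" and ?k = "K\<^sub>1 / (1 - \<rho>)"
    have M2: "M\<^sub>W\<^sup>2 = 3 * (c\<^sub>1\<^sup>2 + c\<^sub>1\<^sup>2 * c\<^sup>2 * ?k + 4 * (h / 2)\<^sup>2)"
      unfolding M\<^sub>W_def
      by (rule real_sqrt_pow2) (intro mult_nonneg_nonneg add_nonneg_nonneg K0 zero_le_power2, simp_all)
    have x: "0 \<le> ?x" by simp
    have sq: "(1 + ?x + \<Lambda>)\<^sup>2 = 1 + ?x\<^sup>2 + \<Lambda>\<^sup>2 + 2 * ?x + 2 * \<Lambda> + 2 * (?x * \<Lambda>)"
      by (simp add: power2_eq_square algebra_simps)
    have "0 \<le> ?x * \<Lambda>" using \<Lambda> by simp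
    then have le: "?x\<^sup>2 \<le> (1 + ?x + \<Lambda>)\<^sup>2" "1 + \<Lambda>\<^sup>2 \<le> (1 + ?x + \<Lambda>)\<^sup>2" "\<Lambda>\<^sup>2 \<le> (1 + ?x + \<Lambda>)\<^sup>2"
      unfolding sq using x \<Lambda> by (smt (verit) zero_le_power2)+
    have "?a + ?b * (?k * (1 + \<Lambda>\<^sup>2)) = 3 * c\<^sub>1\<^sup>2 * ?x\<^sup>2 + (3 * (c\<^sub>1\<^sup>2 * c\<^sup>2) * ?k) * (1 + \<Lambda>\<^sup>2) + 3 * (4 * (h / 2)\<^sup>2) * \<Lambda>\<^sup>2"
      by (simp add: algebra_simps)
    also have "\<dots> \<le> 3 * c\<^sub>1\<^sup>2 * (1 + ?x + \<Lambda>)\<^sup>2 + (3 * (c\<^sub>1\<^sup>2 * c\<^sup>2) * ?k) * (1 + ?x + \<Lambda>)\<^sup>2 + 3 * (4 * (h / 2)\<^sup>2) * (1 + ?x + \<Lambda>)\<^sup>2"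
      by (intro add_mono mult_left_mono le mult_nonneg_nonneg K0 zero_le_power2) simp_all
    also have "\<dots> = (M\<^sub>W * (1 + ?x + \<Lambda>))\<^sup>2"
      unfolding power_mult_distrib M2 by (simp add: algebra_simps)
    finally show "?a + ?b * (?k * (1 + \<Lambda>\<^sup>2)) \<le> (M\<^sub>W * (1 + ?x + \<Lambda>))\<^sup>2" .
  qed
  finally have *: "(INF \<Gamma>\<in>couplings (dirac z) \<pi>. \<integral>\<^sup>+ (x, y). ennreal ((dist x y)\<^sup>2) \<partial>\<Gamma>)
    \<le> ennreal ((M\<^sub>W * (1 + norm (\<Phi> z) + \<Lambda>))\<^sup>2)" (is "?I \<le> _") .
  then have fin: "?I \<noteq> \<infinity>" by (metis ennreal_neq_top infinity_ennreal_def neq_top_trans)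
  note M0 = M\<^sub>W
  have "enn2real ?I \<le> (M\<^sub>W * (1 + norm (\<Phi> z) + \<Lambda>))\<^sup>2"
    using enn2real_mono[OF *] by simp
  then have "enn2real ?I powr (1 / 2) \<le> M\<^sub>W * (1 + norm (\<Phi> z) + \<Lambda>)"
    using M0 \<Lambda> by (simp add: powr_half_sqrt real_le_lsqrt)
  then show ?thesis
    using fin unfolding W2_def epowr_def by (simp only: if_False ennreal_leI)
qed

end

section \<open>Tracking orbits of the iteration without noise\<close>

definition heavy_ball_orbit :: "real \<Rightarrow> real \<Rightarrow> ('a::real_vector \<Rightarrow> 'a) \<Rightarrow> (nat \<Rightarrow> 'a) \<Rightarrow> bool" where
  "heavy_ball_orbit \<beta> \<alpha> G ob \<longleftrightarrow>
     (\<forall>n. ob (Suc (Suc n)) = ob (Suc n) + \<beta> *\<^sub>R (ob (Suc n) - ob n) - \<alpha> *\<^sub>R G (ob (Suc n)))"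

text \<open>
  The initial point \<open>ob 0\<close> plays the role of the auxiliary coordinate \<open>u\<close>, at which no gradient is
  evaluated; hence the index shift.
\<close>

definition constant_near_orbit :: "real \<Rightarrow> ('a::real_normed_vector \<Rightarrow> 'a) \<Rightarrow> (nat \<Rightarrow> 'a) \<Rightarrow> bool" where
  "constant_near_orbit r B ob \<longleftrightarrow> (\<forall>m x. norm (x - ob (Suc m)) \<le> r \<longrightarrow> B x = B (ob (Suc m)))"

definition perturbed_quadratic :: "real \<Rightarrow> real \<Rightarrow> ('a::euclidean_space \<Rightarrow> real) \<Rightarrow> ('a \<Rightarrow> 'a) \<Rightarrow> bool" where
  "perturbed_quadratic L \<Lambda> U B \<longleftrightarrow> (\<forall>x. gradient U x = L *\<^sub>R x + B x) \<and> continuous_on UNIV B \<and>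
     (\<forall>x. norm (B x) \<le> \<Lambda>) \<and> (\<exists>R. \<forall>x. R \<le> norm x \<longrightarrow> B x = 0)"

definition slow_mixing_at :: "real \<Rightarrow> real \<Rightarrow> ('a::euclidean_space \<Rightarrow> real) \<Rightarrow> nat \<Rightarrow> real \<Rightarrow> bool" where
  "slow_mixing_at h \<gamma> U n w \<longleftrightarrow> (\<exists>\<pi> z. unique_invariant_law (baoab_kernel h \<gamma> U) \<pi> \<and>
     1 / 4 \<le> tv_dist (apply_kernel (baoab_kernel h \<gamma> U) n (dirac z)) \<pi> \<and> W2 (dirac z) \<pi> \<le> ennreal w)"

lemma slow_mixing_at_mono: "slow_mixing_at h \<gamma> U n w \<Longrightarrow> w \<le> w' \<Longrightarrow> slow_mixing_at h \<gamma> U n w'"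
  unfolding slow_mixing_at_def by (meson ennreal_leI order_trans)

context baoab_chain begin

definition near_orbit :: "(nat \<Rightarrow> 'a) \<Rightarrow> real \<Rightarrow> nat \<Rightarrow> ('a \<times> 'a) set" where
  "near_orbit o' r n = {z. N (\<Phi> z - (o' n, o' (Suc n))) \<le> r / c}"

lemma near_orbit_sets [measurable]: "near_orbit o' r n \<in> sets borel"
  unfolding near_orbit_def by measurable

lemma near_orbit_dist:
  assumes "z \<in> near_orbit o' r n"
  shows "norm (fst z - o' (Suc n)) \<le> r"
proof -
  have "norm (fst z - o' (Suc n)) = norm (snd (\<Phi> z - (o' n, o' (Suc n))))"
    by (simp add: snd_\<Phi>)
  also have "\<dots> \<le> norm (\<Phi> z - (o' n, o' (Suc n)))"
    by (metis norm_snd_le prod.collapse)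
  also have "\<dots> \<le> c * N (\<Phi> z - (o' n, o' (Suc n)))" by (rule N_lower)
  also have "\<dots> \<le> r" using assms c by (simp add: near_orbit_def pos_le_divide_eq mult.commute)
  finally show ?thesis .
qed

text \<open>
  Near the orbit the gradient is \<open>L x\<close> plus a constant, so the deviation from the orbit follows the
  linear recursion and is contracted by \<open>\<rho>\<close>. It stays below \<open>r / c\<close> unless the noise is larger than
  a multiple of \<open>r\<close>, which by Chebyshev's inequality has probability at most \<open>M\<^sub>T / r\<^sup>2\<close>.
\<close>

lemma near_orbit_step:
  assumes orbit: "heavy_ball_orbit \<beta> \<alpha> (gradient U) o'" and flat: "constant_near_orbit r B o'"
    and z: "z \<in> near_orbit o' r n" and r: "0 < r"
  shows "1 - M\<^sub>T / r\<^sup>2 \<le> measure (Q z) (near_orbit o' r (Suc n))"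
proof -
  interpret G: prob_space "std_gaussian :: 'a measure" by (rule prob_space_std_gaussian)
  obtain u x where ux: "\<Phi> z = (u, x)" by (cases "\<Phi> z")
  have Bx: "B x = B (o' (Suc n))"
    using near_orbit_dist[OF z] snd_\<Phi>[of z] flat by (simp add: ux constant_near_orbit_def)
  have orbit': "o' (Suc (Suc n)) = o' (Suc n) + \<beta> *\<^sub>R (o' (Suc n) - o' n) - \<alpha> *\<^sub>R (L *\<^sub>R o' (Suc n) + B (o' (Suc n)))"
    using orbit by (simp add: heavy_ball_orbit_def grad)
  define s where "s = (1 - \<rho>) * (r / c) / (c * \<kappa>\<^sub>1)"
  have s: "0 < s" using \<rho> r c \<kappa>\<^sub>1 by (simp add: s_def)
  have good: "\<Psi> (hb \<xi> (\<Phi> z)) \<in> near_orbit o' r (Suc n)" if "norm \<xi> < s" for \<xi>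
  proof -
    have "hb \<xi> (\<Phi> z) - (o' (Suc n), o' (Suc (Suc n)))
       = (x - o' (Suc n), T *\<^sub>R (x - o' (Suc n)) - \<beta> *\<^sub>R (u - o' n))
         + (- (tu) *\<^sub>R \<xi>, (tx) *\<^sub>R \<xi>)"
      unfolding ux hb_split orbit' Bx by (simp add: T_def algebra_simps)
    then have "N (hb \<xi> (\<Phi> z) - (o' (Suc n), o' (Suc (Suc n))))
      \<le> N (x - o' (Suc n), T *\<^sub>R (x - o' (Suc n)) - \<beta> *\<^sub>R (u - o' n)) + c * \<kappa>\<^sub>1 * norm \<xi>"
      using order_trans[OF N_triangle add_left_mono[OF N_noise]] by metis
    also have "\<dots> \<le> \<rho> * N (u - o' n, x - o' (Suc n)) + c * \<kappa>\<^sub>1 * s"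
      using that c \<kappa>\<^sub>1 by (intro add_mono N_contract mult_left_mono) auto
    also have "\<dots> \<le> \<rho> * (r / c) + (1 - \<rho>) * (r / c)"
      using z \<rho> c \<kappa>\<^sub>1 by (intro add_mono mult_left_mono) (auto simp: near_orbit_def ux s_def)
    also have "\<dots> = r / c" unfolding distrib_right[symmetric] by simp
    finally show ?thesis by (simp add: near_orbit_def)
  qed
  have "1 - real DIM('a) / s\<^sup>2 \<le> 1 - measure (std_gaussian :: 'a measure) {\<xi>. s \<le> norm \<xi>}"
    using std_gaussian_tail[OF s, where 'a='a] by simp
  also have "\<dots> = measure (std_gaussian :: 'a measure) (space std_gaussian - {\<xi>. s \<le> norm \<xi>})"
    by (rule G.prob_compl[symmetric]) simp
  also have "\<dots> \<le> measure (std_gaussian :: 'a measure) ((\<lambda>\<xi>. baoab_step h \<gamma> U \<xi> z) -` near_orbit o' r (Suc n) \<inter> space std_gaussian)"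
  proof (rule G.finite_measure_mono)
    show "space std_gaussian - {\<xi>. s \<le> norm \<xi>} \<subseteq> (\<lambda>\<xi>. baoab_step h \<gamma> U \<xi> z) -` near_orbit o' r (Suc n) \<inter> space std_gaussian"
      using good by (auto simp: step_conj not_le)
    show "(\<lambda>\<xi>. baoab_step h \<gamma> U \<xi> z) -` near_orbit o' r (Suc n) \<inter> space std_gaussian \<in> G.events"
      using measurable_sets[OF step_meas1 near_orbit_sets] by simp
  qed
  also have "\<dots> = measure (Q z) (near_orbit o' r (Suc n))"
    unfolding baoab_kernel_def
    by (rule measure_distr[symmetric]) (use step_meas1 in \<open>auto cong: measurable_cong_sets\<close>)
  also have "real DIM('a) / s\<^sup>2 = M\<^sub>T / r\<^sup>2"
    using c \<rho> r \<kappa>\<^sub>1 by (simp add: s_def M\<^sub>T_def power_divide power_mult_distrib power2_eq_square power4_eq_xxxx mult_ac)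
  finally show ?thesis .
qed

lemma tracking:
  assumes orbit: "heavy_ball_orbit \<beta> \<alpha> (gradient U) o'" and flat: "constant_near_orbit r B o'"
    and r: "0 < r" and z: "z = \<Psi> (o' 0, o' 1)"
  shows "1 - real n * (M\<^sub>T / r\<^sup>2) \<le> measure (apply_kernel Q n (dirac z)) (near_orbit o' r n)"
proof (induction n)
  case 0
  have "N 0 = 0" using N_upper[of 0] N_nonneg[of 0] by simp
  then have "z \<in> near_orbit o' r 0" using r c by (simp add: near_orbit_def z)
  then show ?case by (simp add: measure_return)
next
  case (Suc n)
  let ?\<mu> = "apply_kernel Q n (dirac z)" and ?p = "M\<^sub>T / r\<^sup>2"
  have P: "?\<mu> \<in> space (prob_algebra borel)"
    by (rule apply_kernel_in_prob_algebra[OF Q_kernel dirac_in_prob_algebra])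
  then interpret M: prob_space ?\<mu> by (simp add: space_prob_algebra)
  have s [measurable_cong]: "sets ?\<mu> = sets borel" using P by (simp add: space_prob_algebra)
  have QN: "Q \<in> ?\<mu> \<rightarrow>\<^sub>M subprob_algebra borel"
    using measurable_prob_algebraD[OF Q_kernel] s by (simp cong: measurable_cong_sets)
  have Qm: "(\<lambda>y. measure (Q y) (near_orbit o' r (Suc n))) \<in> borel_measurable borel"
    by (rule measurable_compose[OF Q_kernel measurable_measure_prob_algebra[OF near_orbit_sets]])
  have Qp: "prob_space (Q y)" for y using measurable_space[OF Q_kernel, of y] by (auto simp: space_prob_algebra)
  have p: "0 \<le> ?p" using M\<^sub>T by simp
  have "1 - real (Suc n) * ?p \<le> M.prob (near_orbit o' r n) - ?p * 1"
  proof -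
    have "real (Suc n) * ?p = real n * ?p + ?p" by (simp only: of_nat_Suc distrib_right mult_1_left add.commute)
    then show ?thesis using Suc.IH by simp
  qed
  also have "\<dots> \<le> M.prob (near_orbit o' r n) - ?p * M.prob (near_orbit o' r n)"
    by (intro diff_left_mono mult_left_mono M.prob_le_1 p)
  also have "\<dots> = (\<integral>y. (1 - ?p) * indicator (near_orbit o' r n) y \<partial>?\<mu>)"
  proof -
    have "(\<integral>y. indicator (near_orbit o' r n) y \<partial>?\<mu>) = M.prob (near_orbit o' r n)"
      using sets_eq_imp_space_eq[OF s] by simp
    then show ?thesis by (subst integral_mult_right_zero) (simp only: left_diff_distrib mult_1_left)
  qed
  also have "\<dots> \<le> (\<integral>y. measure (Q y) (near_orbit o' r (Suc n)) \<partial>?\<mu>)"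
  proof (rule integral_mono)
    show "integrable ?\<mu> (\<lambda>y. (1 - ?p) * indicator (near_orbit o' r n) y)"
      by (intro integrable_mult_right integrable_real_indicator) (auto simp: s M.emeasure_eq_measure)
    show "integrable ?\<mu> (\<lambda>y. measure (Q y) (near_orbit o' r (Suc n)))"
      using Qm s prob_space.prob_le_1[OF Qp] by (intro M.integrable_const_bound[where B=1]) (auto cong: measurable_cong_sets)
    show "(1 - ?p) * indicator (near_orbit o' r n) y \<le> measure (Q y) (near_orbit o' r (Suc n))" for y
      using near_orbit_step[OF orbit flat _ r, of y n] by (cases "y \<in> near_orbit o' r n") auto
  qed
  also have "\<dots> = measure (apply_kernel Q (Suc n) (dirac z)) (near_orbit o' r (Suc n))"
    unfolding apply_kernel_Suc by (rule M.measure_bind[OF QN near_orbit_sets, symmetric])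
  finally show ?case .
qed

lemma tv_dist_ge:
  assumes "prob_space \<mu>" "prob_space \<nu>" "A \<in> sets borel"
  shows "\<bar>measure \<mu> A - measure \<nu> A\<bar> \<le> tv_dist \<mu> \<nu>"
  unfolding tv_dist_def
proof (rule cSUP_upper[OF assms(3)], rule bdd_aboveI2)
  fix A
  have "0 \<le> measure \<mu> A" "measure \<mu> A \<le> 1" "0 \<le> measure \<nu> A" "measure \<nu> A \<le> 1"
    using prob_space.prob_le_1 assms by auto
  then show "\<bar>measure \<mu> A - measure \<nu> A\<bar> \<le> 1" by linarith
qed

text \<open>
  From each of the two starting points the chain is found near its own orbit with probability at
  least \<open>3/4\<close>. As the two neighbourhoods are disjoint, \<open>\<pi>\<close> gives mass at most \<open>1/2\<close> to one of them,
  and the corresponding starting point is at distance at least \<open>1/4\<close> from \<open>\<pi>\<close>.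
\<close>

lemma slow_from_two_orbits:
  assumes orb: "heavy_ball_orbit \<beta> \<alpha> (gradient U) o1" "heavy_ball_orbit \<beta> \<alpha> (gradient U) o2"
    and flat: "constant_near_orbit r B o1" "constant_near_orbit r B o2"
    and sep: "2 * r < norm (o1 (Suc n) - o2 (Suc n))"
    and r: "0 < r" "4 * M\<^sub>T * real n \<le> r\<^sup>2"
  shows "slow_mixing_at h \<gamma> U n (M\<^sub>W * (1 + (norm (o1 0) + norm (o1 1) + norm (o2 0) + norm (o2 1)) + \<Lambda>))"
proof -
  obtain \<pi> where \<pi>: "unique_invariant_law Q \<pi>" "(\<integral>\<^sup>+y. ennreal (V y) \<partial>\<pi>) \<le> ennreal (K\<^sub>1 * (1 + \<Lambda>\<^sup>2) / (1 - \<rho>))"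
    using invariant_law_exists by blast
  have p: "prob_space \<pi>" "sets \<pi> = sets borel"
    using \<pi> by (auto simp: unique_invariant_law_def invariant_law_def)
  interpret prob_space \<pi> by fact
  let ?S = "norm (o1 0) + norm (o1 1) + norm (o2 0) + norm (o2 1)"
  let ?A1 = "near_orbit o1 r n" and ?A2 = "near_orbit o2 r n"
  have W: "W2 (dirac (\<Psi> e)) \<pi> \<le> ennreal (M\<^sub>W * (1 + ?S + \<Lambda>))" if "norm e \<le> ?S" for e
  proof -
    have "M\<^sub>W * (1 + norm (\<Phi> (\<Psi> e)) + \<Lambda>) \<le> M\<^sub>W * (1 + ?S + \<Lambda>)"
      using that M\<^sub>W by (intro mult_left_mono) auto
    then show ?thesis using W2_bound[OF \<pi>, of "\<Psi> e"] by (meson ennreal_leI order_trans)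
  qed
  have q: "real n * (M\<^sub>T / r\<^sup>2) \<le> 1 / 4"
    using r by (simp add: field_simps)
  have t: "3 / 4 \<le> measure (apply_kernel Q n (dirac (\<Psi> (o1 0, o1 1)))) ?A1"
     "3 / 4 \<le> measure (apply_kernel Q n (dirac (\<Psi> (o2 0, o2 1)))) ?A2"
    using tracking[OF orb(1) flat(1) r(1) refl, of n] tracking[OF orb(2) flat(2) r(1) refl, of n] q by simp_all
  have pk: "prob_space (apply_kernel Q n (dirac z))" for z
    using apply_kernel_in_prob_algebra[OF Q_kernel dirac_in_prob_algebra, of n z] by (simp add: space_prob_algebra)
  have "?A1 \<inter> ?A2 = {}"
  proof (rule ccontr)
    assume "?A1 \<inter> ?A2 \<noteq> {}"
    then obtain z where z: "z \<in> ?A1" "z \<in> ?A2" by blast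
    have "norm (o1 (Suc n) - o2 (Suc n)) \<le> norm (fst z - o2 (Suc n)) + norm (fst z - o1 (Suc n))"
      using norm_triangle_ineq4[of "fst z - o2 (Suc n)" "fst z - o1 (Suc n)"] by simp
    then show False using sep near_orbit_dist[OF z(1)] near_orbit_dist[OF z(2)] by linarith
  qed
  then have "measure \<pi> ?A1 + measure \<pi> ?A2 = measure \<pi> (?A1 \<union> ?A2)"
    using p by (subst finite_measure_Union) auto
  then have "measure \<pi> ?A1 + measure \<pi> ?A2 \<le> 1" using prob_le_1 by simp
  then consider "measure \<pi> ?A1 \<le> 1 / 2" | "measure \<pi> ?A2 \<le> 1 / 2" by linarith
  then have "\<exists>z. 1 / 4 \<le> tv_dist (apply_kernel Q n (dirac z)) \<pi> \<and> W2 (dirac z) \<pi> \<le> ennreal (M\<^sub>W * (1 + ?S + \<Lambda>))"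
  proof cases
    case 1
    have "1 / 4 \<le> tv_dist (apply_kernel Q n (dirac (\<Psi> (o1 0, o1 1)))) \<pi>"
      using tv_dist_ge[OF pk p(1) near_orbit_sets, of "\<Psi> (o1 0, o1 1)" o1 r n] t(1) 1 by linarith
    moreover have "norm (o1 0, o1 1) \<le> ?S" using norm_Pair_le[of "o1 0" "o1 1"] by (smt (verit) norm_ge_zero)
    ultimately show ?thesis using W by blast
  next
    case 2
    have "1 / 4 \<le> tv_dist (apply_kernel Q n (dirac (\<Psi> (o2 0, o2 1)))) \<pi>"
      using tv_dist_ge[OF pk p(1) near_orbit_sets, of "\<Psi> (o2 0, o2 1)" o2 r n] t(2) 2 by linarith
    moreover have "norm (o2 0, o2 1) \<le> ?S" using norm_Pair_le[of "o2 0" "o2 1"] by (smt (verit) norm_ge_zero)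
    ultimately show ?thesis using W by blast
  qed
  then show ?thesis using \<pi>(1) unfolding slow_mixing_at_def by blast
qed

end

text \<open>
  The previous result with the auxiliary norm eliminated. The point is the order of quantifiers: \<open>M\<close>
  is chosen before the potential and the orbits.
\<close>

lemma baoab_slow_mixing_criterion:
  fixes h \<gamma> L :: real
  assumes "0 < h" "0 < \<gamma>" "0 < L" "h\<^sup>2 * L < 4"
    and \<beta>: "\<beta> = exp (- \<gamma> * h)" and \<alpha>: "\<alpha> = h\<^sup>2 * (1 + \<beta>) / 2"
  shows "\<exists>M>0. \<forall>(U :: 'a::euclidean_space \<Rightarrow> real) B \<Lambda> o1 o2 n r. perturbed_quadratic L \<Lambda> U B \<longrightarrow>
    (\<forall>ob\<in>{o1, o2}. heavy_ball_orbit \<beta> \<alpha> (gradient U) ob \<and> constant_near_orbit r B ob) \<longrightarrow>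
    2 * r < norm (o1 (Suc n) - o2 (Suc n)) \<longrightarrow> 0 < r \<longrightarrow> M * real n \<le> r\<^sup>2 \<longrightarrow>
    slow_mixing_at h \<gamma> U n (M * (1 + (norm (o1 0) + norm (o1 1) + norm (o2 0) + norm (o2 1)) + \<Lambda>))"
proof -
  interpret P: baoab_params h \<gamma> L by standard fact+
  obtain N :: "'a \<times> 'a \<Rightarrow> real" and \<rho> c where "baoab_norm h \<gamma> L N \<rho> c"
    using adapted_norm_exists[OF P.\<beta> P.T, where 'a='a]
    unfolding baoab_norm_def baoab_norm_axioms_def using P.baoab_params_axioms by blast
  then interpret N: baoab_norm h \<gamma> L N \<rho> c .
  define M where "M = 1 + 4 * N.M\<^sub>T + N.M\<^sub>W"
  have M: "0 < M" "4 * N.M\<^sub>T \<le> M" "N.M\<^sub>W \<le> M" using N.M\<^sub>T N.M\<^sub>W by (auto simp: M_def)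
  have eqs: "P.\<beta> = \<beta>" "P.\<alpha> = \<alpha>" by (simp_all add: P.\<beta>_def P.\<alpha>_def \<beta> \<alpha>)
  show ?thesis
  proof (rule exI[of _ M], intro conjI allI impI, rule M(1))
    fix U :: "'a \<Rightarrow> real" and B \<Lambda> o1 o2 n r
    assume U: "perturbed_quadratic L \<Lambda> U B"
      and orb: "\<forall>ob\<in>{o1, o2}. heavy_ball_orbit \<beta> \<alpha> (gradient U) ob \<and> constant_near_orbit r B ob"
      and sep: "2 * r < norm (o1 (Suc n) - o2 (Suc n))" and r: "0 < r" and rn: "M * real n \<le> r\<^sup>2"
    obtain R where R: "\<forall>x. R \<le> norm x \<longrightarrow> B x = 0"
      using U by (auto simp: perturbed_quadratic_def)
    interpret C: baoab_chain \<rho> c h \<gamma> L N U B \<Lambda> R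
      by standard (use U R in \<open>auto simp: perturbed_quadratic_def intro: borel_measurable_continuous_onI\<close>)
    have rn': "4 * N.M\<^sub>T * real n \<le> r\<^sup>2"
      using mult_right_mono[OF M(2), of "real n"] rn by simp
    let ?S = "norm (o1 0) + norm (o1 1) + norm (o2 0) + norm (o2 1)"
    have "0 \<le> ?S" by (intro add_nonneg_nonneg) auto
    then have le: "N.M\<^sub>W * (1 + ?S + \<Lambda>) \<le> M * (1 + ?S + \<Lambda>)"
      using M C.\<Lambda> by (intro mult_right_mono) auto
    show "slow_mixing_at h \<gamma> U n (M * (1 + ?S + \<Lambda>))"
    proof (rule slow_mixing_at_mono[OF C.slow_from_two_orbits le])
      show "2 * r < norm (o1 (Suc n) - o2 (Suc n))" "0 < r" "4 * N.M\<^sub>T * real n \<le> r\<^sup>2" by fact+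
    qed (use orb in \<open>simp_all add: eqs\<close>)
  qed
qed

section \<open>Smooth functions\<close>

lemma C_k_SucI:
  assumes "\<And>x. (f has_derivative f' x) (at x)" "\<And>v. C_k k (\<lambda>x. f' x v)"
  shows "C_k (Suc k) f"
proof -
  have "frechet_derivative f (at x) = f' x" for x
    using frechet_derivative_at[OF assms(1)] by simp
  then show ?thesis using assms by (auto simp: differentiable_def)
qed

lemma C_k_SucD:
  assumes "C_k (Suc k) f"
  shows "(f has_derivative frechet_derivative f (at x)) (at x)" "C_k k (\<lambda>x. frechet_derivative f (at x) v)"
  using assms by (auto simp: frechet_derivative_works)

lemma C_k_Suc_imp: "C_k (Suc k) f \<Longrightarrow> C_k k f"
proof (induction k arbitrary: f)
  case 0
  then show ?case by (auto intro!: differentiable_imp_continuous_on simp: differentiable_on_def)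
next
  case (Suc k)
  then show ?case by simp
qed

lemma C_k_const: "C_k k (\<lambda>x::'a::euclidean_space. c)"
proof (induction k arbitrary: c)
  case (Suc k)
  show ?case by (rule C_k_SucI[where f'="\<lambda>_ _. 0"]) (auto intro: Suc)
qed simp

lemma C_k_linear: "bounded_linear f \<Longrightarrow> C_k k f"
proof (induction k)
  case 0
  then show ?case by (simp add: linear_continuous_on)
next
  case (Suc k)
  show ?case by (rule C_k_SucI[where f'="\<lambda>_. f"]) (auto intro: bounded_linear_imp_has_derivative Suc.prems C_k_const)
qed

lemma C_k_add: "C_k k f \<Longrightarrow> C_k k g \<Longrightarrow> C_k k (\<lambda>x. f x + g x)"
proof (induction k arbitrary: f g)
  case 0
  then show ?case by (auto intro: continuous_intros)
next
  case (Suc k)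
  show ?case
    by (rule C_k_SucI[OF has_derivative_add[OF C_k_SucD(1)[OF Suc.prems(1)] C_k_SucD(1)[OF Suc.prems(2)]]])
       (intro Suc.IH C_k_SucD(2) Suc.prems)
qed

lemma C_k_mult: "C_k k f \<Longrightarrow> C_k k g \<Longrightarrow> C_k k (\<lambda>x. f x * g x)"
proof (induction k arbitrary: f g)
  case 0
  then show ?case by (auto intro: continuous_intros)
next
  case (Suc k)
  show ?case
    by (rule C_k_SucI[OF has_derivative_mult[OF C_k_SucD(1)[OF Suc.prems(1)] C_k_SucD(1)[OF Suc.prems(2)]]])
       (intro C_k_add Suc.IH C_k_SucD(2) C_k_Suc_imp[OF Suc.prems(1)] C_k_Suc_imp[OF Suc.prems(2)] Suc.prems)
qed

lemma C_k_compose_real: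
  fixes g :: "real \<Rightarrow> real"
  shows "C_k k g \<Longrightarrow> C_k k f \<Longrightarrow> C_k k (\<lambda>x. g (f x))"
proof (induction k arbitrary: f g)
  case 0
  then show ?case by (auto intro: continuous_on_compose2)
next
  case (Suc k)
  have g: "(g has_derivative frechet_derivative g (at y)) (at y)" for y by (rule C_k_SucD(1)[OF Suc.prems(1)])
  have lin: "frechet_derivative g (at y) w = w * frechet_derivative g (at y) 1" for y w
    using linear_cmul[OF has_derivative_linear[OF g], of y w 1] by simp
  show ?case
  proof (rule C_k_SucI)
    show "((\<lambda>x. g (f x)) has_derivative (\<lambda>v. frechet_derivative g (at (f x)) (frechet_derivative f (at x) v))) (at x)" for x
      by (rule has_derivative_compose[OF C_k_SucD(1)[OF Suc.prems(2)] g])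
    show "C_k k (\<lambda>x. frechet_derivative g (at (f x)) (frechet_derivative f (at x) v))" for v
      by (subst lin) (rule C_k_mult[OF C_k_SucD(2)[OF Suc.prems(2)] Suc.IH[OF C_k_SucD(2)[OF Suc.prems(1)] C_k_Suc_imp[OF Suc.prems(2)]]])
  qed
qed

lemma C_k_sum: "(\<And>i. i \<in> I \<Longrightarrow> C_k k (f i)) \<Longrightarrow> C_k k (\<lambda>x. \<Sum>i\<in>I. f i x)"
  by (induction I rule: infinite_finite_induct) (auto intro: C_k_const C_k_add)

lemma C_k_inner_self: "C_k k (\<lambda>x::'a::euclidean_space. x \<bullet> x)"
proof -
  have "C_k k (\<lambda>x::'a. \<Sum>b\<in>Basis. (x \<bullet> b) * (x \<bullet> b))"
    by (intro C_k_sum C_k_mult C_k_linear bounded_linear_inner_left)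
  then show ?thesis by (subst euclidean_inner)
qed

section \<open>A smooth cutoff\<close>

text \<open>
  The family is closed under differentiation, which makes smoothness an induction over the
  polynomial \<open>p\<close>.
\<close>

definition flat_exp :: "real poly \<Rightarrow> real \<Rightarrow> real" where
  "flat_exp p x = (if x > 0 then poly p (1 / x) * exp (- (1 / x)) else 0)"

lemma poly_times_exp_tendsto_0: "((\<lambda>t::real. poly p t * exp (- t)) \<longlongrightarrow> 0) at_top"
proof -
  have "((\<lambda>t::real. \<Sum>i\<le>degree p. coeff p i * (t ^ i / exp t)) \<longlongrightarrow> (\<Sum>i\<le>degree p. coeff p i * 0)) at_top"
    by (intro tendsto_sum tendsto_mult_left tendsto_power_div_exp_0)
  then show ?thesis
    by (simp only: poly_altdef sum_distrib_right exp_minus divide_inverse mult.assoc mult_zero_right sum.neutral_const)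
qed

lemma flat_exp_deriv:
  "(flat_exp p has_real_derivative flat_exp ([:0, 0, 1:] * (p - pderiv p)) x) (at x)"
proof (cases x "0::real" rule: linorder_cases)
  case less
  have "((\<lambda>_. 0) has_real_derivative 0) (at x)" by simp
  then have "(flat_exp p has_real_derivative 0) (at x)"
    by (rule DERIV_cong_ev[THEN iffD1, rotated 3])
       (use less in \<open>auto simp: flat_exp_def eventually_nhds intro!: exI[of _ "{..<0}"]\<close>)
  then show ?thesis using less by (simp add: flat_exp_def)
next
  case greater
  have "((\<lambda>x. poly p (1 / x) * exp (- (1 / x))) has_real_derivative
      poly ([:0, 0, 1:] * (p - pderiv p)) (1 / x) * exp (- (1 / x))) (at x)"
  proof -
    have inv: "((\<lambda>x. 1 / x) has_real_derivative - ((1 / x)\<^sup>2)) (at x)"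
      using greater by (auto intro!: derivative_eq_intros simp: field_simps power2_eq_square)
    have alg: "poly (pderiv p) y * - (y\<^sup>2) * E + E * - (- (y\<^sup>2)) * poly p y = poly ([:0, 0, 1:] * (p - pderiv p)) y * E"
      for y E by (simp add: algebra_simps power2_eq_square)
    show ?thesis
      using DERIV_mult[OF DERIV_chain2[OF poly_DERIV[of p] inv] DERIV_chain2[OF DERIV_exp DERIV_minus[OF inv]]]
      unfolding alg .
  qed
  then have "(flat_exp p has_real_derivative poly ([:0, 0, 1:] * (p - pderiv p)) (1 / x) * exp (- (1 / x))) (at x)"
    by (rule DERIV_cong_ev[THEN iffD1, rotated 3])
       (use greater in \<open>auto simp: flat_exp_def eventually_nhds intro!: exI[of _ "{0<..}"]\<close>)
  then show ?thesis using greater by (simp add: flat_exp_def)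
next
  case equal
  have "((\<lambda>y. poly (pCons 0 p) (inverse y) * exp (- inverse y)) \<longlongrightarrow> 0) (at_right (0::real))"
    by (rule filterlim_compose[OF poly_times_exp_tendsto_0 filterlim_inverse_at_top_right])
  then have "((\<lambda>y. flat_exp p y / y) \<longlongrightarrow> 0) (at_right 0)"
    by (rule Lim_transform_eventually)
       (auto simp: flat_exp_def eventually_at_right_field divide_inverse intro!: exI[of _ 1])
  moreover have "((\<lambda>y. flat_exp p y / y) \<longlongrightarrow> 0) (at_left 0)"
    by (rule Lim_transform_eventually[OF tendsto_const])
       (auto simp: flat_exp_def eventually_at_left_field intro!: exI[of _ "-1"])
  ultimately have "((\<lambda>y. flat_exp p y / y) \<longlongrightarrow> 0) (at 0)" by (simp add: filterlim_at_split)
  then show ?thesis using equal by (simp add: has_field_derivative_iff flat_exp_def)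
qed

lemma C_k_flat_exp: "C_k k (flat_exp p)"
proof (induction k arbitrary: p)
  case 0
  show ?case
    by (auto intro!: continuous_at_imp_continuous_on DERIV_isCont[OF flat_exp_deriv])
next
  case (Suc k)
  show ?case
    by (rule C_k_SucI[OF flat_exp_deriv[unfolded has_field_derivative_def]])
       (intro C_k_mult C_k_const Suc)
qed

lemma C_infinity_real_deriv:
  fixes g :: "real \<Rightarrow> real"
  assumes "C_infinity g"
  obtains g' where "C_infinity g'" "\<And>x. (g has_real_derivative g' x) (at x)"
proof
  let ?g' = "\<lambda>x. frechet_derivative g (at x) 1"
  have S: "C_k (Suc k) g" for k using assms by (simp only: C_infinity_def)
  show "C_infinity ?g'" unfolding C_infinity_def by (intro allI C_k_SucD(2)[OF S])
  fix x
  have d: "(g has_derivative frechet_derivative g (at x)) (at x)" by (rule C_k_SucD(1)[OF S[of 0]])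
  have "frechet_derivative g (at x) = (*) (?g' x)"
  proof
    fix w
    show "frechet_derivative g (at x) w = ?g' x * w"
      using linear_cmul[OF has_derivative_linear[OF d], of w 1]
      by (metis mult.commute mult.right_neutral real_scaleR_def)
  qed
  then show "(g has_real_derivative ?g' x) (at x)" using d by (simp add: has_field_derivative_def)
qed

lemma bounded_if_supported_in_unit_interval:
  fixes f :: "real \<Rightarrow> real"
  assumes "continuous_on UNIV f" "\<And>x. x < 0 \<Longrightarrow> f x = 0" "\<And>x. 1 \<le> x \<Longrightarrow> f x = 0"
  shows "\<exists>M\<ge>0. \<forall>x. \<bar>f x\<bar> \<le> M"
proof -
  have "compact (f ` {0..1})"
    by (intro compact_continuous_image continuous_on_subset[OF assms(1)]) auto
  then obtain M where M: "\<And>x. x \<in> {0..1} \<Longrightarrow> \<bar>f x\<bar> \<le> M"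
    by (meson bounded_real compact_imp_bounded image_eqI)
  have *: "\<bar>f x\<bar> \<le> M" for x
  proof (cases "x \<in> {0..1}")
    case False
    then have "f x = 0" using assms(2,3)[of x] by (cases "x < 0") auto
    then show ?thesis using M[of 0] abs_ge_zero[of "f 0"] by (simp del: abs_ge_zero)
  qed (rule M)
  have "0 \<le> M" using *[of 0] abs_ge_zero[of "f 0"] by linarith
  with * show ?thesis by blast
qed

definition smooth_cutoff :: "real \<Rightarrow> (real \<Rightarrow> real) \<Rightarrow> (real \<Rightarrow> real) \<Rightarrow> (real \<Rightarrow> real) \<Rightarrow> bool" where
  "smooth_cutoff M g g1 g2 \<longleftrightarrow> C_infinity g \<and> (\<forall>x. (g has_real_derivative g1 x) (at x)) \<and>
    (\<forall>x. (g1 has_real_derivative g2 x) (at x)) \<and> (\<forall>x\<le>1/4. g x = 1) \<and> (\<forall>x<1/4. g1 x = 0) \<and>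
    (\<forall>x\<ge>1. g x = 0 \<and> g1 x = 0 \<and> g2 x = 0) \<and> 1 \<le> M \<and> (\<forall>x\<ge>0. \<bar>g x\<bar> \<le> M \<and> \<bar>g1 x\<bar> \<le> M \<and> \<bar>g2 x\<bar> \<le> M)"

text \<open>
  Composing \<open>exp (- 1/x)\<close> with a shift of itself produces plateaus on both sides without any division
  by a nonconstant function.
\<close>

lemma smooth_cutoff_exists: "\<exists>M g g1 g2. smooth_cutoff M g g1 g2"
proof -
  let ?e = "flat_exp 1"
  have pos: "0 < ?e x \<longleftrightarrow> 0 < x" for x by (simp add: flat_exp_def)
  have zero: "?e x = 0" if "x \<le> 0" for x using that by (simp add: flat_exp_def)
  have mono: "?e x \<le> ?e y" if "x \<le> y" for x y
    using that by (auto simp: flat_exp_def frac_le)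
  let ?c = "?e (?e (1/4))"
  have c: "0 < ?c" by (simp add: pos)
  \<comment> \<open>the inner value is constant for \<open>x \<le> 1/4\<close> and nonpositive for \<open>x \<ge> 1/2\<close>\<close>
  define g where "g x = ?e (?e (1/4) + (- 1) * ?e (x + (- 1/4))) * (1 / ?c)" for x
  have x4: "C_k k (\<lambda>x::real. x + (- 1/4))" for k
    by (intro C_k_add C_k_const C_k_linear bounded_linear_ident)
  have Cg: "C_infinity g"
    unfolding C_infinity_def g_def
    by (intro allI C_k_mult C_k_const C_k_compose_real[OF C_k_flat_exp] C_k_add C_k_compose_real[OF C_k_flat_exp x4])
  obtain g1 where g1: "C_infinity g1" "\<And>x. (g has_real_derivative g1 x) (at x)" using C_infinity_real_deriv[OF Cg] by blast
  obtain g2 where g2: "C_infinity g2" "\<And>x. (g1 has_real_derivative g2 x) (at x)" using C_infinity_real_deriv[OF g1(1)] by blast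
  have low: "g x = 1" if "x \<le> 1/4" for x using that c by (simp add: g_def zero)
  have high: "g x = 0" if "1/2 \<le> x" for x
  proof -
    have "?e (1/4) \<le> ?e (x - 1/4)" using that by (intro mono) simp
    then show ?thesis by (simp add: g_def zero)
  qed
  have loc: "f' x = 0" if "\<And>x. (f has_real_derivative f' x) (at x)" "open S" "x \<in> S" "\<And>y. y \<in> S \<Longrightarrow> f y = (k::real)" for f f' :: "real \<Rightarrow> real" and x S k
  proof -
    have "(f has_real_derivative 0) (at x)"
      using DERIV_const[of k "at x"]
      by (rule DERIV_cong_ev[THEN iffD1, rotated 3]) (use that in \<open>auto simp: eventually_nhds intro!: exI[of _ S]\<close>)
    then show ?thesis using that(1) DERIV_unique by blast
  qed
  have g1l: "g1 x = 0" if "x < 1/4" for x by (rule loc[of g g1 "{..<1/4}" x 1, OF g1(2)]) (use that low in auto)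
  have g1h: "g1 x = 0" if "1/2 < x" for x by (rule loc[of g g1 "{1/2<..}" x 0, OF g1(2)]) (use that high in auto)
  have g2l: "g2 x = 0" if "x < 1/4" for x by (rule loc[of g1 g2 "{..<1/4}" x 0, OF g2(2)]) (use that g1l in auto)
  have g2h: "g2 x = 0" if "1/2 < x" for x by (rule loc[of g1 g2 "{1/2<..}" x 0, OF g2(2)]) (use that g1h in auto)
  have cont: "continuous_on UNIV f" if "C_infinity f" for f :: "real \<Rightarrow> real"
    using that C_k.simps(1) unfolding C_infinity_def by metis
  obtain M1 where M1: "0 \<le> M1" "\<And>x. \<bar>g1 x\<bar> \<le> M1"
    using bounded_if_supported_in_unit_interval[OF cont[OF g1(1)]] g1l g1h by force
  obtain M2 where M2: "0 \<le> M2" "\<And>x. \<bar>g2 x\<bar> \<le> M2"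
    using bounded_if_supported_in_unit_interval[OF cont[OF g2(1)]] g2l g2h by force
  have g01: "\<bar>g x\<bar> \<le> 1" for x
  proof -
    have n: "0 \<le> ?e y" for y by (simp add: flat_exp_def)
    have "?e (?e (1/4) - ?e (x - 1/4)) \<le> ?c" using n[of "x - 1/4"] by (intro mono) simp
    then show ?thesis using c n by (simp add: g_def abs_mult)
  qed
  show ?thesis
    unfolding smooth_cutoff_def
  proof (rule exI[of _ "1 + M1 + M2"], rule exI[of _ g], rule exI[of _ g1], rule exI[of _ g2], intro conjI allI impI)
    fix x :: real
    show "\<bar>g x\<bar> \<le> 1 + M1 + M2" "\<bar>g1 x\<bar> \<le> 1 + M1 + M2" "\<bar>g2 x\<bar> \<le> 1 + M1 + M2"
      using g01[of x] M1(1) M1(2)[of x] M2(1) M2(2)[of x] by linarith+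
  next
    fix x :: real assume "1 \<le> x"
    then show "g x = 0" "g1 x = 0" "g2 x = 0" using high[of x] g1h[of x] g2h[of x] by simp_all
  qed (use Cg g1(2) g2(2) low g1l M1(1) M2(1) in \<open>simp_all\<close>)
qed

section \<open>Quadratic potentials with bumps\<close>

text \<open>
  The function \<open>f\<close> is linear with gradient \<open>l\<close> near the origin and vanishes outside the ball of radius
  \<open>w\<close>. Its first and second derivatives are \<open>b\<close> and \<open>b'\<close>; the size of the second derivative is of
  order \<open>|l| / w\<close>.
\<close>

definition linear_bump :: "real \<Rightarrow> real \<Rightarrow> 'a::euclidean_space \<Rightarrow> ('a \<Rightarrow> real) \<Rightarrow> ('a \<Rightarrow> 'a) \<Rightarrow> ('a \<Rightarrow> 'a \<Rightarrow> 'a) \<Rightarrow> bool" where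
  "linear_bump M w l f b b' \<longleftrightarrow> (\<forall>k. C_k k f) \<and>
    (\<forall>y. (f has_derivative (\<lambda>v. v \<bullet> b y)) (at y)) \<and> (\<forall>y. (b has_derivative b' y) (at y)) \<and>
    (\<forall>y. norm (b y) \<le> M * norm l) \<and> (\<forall>y v. \<bar>v \<bullet> b' y v\<bar> \<le> M * norm l / w * (norm v)\<^sup>2) \<and>
    (\<forall>y. w \<le> norm y \<longrightarrow> b y = 0 \<and> (\<forall>v. b' y v = 0)) \<and> (\<forall>y. norm y \<le> w / 3 \<longrightarrow> b y = l)"

lemma linear_bump_exists: "\<exists>M\<ge>1. \<forall>w>0. \<forall>l::'a::euclidean_space. \<exists>f b b'. linear_bump M w l f b b'"
proof -
  obtain g g1 g2 M where "smooth_cutoff M g g1 g2"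
    using smooth_cutoff_exists by (elim exE) (rule that)
  then have Cg: "C_infinity g" and g: "\<And>x. (g has_real_derivative g1 x) (at x)" "\<And>x. (g1 has_real_derivative g2 x) (at x)"
    and low: "\<And>x. x \<le> 1/4 \<Longrightarrow> g x = 1" "\<And>x. x < 1/4 \<Longrightarrow> g1 x = 0"
    and high: "\<And>x. 1 \<le> x \<Longrightarrow> g x = 0" "\<And>x. 1 \<le> x \<Longrightarrow> g1 x = 0" "\<And>x. 1 \<le> x \<Longrightarrow> g2 x = 0"
    and M: "1 \<le> M" "\<And>x. 0 \<le> x \<Longrightarrow> \<bar>g x\<bar> \<le> M" "\<And>x. 0 \<le> x \<Longrightarrow> \<bar>g1 x\<bar> \<le> M" "\<And>x. 0 \<le> x \<Longrightarrow> \<bar>g2 x\<bar> \<le> M"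
    unfolding smooth_cutoff_def by blast+
  show ?thesis
  proof (intro exI[of _ "10 * M"] conjI allI impI)
    show "1 \<le> 10 * M" using M by simp
    fix w :: real and l :: 'a assume w: "0 < w"
    define s where "s y = (y \<bullet> y) * (1 / w\<^sup>2)" for y :: 'a
    define f where "f y = (y \<bullet> l) * g (s y)" for y
    define p where "p y = (y \<bullet> l) * (2 / w\<^sup>2) * g1 (s y)" for y
    define b where "b y = g (s y) *\<^sub>R l + p y *\<^sub>R y" for y
    define p' where "p' y v = (v \<bullet> l) * (2 / w\<^sup>2) * g1 (s y) + (y \<bullet> l) * (2 / w\<^sup>2) * (g2 (s y) * (2 * (y \<bullet> v) * (1 / w\<^sup>2)))" for y v
    define b' where "b' y v = (g1 (s y) * (2 * (y \<bullet> v) * (1 / w\<^sup>2))) *\<^sub>R l + (p' y v *\<^sub>R y + p y *\<^sub>R v)" for y v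
    have s0: "0 \<le> s y" for y by (simp add: s_def)
    have s1: "1 \<le> s y \<longleftrightarrow> w \<le> norm y" for y
    proof -
      have "1 \<le> s y \<longleftrightarrow> w\<^sup>2 \<le> (norm y)\<^sup>2" using w by (simp add: s_def power2_norm_eq_inner field_simps)
      also have "\<dots> \<longleftrightarrow> w \<le> norm y" using w by (metis abs_le_square_iff abs_norm_cancel abs_of_pos)
      finally show ?thesis .
    qed
    have ds: "(s has_derivative (\<lambda>v. 2 * (y \<bullet> v) * (1 / w\<^sup>2))) (at y)" for y
      unfolding s_def by (rule derivative_eq_intros refl)+ (simp add: inner_commute fun_eq_iff)
    have dg: "((\<lambda>y. g (s y)) has_derivative (\<lambda>v. g1 (s y) * (2 * (y \<bullet> v) * (1 / w\<^sup>2)))) (at y)" for y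
      by (rule has_derivative_compose[OF ds has_field_derivative_imp_has_derivative[OF g(1)]])
    have dg1: "((\<lambda>y. g1 (s y)) has_derivative (\<lambda>v. g2 (s y) * (2 * (y \<bullet> v) * (1 / w\<^sup>2)))) (at y)" for y
      by (rule has_derivative_compose[OF ds has_field_derivative_imp_has_derivative[OF g(2)]])
    have dl: "((\<lambda>y. y \<bullet> l) has_derivative (\<lambda>v. v \<bullet> l)) (at y)" for y
      by (rule bounded_linear_imp_has_derivative[OF bounded_linear_inner_left])
    have dl2: "((\<lambda>y. y \<bullet> l * (2 / w\<^sup>2)) has_derivative (\<lambda>v. v \<bullet> l * (2 / w\<^sup>2))) (at y)" for y
      by (rule has_derivative_mult_left[OF dl])
    have dp: "(p has_derivative p' y) (at y)" for y
      unfolding p_def p'_def using has_derivative_mult[OF dl2 dg1, of y] by (simp add: add.commute)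
    show "\<exists>f b b'. linear_bump (10 * M) w l f b b'"
      unfolding linear_bump_def
    proof (rule exI[of _ f], rule exI[of _ b], rule exI[of _ b'], intro conjI allI impI)
      have Cs: "C_k k s" for k
        unfolding s_def by (intro C_k_mult C_k_inner_self C_k_const)
      have Cg': "C_k k g" for k using Cg by (simp add: C_infinity_def)
      show "C_k k f" for k
        unfolding f_def by (intro C_k_mult C_k_linear bounded_linear_inner_left C_k_compose_real[OF Cg' Cs])
      show "(f has_derivative (\<lambda>v. v \<bullet> b y)) (at y)" for y
      proof -
        have "(f has_derivative (\<lambda>v. (y \<bullet> l) * (g1 (s y) * (2 * (y \<bullet> v) * (1 / w\<^sup>2))) + (v \<bullet> l) * g (s y))) (at y)"
          unfolding f_def by (rule has_derivative_mult[OF dl dg])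
        also have "(\<lambda>v. (y \<bullet> l) * (g1 (s y) * (2 * (y \<bullet> v) * (1 / w\<^sup>2))) + (v \<bullet> l) * g (s y)) = (\<lambda>v. v \<bullet> b y)"
          by (auto simp: b_def p_def inner_add_right inner_commute mult_ac)
        finally show ?thesis .
      qed
      show "(b has_derivative b' y) (at y)" for y
      proof -
        have "((\<lambda>y. g (s y) *\<^sub>R l) has_derivative (\<lambda>v. (g1 (s y) * (2 * (y \<bullet> v) * (1 / w\<^sup>2))) *\<^sub>R l)) (at y)"
          by (rule has_derivative_scaleR_left[OF dg])
        moreover have "((\<lambda>y. p y *\<^sub>R y) has_derivative (\<lambda>v. p y *\<^sub>R v + p' y v *\<^sub>R y)) (at y)"
          by (rule has_derivative_scaleR[OF dp has_derivative_ident])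
        ultimately show ?thesis
          unfolding b_def b'_def by (auto intro: has_derivative_add simp: add.commute[of "p y *\<^sub>R _"])
      qed
      have zero: "b y = 0" "b' y v = 0" if "w \<le> norm y" for y v
        using that high[of "s y"] s1[of y] by (simp_all add: b_def b'_def p_def p'_def)
      show "b y = 0" "b' y v = 0" if "w \<le> norm y" for y v by (rule zero[OF that])+
      show "b y = l" if "norm y \<le> w / 3" for y
      proof -
        have "s y = (norm y / w)\<^sup>2" by (simp add: s_def power2_norm_eq_inner power_divide)
        also have "\<dots> \<le> (1 / 3)\<^sup>2" using that w by (intro power_mono) (auto simp: field_simps)
        also have "\<dots> < 1 / 4" by (simp add: power2_eq_square)
        finally show ?thesis using low[of "s y"] by (simp add: b_def p_def)
      qed
      have yl: "\<bar>y \<bullet> l\<bar> \<le> w * norm l" if "norm y < w" for y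
        using Cauchy_Schwarz_ineq2[of y l] mult_right_mono[OF less_imp_le[OF that] norm_ge_zero[of l]] by linarith
      have pb: "\<bar>p y\<bar> \<le> 2 * M * norm l / w" if "norm y < w" for y
      proof -
        have "\<bar>p y\<bar> = \<bar>y \<bullet> l\<bar> * (2 / w\<^sup>2) * \<bar>g1 (s y)\<bar>" by (simp add: p_def abs_mult)
        also have "\<dots> \<le> (w * norm l) * (2 / w\<^sup>2) * M"
          using yl[OF that] M(3)[OF s0[of y]] w by (intro mult_mono mult_right_mono) auto
        also have "\<dots> = 2 * M * norm l / w" using w by (simp add: power2_eq_square)
        finally show ?thesis .
      qed
      show "norm (b y) \<le> 10 * M * norm l" for y
      proof (cases "norm y < w")
        case True
        have "norm (b y) \<le> \<bar>g (s y)\<bar> * norm l + \<bar>p y\<bar> * norm y"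
          unfolding b_def by (rule order_trans[OF norm_triangle_ineq]) simp
        also have "\<dots> \<le> M * norm l + (2 * M * norm l / w) * w"
          using True pb[OF True] M(2)[OF s0[of y]] by (intro add_mono mult_mono) auto
        also have "\<dots> \<le> 10 * (M * norm l)" using w M(1) by simp
        finally show ?thesis by simp
      qed (use zero M(1) in simp)
      show "\<bar>v \<bullet> b' y v\<bar> \<le> 10 * M * norm l / w * (norm v)\<^sup>2" for y v
      proof (cases "norm y < w")
        case True
        let ?D = "M * norm l / w * (norm v)\<^sup>2"
        have vl: "\<bar>v \<bullet> l\<bar> \<le> norm v * norm l" "\<bar>l \<bullet> v\<bar> \<le> norm v * norm l"
          using Cauchy_Schwarz_ineq2[of v l] by (simp_all add: inner_commute)
        have yv: "\<bar>y \<bullet> v\<bar> \<le> w * norm v"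
          using Cauchy_Schwarz_ineq2[of y v] mult_right_mono[OF less_imp_le[OF True] norm_ge_zero[of v]] by linarith
        have g1b: "\<bar>g1 (s y)\<bar> \<le> M" and g2b: "\<bar>g2 (s y)\<bar> \<le> M" using M(3,4)[OF s0[of y]] by auto
        have t: "\<bar>g1 (s y) * (2 * (y \<bullet> v) * (1 / w\<^sup>2))\<bar> \<le> M * (2 * (w * norm v) * (1 / w\<^sup>2))"
          unfolding abs_mult using yv g1b M(1) by (intro mult_mono) auto
        have "\<bar>(g1 (s y) * (2 * (y \<bullet> v) * (1 / w\<^sup>2))) * (v \<bullet> l)\<bar> \<le> M * (2 * (w * norm v) * (1 / w\<^sup>2)) * (norm v * norm l)"
          unfolding abs_mult[of _ "v \<bullet> l"] using t vl w M(1) by (intro mult_mono) auto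
        also have "\<dots> = 2 * ?D" using w by (simp add: power2_eq_square)
        finally have a1: "\<bar>(g1 (s y) * (2 * (y \<bullet> v) * (1 / w\<^sup>2))) * (v \<bullet> l)\<bar> \<le> 2 * ?D" .
        have p1: "\<bar>(v \<bullet> l) * (2 / w\<^sup>2) * g1 (s y)\<bar> \<le> (norm v * norm l) * (2 / w\<^sup>2) * M"
          unfolding abs_mult using vl g1b w by (intro mult_mono) auto
        have p2: "\<bar>(y \<bullet> l) * (2 / w\<^sup>2) * (g2 (s y) * (2 * (y \<bullet> v) * (1 / w\<^sup>2)))\<bar>
            \<le> (w * norm l) * (2 / w\<^sup>2) * (M * (2 * (w * norm v) * (1 / w\<^sup>2)))"
          unfolding abs_mult using yl[OF True] g2b yv w M(1) by (intro mult_mono) auto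
        have "\<bar>p' y v\<bar> \<le> (norm v * norm l) * (2 / w\<^sup>2) * M + (w * norm l) * (2 / w\<^sup>2) * (M * (2 * (w * norm v) * (1 / w\<^sup>2)))"
          unfolding p'_def using p1 p2 by linarith
        also have "\<dots> = 6 * (M * norm l * norm v / w\<^sup>2)" using w by (simp add: power2_eq_square)
        finally have "\<bar>p' y v * (y \<bullet> v)\<bar> \<le> 6 * (M * norm l * norm v / w\<^sup>2) * (w * norm v)"
          unfolding abs_mult using yv M(1) by (intro mult_mono) auto
        also have "\<dots> = 6 * ?D" using w by (simp add: power2_eq_square)
        finally have a2: "\<bar>p' y v * (y \<bullet> v)\<bar> \<le> 6 * ?D" .
        have "\<bar>p y * (v \<bullet> v)\<bar> \<le> (2 * M * norm l / w) * (norm v)\<^sup>2"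
          using mult_right_mono[OF pb[OF True] inner_ge_zero[of v]]
          unfolding abs_mult power2_norm_eq_inner abs_of_nonneg[OF inner_ge_zero[of v]] .
        then have a3: "\<bar>p y * (v \<bullet> v)\<bar> \<le> 2 * ?D" by simp
        have "v \<bullet> b' y v = (g1 (s y) * (2 * (y \<bullet> v) * (1 / w\<^sup>2))) * (v \<bullet> l) + (p' y v * (y \<bullet> v) + p y * (v \<bullet> v))"
          unfolding b'_def inner_add_right inner_scaleR_right by (simp only: inner_commute[of v y])
        moreover have "\<bar>a + (b + c)\<bar> \<le> 10 * D" if "\<bar>a\<bar> \<le> 2 * D" "\<bar>b\<bar> \<le> 6 * D" "\<bar>c\<bar> \<le> 2 * D" for a b c D :: real
          using that by linarith
        ultimately have "\<bar>v \<bullet> b' y v\<bar> \<le> 10 * ?D" using a1 a2 a3 by metis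
        then show ?thesis by simp
      qed (use zero M(1) w in simp)
    qed
  qed
qed

lemma sum_at_most_one_nonzero:
  fixes f :: "'i \<Rightarrow> 'a::comm_monoid_add"
  assumes "finite I" "\<And>i. i \<in> I \<Longrightarrow> i \<noteq> j \<Longrightarrow> f i = 0"
  shows "(\<Sum>i\<in>I. f i) = (if j \<in> I then f j else 0)"
proof (cases "j \<in> I")
  case True
  then show ?thesis using assms by (simp add: sum.remove[of I j] sum.neutral)
next
  case False
  then show ?thesis using assms by (auto intro!: sum.neutral)
qed

lemma gradient_eqI:
  assumes "\<And>x. (f has_derivative (\<lambda>v. v \<bullet> G x)) (at x)"
  shows "gradient f = G"
proof
  fix x
  have d: "(f has_derivative (\<lambda>v. v \<bullet> G x)) (at x)" by (rule assms)
  show "gradient f x = G x"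
    unfolding gradient_def gderiv_def
  proof (rule the_equality, rule d)
    fix g assume "(f has_derivative (\<lambda>v. v \<bullet> g)) (at x)"
    then have "(\<lambda>v. v \<bullet> g) = (\<lambda>v. v \<bullet> G x)" using d has_derivative_unique by blast
    then show "g = G x" by (metis inner_commute vector_eq_rdot)
  qed
qed

text \<open>
  Bumps with disjoint supports perturb the gradient of a quadratic by prescribed constants \<open>l i\<close> near
  prescribed points \<open>a i\<close>. As at most one bump is active at any point, the Hessian changes by
  \<open>M m / w\<close> at most, however many bumps there are.
\<close>

lemma bumpy_quadratic_potential_exists:
  "\<exists>M\<ge>1. \<forall>\<kappa> L w m (I::'i set) a l. finite I \<longrightarrow> 0 < w \<longrightarrow> 0 \<le> m \<longrightarrow> (\<forall>i\<in>I. norm (l i :: 'a::euclidean_space) \<le> m) \<longrightarrow>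
    (\<forall>i\<in>I. \<forall>j\<in>I. i \<noteq> j \<longrightarrow> 2 * w \<le> norm (a i - a j)) \<longrightarrow> 1 + M * m / w \<le> L \<longrightarrow> L + M * m / w \<le> \<kappa> \<longrightarrow>
    (\<exists>U\<in>potentials \<kappa>. \<exists>B. perturbed_quadratic L (M * m) U B \<and> (\<forall>i\<in>I. \<forall>x. norm (x - a i) \<le> w / 3 \<longrightarrow> B x = l i))"
proof -
  obtain M where M: "1 \<le> M" and bump: "\<And>w l. 0 < w \<Longrightarrow> \<exists>f b b'. linear_bump M w (l::'a) f b b'"
    using linear_bump_exists[where 'a='a] by auto
  show ?thesis
  proof (rule exI[of _ M], intro conjI allI impI)
    show "1 \<le> M" by fact
    fix \<kappa> L w m :: real and I :: "'i set" and a l :: "'i \<Rightarrow> 'a"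
    assume I: "finite I" and w: "0 < w" and m: "0 \<le> m" and lm: "\<forall>i\<in>I. norm (l i) \<le> m"
      and sep: "\<forall>i\<in>I. \<forall>j\<in>I. i \<noteq> j \<longrightarrow> 2 * w \<le> norm (a i - a j)"
      and L1: "1 + M * m / w \<le> L" and L2: "L + M * m / w \<le> \<kappa>"
    have "\<forall>i. \<exists>f b b'. linear_bump M w (l i) f b b'"
      using bump[OF w] by blast
    then obtain f b b' where fb: "\<forall>i. linear_bump M w (l i) (f i) (b i) (b' i)"
      unfolding choice_iff by blast
    have Cf: "C_k k (f i)" and df: "(f i has_derivative (\<lambda>v. v \<bullet> b i y)) (at y)"
      and db: "(b i has_derivative b' i y) (at y)" and bn: "norm (b i y) \<le> M * norm (l i)"
      and b'n: "\<bar>v \<bullet> b' i y v\<bar> \<le> M * norm (l i) / w * (norm v)\<^sup>2"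
      and bz: "w \<le> norm y \<Longrightarrow> b i y = 0" "w \<le> norm y \<Longrightarrow> b' i y v = 0"
      and bl: "norm y \<le> w / 3 \<Longrightarrow> b i y = l i" for i k y v
      using fb unfolding linear_bump_def by blast+
    define U where "U x = L / 2 * (x \<bullet> x) + (\<Sum>i\<in>I. f i (x - a i))" for x
    define B where "B x = (\<Sum>i\<in>I. b i (x - a i))" for x
    define B' where "B' x v = (\<Sum>i\<in>I. b' i (x - a i) v)" for x v
    have shift: "((\<lambda>x. F (x - a i)) has_derivative F') (at x)" if "(F has_derivative F') (at (x - a i))"
      for F :: "'a \<Rightarrow> 'b::real_normed_vector" and F' i x
      using has_derivative_compose[OF has_derivative_diff[OF has_derivative_ident has_derivative_const[of "a i"]] that] by simp
    have dU: "(U has_derivative (\<lambda>v. v \<bullet> (L *\<^sub>R x + B x))) (at x)" for x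
    proof -
      have q: "((\<lambda>x. L / 2 * (x \<bullet> x)) has_derivative (\<lambda>v. L / 2 * (x \<bullet> v + v \<bullet> x))) (at x)"
        by (intro has_derivative_mult_right has_derivative_inner has_derivative_ident)
      have "((\<lambda>x. \<Sum>i\<in>I. f i (x - a i)) has_derivative (\<lambda>v. \<Sum>i\<in>I. v \<bullet> b i (x - a i))) (at x)"
        by (intro has_derivative_sum shift df)
      from has_derivative_add[OF q this]
      have "(U has_derivative (\<lambda>v. L / 2 * (x \<bullet> v + v \<bullet> x) + (\<Sum>i\<in>I. v \<bullet> b i (x - a i)))) (at x)"
        unfolding U_def .
      also have "(\<lambda>v. L / 2 * (x \<bullet> v + v \<bullet> x) + (\<Sum>i\<in>I. v \<bullet> b i (x - a i))) = (\<lambda>v. v \<bullet> (L *\<^sub>R x + B x))"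
        by (auto simp: B_def inner_add_right inner_sum_right inner_commute)
      finally show ?thesis .
    qed
    have gU: "gradient U = (\<lambda>x. L *\<^sub>R x + B x)" by (rule gradient_eqI[OF dU])
    have dB: "(B has_derivative B' x) (at x)" for x
      unfolding B_def B'_def by (intro has_derivative_sum shift db)
    have hU: "hessian U x = (\<lambda>v. L *\<^sub>R v + B' x v)" for x
    proof -
      have "((\<lambda>x. L *\<^sub>R x + B x) has_derivative (\<lambda>v. L *\<^sub>R v + B' x v)) (at x)"
        by (intro has_derivative_add has_derivative_scaleR_right has_derivative_ident dB)
      then show ?thesis unfolding hessian_def gU by (rule frechet_derivative_at[symmetric])
    qed
    have only: "\<exists>j. \<forall>i\<in>I. i \<noteq> j \<longrightarrow> w \<le> norm (x - a i)" for x
    proof (cases "\<exists>j\<in>I. norm (x - a j) < w")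
      case True
      then obtain j where j: "j \<in> I" "norm (x - a j) < w" by blast
      have "w \<le> norm (x - a i)" if "i \<in> I" "i \<noteq> j" for i
      proof -
        have "2 * w \<le> norm ((x - a j) - (x - a i))" using sep that j by simp
        also have "\<dots> \<le> norm (x - a j) + norm (x - a i)" by (rule norm_triangle_ineq4)
        finally show ?thesis using j by simp
      qed
      then show ?thesis by blast
    qed (auto simp: not_less)
    have CU: "C_infinity U"
    proof -
      have "C_k k (\<lambda>x. f i (x - a i))" for k i
      proof -
        have "C_k k F \<Longrightarrow> C_k k (\<lambda>x. F (x - a i))" for F :: "'a \<Rightarrow> real"
        proof (induction k arbitrary: F)
          case 0
          then show ?case by (auto intro!: continuous_intros elim: continuous_on_compose2)
        next
          case (Suc k)
          show ?case
            by (rule C_k_SucI[OF shift[OF C_k_SucD(1)[OF Suc.prems]] Suc.IH[OF C_k_SucD(2)[OF Suc.prems]]])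
        qed
        then show ?thesis using Cf by blast
      qed
      then show ?thesis
        unfolding C_infinity_def U_def by (intro allI C_k_add C_k_mult C_k_const C_k_inner_self C_k_sum)
    qed
    have Bn: "norm (B x) \<le> M * m" for x
    proof -
      obtain j where "\<forall>i\<in>I. i \<noteq> j \<longrightarrow> w \<le> norm (x - a i)" using only by blast
      then have "B x = (if j \<in> I then b j (x - a j) else 0)"
        unfolding B_def using bz by (intro sum_at_most_one_nonzero[OF I]) auto
      moreover have "norm (b j (x - a j)) \<le> M * m" if "j \<in> I"
        using order_trans[OF bn[of j "x - a j"] mult_left_mono[of "norm (l j)" m M]] lm that M by simp
      ultimately show ?thesis using M m by simp
    qed
    have B'n: "\<bar>v \<bullet> B' x v\<bar> \<le> M * m / w * (norm v)\<^sup>2" for x v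
    proof -
      obtain j where "\<forall>i\<in>I. i \<noteq> j \<longrightarrow> w \<le> norm (x - a i)" using only by blast
      then have "B' x v = (if j \<in> I then b' j (x - a j) v else 0)"
        unfolding B'_def using bz by (intro sum_at_most_one_nonzero[OF I]) auto
      moreover have "\<bar>v \<bullet> b' j (x - a j) v\<bar> \<le> M * m / w * (norm v)\<^sup>2" if "j \<in> I"
      proof (rule order_trans[OF b'n])
        show "M * norm (l j) / w * (norm v)\<^sup>2 \<le> M * m / w * (norm v)\<^sup>2"
          using lm that M w by (intro mult_right_mono divide_right_mono mult_left_mono) auto
      qed
      ultimately show ?thesis using M m w by simp
    qed
    have "U \<in> potentials \<kappa>"
    proof -
      have "v \<bullet> v \<le> v \<bullet> (L *\<^sub>R v + B' x v) \<and> v \<bullet> (L *\<^sub>R v + B' x v) \<le> v \<bullet> (\<kappa> *\<^sub>R v)" for x v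
      proof -
        have "1 * (v \<bullet> v) \<le> (L - M * m / w) * (v \<bullet> v)" using L1 by (intro mult_right_mono) auto
        moreover have "(L + M * m / w) * (v \<bullet> v) \<le> \<kappa> * (v \<bullet> v)" using L2 by (intro mult_right_mono) auto
        moreover have "\<bar>v \<bullet> B' x v\<bar> \<le> M * m / w * (v \<bullet> v)" using B'n[of v x] by (simp add: power2_norm_eq_inner)
        ultimately show ?thesis
          unfolding inner_add_right inner_scaleR_right left_diff_distrib distrib_right abs_le_iff by linarith
      qed
      then show ?thesis using CU by (simp add: potentials_def loewner_le_def hU)
    qed
    moreover have "\<forall>x. gradient U x = L *\<^sub>R x + B x" by (simp add: gU)
    moreover have "continuous_on UNIV B"
      by (intro continuous_at_imp_continuous_on ballI has_derivative_continuous[OF dB])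
    moreover have "\<forall>x. (\<Sum>i\<in>I. norm (a i)) + w \<le> norm x \<longrightarrow> B x = 0"
    proof (intro allI impI)
      fix x :: 'a assume x: "(\<Sum>i\<in>I. norm (a i)) + w \<le> norm x"
      show "B x = 0" unfolding B_def
      proof (rule sum.neutral, intro ballI bz(1))
        fix i assume i: "i \<in> I"
        have "norm (a i) \<le> (\<Sum>i\<in>I. norm (a i))" using I i by (intro member_le_sum) auto
        then show "w \<le> norm (x - a i)" using x norm_triangle_ineq2[of x "a i"] by linarith
      qed
    qed
    moreover have "B x = l i" if i: "i \<in> I" and x: "norm (x - a i) \<le> w / 3" for i x
    proof -
      have "w \<le> norm (x - a k)" if "k \<in> I" "k \<noteq> i" for k
      proof -
        have "2 * w \<le> norm ((x - a i) - (x - a k))" using sep that i by simp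
        also have "\<dots> \<le> norm (x - a i) + norm (x - a k)" by (rule norm_triangle_ineq4)
        finally show ?thesis using x w by simp
      qed
      then have "B x = b i (x - a i)"
        unfolding B_def using bz i by (subst sum_at_most_one_nonzero[OF I, of i]) auto
      then show ?thesis using bl[OF x] by simp
    qed
    ultimately show "\<exists>U\<in>potentials \<kappa>. \<exists>B. perturbed_quadratic L (M * m) U B \<and> (\<forall>i\<in>I. \<forall>x. norm (x - a i) \<le> w / 3 \<longrightarrow> B x = l i)"
      using Bn unfolding perturbed_quadratic_def by blast
  qed
qed

section \<open>The plane\<close>

definition plane :: "complex \<Rightarrow> real ^ 2" where
  "plane z = (\<chi> i. if i = 1 then Re z else Im z)"

lemma plane_add: "plane (z + w) = plane z + plane w"
  and plane_diff: "plane (z - w) = plane z - plane w"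
  and plane_scale: "plane (of_real a * z) = a *\<^sub>R plane z"
  and plane_minus: "plane (- z) = - plane z"
  by (simp_all add: plane_def vec_eq_iff)

lemma norm_plane: "norm (plane z) = cmod z"
  by (simp add: norm_vec_def L2_set_def sum_2 plane_def cmod_def)

section \<open>Small steps: an isotropic quadratic potential\<close>

text \<open>
  The characteristic polynomial \<open>r\<^sup>2 - (1 + \<beta> - \<alpha>) r + \<beta>\<close> belongs to the potential \<open>|x|\<^sup>2 / 2\<close>. If the
  friction \<open>1 - \<beta>\<close> is of order \<open>1 / \<kappa>\<close>, the product \<open>\<beta>\<close> of the roots is already close to \<open>1\<close>.
  Otherwise the iteration is overdamped, and there is a real root within \<open>2 \<alpha> / (1 - \<beta>) \<le> 2 C / \<kappa>\<close>
  of \<open>1\<close>.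
\<close>

lemma slow_root_exists:
  fixes \<beta> \<alpha> \<kappa> C :: real
  assumes \<beta>: "0 < \<beta>" "\<beta> < 1" and \<alpha>: "0 < \<alpha>" and C: "1 \<le> C" "16 * C \<le> \<kappa>" and slow: "\<alpha> * \<kappa> \<le> C * (1 - \<beta>)"
  shows "\<exists>r::complex. r\<^sup>2 = of_real (1 + \<beta> - \<alpha>) * r - of_real \<beta> \<and> 1 - 8 * C / \<kappa> \<le> cmod r"
proof -
  define T where "T = 1 + \<beta> - \<alpha>"
  define \<epsilon> where "\<epsilon> = 1 - \<beta>"
  have \<kappa>: "0 < \<kappa>" using C by linarith
  have \<epsilon>: "0 < \<epsilon>" "\<epsilon> < 1" using \<beta> by (auto simp: \<epsilon>_def)
  show ?thesis
  proof (cases "\<epsilon> \<le> 8 * C / \<kappa>")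
    case True
    define r1 where "r1 = (of_real T + csqrt (of_real (T\<^sup>2 - 4 * \<beta>))) / 2"
    define r2 where "r2 = (of_real T - csqrt (of_real (T\<^sup>2 - 4 * \<beta>))) / 2"
    define d where "d = csqrt (of_real (T\<^sup>2 - 4 * \<beta>))"
    have "d\<^sup>2 = of_real T ^ 2 - 4 * of_real \<beta>" by (simp add: d_def)
    then have d: "d * d = of_real T * of_real T - 4 * of_real \<beta>" by (simp add: power2_eq_square)
    have r1: "r1\<^sup>2 = of_real T * r1 - of_real \<beta>" and r2: "r2\<^sup>2 = of_real T * r2 - of_real \<beta>"
      and r12: "r1 * r2 = of_real \<beta>"
    proof -
      have e: "r1\<^sup>2 = (of_real T * of_real T + 2 * of_real T * d + d * d) / 4"
        "r2\<^sup>2 = (of_real T * of_real T - 2 * of_real T * d + d * d) / 4"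
        "r1 * r2 = (of_real T * of_real T - d * d) / 4"
        unfolding r1_def r2_def d_def[symmetric] by (simp_all add: field_simps power2_eq_square)
      have rd: "r1 = (of_real T + d) / 2" "r2 = (of_real T - d) / 2" by (simp_all only: r1_def r2_def d_def)
      show "r1\<^sup>2 = of_real T * r1 - of_real \<beta>" unfolding e d by (simp add: rd field_simps)
      show "r2\<^sup>2 = of_real T * r2 - of_real \<beta>" unfolding e d by (simp add: rd field_simps)
      show "r1 * r2 = of_real \<beta>" unfolding e d by simp
    qed
    have "cmod r1 * cmod r2 = \<beta>" using r12 \<beta> by (metis abs_of_pos norm_mult norm_of_real)
    \<comment> \<open>the product of the two moduli is \<open>\<beta>\<close>, so one of them is at least \<open>\<beta>\<close>\<close>
    then have "\<beta> \<le> cmod r1 \<or> \<beta> \<le> cmod r2"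
    proof (rule_tac ccontr)
      assume p: "cmod r1 * cmod r2 = \<beta>" and "\<not> (\<beta> \<le> cmod r1 \<or> \<beta> \<le> cmod r2)"
      then have "cmod r1 < \<beta>" "cmod r2 < 1" using \<beta> by auto
      then have "cmod r1 * cmod r2 \<le> cmod r1 * 1" by (intro mult_left_mono) auto
      then show False using p \<open>cmod r1 < \<beta>\<close> by simp
    qed
    moreover have "1 - 8 * C / \<kappa> \<le> \<beta>" using True by (simp add: \<epsilon>_def)
    ultimately show ?thesis using r1 r2 by (auto simp: T_def intro: order_trans)
  next
    case False
    define t where "t = 2 * \<alpha> / \<epsilon>"
    have t0: "0 < t" using \<alpha> \<epsilon> by (simp add: t_def)
    have a: "\<alpha> / \<epsilon> \<le> C / \<kappa>" using slow \<kappa> \<epsilon> by (simp add: \<epsilon>_def[symmetric] field_simps)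
    have tC: "t \<le> 2 * C / \<kappa>" using a by (simp add: t_def)
    have "8 * C / \<kappa> < \<epsilon>" using False by simp
    have "4 * \<alpha> / \<epsilon>\<^sup>2 \<le> 1"
    proof -
      have "0 \<le> C / \<kappa>" using C \<kappa> by simp
      then have "4 * (\<alpha> / \<epsilon>) \<le> \<epsilon>" using a \<open>8 * C / \<kappa> < \<epsilon>\<close> by linarith
      then have "4 * (\<alpha> / \<epsilon>) / \<epsilon> \<le> 1" using \<epsilon> by (simp add: divide_le_eq)
      then show ?thesis by (simp add: power2_eq_square)
    qed
    define p where "p x = x\<^sup>2 - T * x + \<beta>" for x
    have "p (1 - t) = t\<^sup>2 - (\<epsilon> + \<alpha>) * t + \<alpha>"
      by (simp add: p_def T_def \<epsilon>_def power2_eq_square algebra_simps)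
    also have "\<dots> = \<alpha> * (4 * \<alpha> / \<epsilon>\<^sup>2 - 1 - t)"
      using \<epsilon> by (simp add: t_def power2_eq_square field_simps)
    also have "\<dots> \<le> 0" using \<open>4 * \<alpha> / \<epsilon>\<^sup>2 \<le> 1\<close> t0 \<alpha> by (intro mult_nonneg_nonpos) auto
    finally have p0: "p (1 - t) \<le> 0" .
    have p1: "0 \<le> p 1" using \<alpha> by (simp add: p_def T_def)
    have "\<exists>x\<ge>1 - t. x \<le> 1 \<and> p x = 0"
      using t0 by (intro IVT'[where f=p, OF p0 p1]) (auto simp: p_def intro!: continuous_intros)
    then obtain x where x: "1 - t \<le> x" "p x = 0" by blast
    have "(of_real x :: complex)\<^sup>2 = of_real T * of_real x - of_real \<beta>"
      using x(2) unfolding p_def by (metis (no_types, opaque_lifting) add_diff_cancel_left' diff_add_cancel diff_eq_eq of_real_diff of_real_mult of_real_power minus_diff_eq diff_0 uminus_add_conv_diff)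
    moreover have "1 - 8 * C / \<kappa> \<le> cmod (of_real x)"
    proof -
      have "2 * C / \<kappa> \<le> 8 * C / \<kappa>" using C \<kappa> by (intro divide_right_mono) auto
      then show ?thesis using x(1) tC abs_ge_self[of x] by (simp add: norm_of_real)
    qed
    ultimately show ?thesis unfolding T_def by blast
  qed
qed

lemma exp_le_one_minus:
  assumes "0 \<le> (x::real)" "x \<le> 1 / 2"
  shows "exp (- 2 * x) \<le> 1 - x"
proof -
  have "x * x \<le> x * (1 / 2)" using assms by (intro mult_left_mono) auto
  then have "- 2 * x \<le> - x - 2 * x\<^sup>2" by (simp add: power2_eq_square)
  also have "\<dots> \<le> ln (1 - x)" by (rule ln_one_minus_pos_lower_bound[OF assms])
  finally have "exp (- 2 * x) \<le> exp (ln (1 - x))" by simp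
  then show ?thesis using assms by simp
qed

text \<open>
  With complex coordinates in the plane, a root \<open>r\<close> gives the orbits \<open>s r\<^sup>k\<close> and \<open>- s r\<^sup>k\<close> for the
  potential \<open>|x|\<^sup>2 / 2\<close>. For \<open>s\<close> of order \<open>|r|\<^sup>-\<^sup>n\<close>, they are separated at time \<open>n\<close> by more than the
  noise accumulates. Since \<open>|r| \<ge> 1 - 8 C / \<kappa>\<close>, such a far starting point only costs the factor
  \<open>exp (16 C n / \<kappa>)\<close>.
\<close>

lemma slow_mixing_small_step:
  fixes h \<gamma> \<kappa> C :: real
  assumes h: "0 < h" and \<gamma>: "0 < \<gamma>" and C: "1 \<le> C" "16 * C \<le> \<kappa>" and stable: "h\<^sup>2 * \<kappa> < 4"
    and slow: "h\<^sup>2 * (1 + exp (- \<gamma> * h)) / 2 * \<kappa> \<le> C * (1 - exp (- \<gamma> * h))"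
  shows "\<exists>A\<ge>0. \<forall>n\<ge>1. \<exists>U \<in> (potentials \<kappa> :: (real ^ 2 \<Rightarrow> real) set).
    slow_mixing_at h \<gamma> U n (A * real n * exp (16 * C / \<kappa> * real n))"
proof -
  define \<beta> where "\<beta> = exp (- \<gamma> * h)"
  define \<alpha> where "\<alpha> = h\<^sup>2 * (1 + \<beta>) / 2"
  have \<beta>: "0 < \<beta>" "\<beta> < 1" using h \<gamma> by (auto simp: \<beta>_def)
  have \<alpha>: "0 < \<alpha>" using h \<beta> by (simp add: \<alpha>_def add_pos_pos)
  have \<kappa>: "1 \<le> \<kappa>" using C by linarith
  have "h\<^sup>2 * 1 \<le> h\<^sup>2 * \<kappa>" using \<kappa> by (intro mult_left_mono) auto
  then have h4: "h\<^sup>2 * 1 < 4" using stable by simp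
  obtain r :: complex where r: "r\<^sup>2 = of_real (1 + \<beta> - \<alpha>) * r - of_real \<beta>" "1 - 8 * C / \<kappa> \<le> cmod r"
    using slow_root_exists[OF \<beta> \<alpha> C] slow unfolding \<alpha>_def \<beta>_def by blast
  obtain M where M: "0 < M" and crit: "\<forall>(U :: real ^ 2 \<Rightarrow> real) B \<Lambda> o1 o2 n r. perturbed_quadratic 1 \<Lambda> U B \<longrightarrow>
      (\<forall>ob\<in>{o1, o2}. heavy_ball_orbit \<beta> \<alpha> (gradient U) ob \<and> constant_near_orbit r B ob) \<longrightarrow>
      2 * r < norm (o1 (Suc n) - o2 (Suc n)) \<longrightarrow> 0 < r \<longrightarrow> M * real n \<le> r\<^sup>2 \<longrightarrow>
      slow_mixing_at h \<gamma> U n (M * (1 + (norm (o1 0) + norm (o1 1) + norm (o2 0) + norm (o2 1)) + \<Lambda>))"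
    using baoab_slow_mixing_criterion[OF h \<gamma> zero_less_one h4 \<beta>_def \<alpha>_def]
    by (elim exE conjE) (rule that)
  obtain U B where U: "U \<in> (potentials \<kappa> :: (real ^ 2 \<Rightarrow> real) set)" "perturbed_quadratic 1 0 U B"
  proof -
    obtain MB :: real where "\<forall>\<kappa> L w m (I::nat set) a l. finite I \<longrightarrow> 0 < w \<longrightarrow> 0 \<le> m \<longrightarrow> (\<forall>i\<in>I. norm (l i :: real ^ 2) \<le> m) \<longrightarrow>
      (\<forall>i\<in>I. \<forall>j\<in>I. i \<noteq> j \<longrightarrow> 2 * w \<le> norm (a i - a j)) \<longrightarrow> 1 + MB * m / w \<le> L \<longrightarrow> L + MB * m / w \<le> \<kappa> \<longrightarrow>
      (\<exists>U\<in>potentials \<kappa>. \<exists>B. perturbed_quadratic L (MB * m) U B \<and> (\<forall>i\<in>I. \<forall>x. norm (x - a i) \<le> w / 3 \<longrightarrow> B x = l i))"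
      using bumpy_quadratic_potential_exists[where 'a="real ^ 2" and 'i=nat] by (elim exE conjE) (rule that)
    from this[rule_format, of "{}" 1 0 _ _ 1 \<kappa>] show ?thesis using \<kappa> that by auto
  qed
  have B0: "B x = 0" and grad: "gradient U x = 1 *\<^sub>R x" for x
    using U(2) by (simp_all add: perturbed_quadratic_def)
  have r12: "1 / 2 \<le> cmod r"
  proof -
    have "8 * C / \<kappa> \<le> 1 / 2" using C \<kappa> by (simp add: field_simps)
    then show ?thesis using r(2) by linarith
  qed
  have r3: "cmod r \<le> 3"
  proof (rule ccontr)
    assume "\<not> cmod r \<le> 3"
    then have g: "3 < cmod r" by simp
    have "cmod r * cmod r = cmod (of_real (1 + \<beta> - \<alpha>) * r - of_real \<beta>)"
      using r(1) by (metis norm_mult power2_eq_square)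
    also have "\<dots> \<le> \<bar>1 + \<beta> - \<alpha>\<bar> * cmod r + \<beta>"
      using norm_triangle_ineq4[of "of_real (1 + \<beta> - \<alpha>) * r" "of_real \<beta>"] \<beta> by (simp add: norm_mult del: of_real_diff of_real_add)
    also have "\<bar>1 + \<beta> - \<alpha>\<bar> \<le> 2"
    proof -
      have "\<alpha> = h\<^sup>2 * 1 * ((1 + \<beta>) / 2)" by (simp add: \<alpha>_def \<beta>_def)
      also have "\<dots> \<le> 4 * ((1 + \<beta>) / 2)" using h4 \<beta> by (intro mult_right_mono) auto
      finally show ?thesis using \<beta> \<alpha> by (simp add: abs_le_iff)
    qed
    finally have "cmod r * cmod r \<le> 2 * cmod r + \<beta>" by (simp add: mult_right_mono)
    moreover have "3 * cmod r \<le> cmod r * cmod r" using g by (intro mult_right_mono) auto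
    ultimately show False using g \<beta> by linarith
  qed
  define A where "A = M * (1 + 32 * (1 + M))"
  have "slow_mixing_at h \<gamma> U n (A * real n * exp (16 * C / \<kappa> * real n))" if n: "1 \<le> n" for n
  proof -
    define \<rho> where "\<rho> = sqrt (M * real n)"
    have \<rho>: "0 < \<rho>" "\<rho>\<^sup>2 = M * real n" using M n by (auto simp: \<rho>_def)
    define s where "s = 2 * \<rho> / cmod r ^ Suc n"
    have rp: "0 < cmod r ^ k" for k using r12 by (intro zero_less_power) linarith
    have s: "0 < s" "s * cmod r ^ Suc n = 2 * \<rho>" using \<rho> rp[of "Suc n"] by (auto simp: s_def)
    define ob where "ob k = s *\<^sub>R plane (r ^ k)" for k
    have orb: "ob (Suc (Suc k)) = ob (Suc k) + \<beta> *\<^sub>R (ob (Suc k) - ob k) - \<alpha> *\<^sub>R gradient U (ob (Suc k))" for k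
    proof -
      have "r ^ Suc (Suc k) = r ^ k * r\<^sup>2" by (simp add: power2_eq_square)
      also have "\<dots> = of_real (1 + \<beta> - \<alpha>) * r ^ Suc k - of_real \<beta> * r ^ k"
        unfolding r(1) by (simp add: algebra_simps)
      finally have "plane (r ^ Suc (Suc k)) = (1 + \<beta> - \<alpha>) *\<^sub>R plane (r ^ Suc k) - \<beta> *\<^sub>R plane (r ^ k)"
        by (simp only: plane_diff plane_scale)
      then have "ob (Suc (Suc k)) = (1 + \<beta> - \<alpha>) *\<^sub>R ob (Suc k) - \<beta> *\<^sub>R ob k"
        unfolding ob_def by (simp only:) (simp add: algebra_simps)
      then show ?thesis by (simp add: grad algebra_simps)
    qed
    have obn: "norm (ob k) = s * cmod r ^ k" for k
      using s by (simp add: ob_def norm_plane norm_power)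
    have orb2: "- ob (Suc (Suc k)) = - ob (Suc k) + \<beta> *\<^sub>R (- ob (Suc k) - - ob k) - \<alpha> *\<^sub>R gradient U (- ob (Suc k))" for k
      using orb[of k] by (simp add: grad algebra_simps)
    have sep: "2 * \<rho> < norm (ob (Suc n) - - ob (Suc n))"
    proof -
      have "norm (ob (Suc n) - - ob (Suc n)) = 2 * norm (ob (Suc n))"
        by (metis abs_numeral diff_minus_eq_add norm_scaleR scaleR_2)
      then show ?thesis unfolding obn s(2) using \<rho> by simp
    qed
    have obs: "\<forall>ob'\<in>{ob, \<lambda>k. - ob k}. heavy_ball_orbit \<beta> \<alpha> (gradient U) ob' \<and> constant_near_orbit \<rho> B ob'"
      using orb orb2 by (auto simp: heavy_ball_orbit_def constant_near_orbit_def B0)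
    have slow: "slow_mixing_at h \<gamma> U n (M * (1 + (norm (ob 0) + norm (ob 1) + norm (- ob 0) + norm (- ob 1)) + 0))"
      using crit[THEN spec, THEN spec, THEN spec, THEN spec, THEN spec, THEN spec, THEN spec,
          THEN mp, THEN mp, THEN mp, THEN mp, THEN mp, OF U(2) obs sep \<rho>(1) eq_refl[OF \<rho>(2)[symmetric]]] .
    have "M * (1 + (norm (ob 0) + norm (ob 1) + norm (- ob 0) + norm (- ob 1)) + 0) \<le> A * real n * exp (16 * C / \<kappa> * real n)"
    proof -
      let ?e = "exp (16 * C / \<kappa> * real n)"
      have e1: "1 \<le> ?e" using C \<kappa> by simp
      have sb: "s \<le> 4 * \<rho> * ?e"
      proof -
        have x: "8 * C / \<kappa> \<le> 1 / 2" "0 \<le> 8 * C / \<kappa>" using C \<kappa> by (simp_all add: field_simps)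
        have "exp (- 2 * (8 * C / \<kappa>)) \<le> cmod r" using exp_le_one_minus[OF x(2,1)] r(2) by linarith
        then have "exp (- 2 * (8 * C / \<kappa>)) ^ n \<le> cmod r ^ n" by (intro power_mono) auto
        also have "exp (- 2 * (8 * C / \<kappa>)) ^ n = exp (real n * (- 2 * (8 * C / \<kappa>)))"
          by (rule exp_of_nat_mult[symmetric])
        also have "real n * (- 2 * (8 * C / \<kappa>)) = - (16 * C / \<kappa> * real n)" by simp
        also have "exp \<dots> = 1 / ?e" by (simp only: exp_minus inverse_eq_divide)
        finally have "1 \<le> cmod r ^ n * ?e" by (simp add: divide_le_eq)
        then have "1 / 2 * 1 \<le> cmod r * (cmod r ^ n * ?e)" using r12 by (intro mult_mono) auto
        then have "2 * \<rho> * 1 \<le> 2 * \<rho> * (2 * (cmod r ^ Suc n * ?e))"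
          using \<rho> by (intro mult_left_mono) auto
        then have "2 * \<rho> \<le> (4 * \<rho> * ?e) * cmod r ^ Suc n" by (simp add: mult_ac)
        then show ?thesis unfolding s_def using rp[of "Suc n"] by (simp add: pos_divide_le_eq)
      qed
      have \<rho>n: "\<rho> \<le> (1 + M) * real n"
      proof (rule power2_le_imp_le)
        have "M * real n \<le> (1 + M)\<^sup>2 * (real n)\<^sup>2"
          using M n by (intro mult_mono) (auto simp: power2_eq_square algebra_simps)
        then show "\<rho>\<^sup>2 \<le> ((1 + M) * real n)\<^sup>2" by (simp add: \<rho>(2) power_mult_distrib)
      qed (use M in simp)
      have "norm (ob 0) + norm (ob 1) + norm (- ob 0) + norm (- ob 1) = 2 * s + 2 * (s * cmod r)"
        by (simp add: obn)
      also have "\<dots> \<le> 2 * s + 2 * (s * 3)" using r3 s by (intro add_left_mono mult_left_mono) auto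
      also have "\<dots> \<le> 8 * (4 * \<rho> * ?e)" using sb by simp
      also have "\<dots> \<le> 8 * (4 * ((1 + M) * real n) * ?e)" using \<rho>n by simp
      also have "\<dots> = 32 * (1 + M) * (real n * ?e)" by (simp add: algebra_simps)
      finally have "1 + (norm (ob 0) + norm (ob 1) + norm (- ob 0) + norm (- ob 1)) + 0 \<le> 1 * 1 + 32 * (1 + M) * (real n * ?e)"
        by linarith
      also have "\<dots> \<le> real n * ?e + 32 * (1 + M) * (real n * ?e)"
        using n e1 by (intro add_right_mono mult_mono) auto
      also have "\<dots> = (1 + 32 * (1 + M)) * (real n * ?e)" by (simp add: algebra_simps)
      finally have "M * (1 + (norm (ob 0) + norm (ob 1) + norm (- ob 0) + norm (- ob 1)) + 0) \<le> M * ((1 + 32 * (1 + M)) * (real n * ?e))"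
        using M by (intro mult_left_mono) auto
      then show ?thesis by (simp add: A_def mult_ac)
    qed
    then show ?thesis by (rule slow_mixing_at_mono[OF slow])
  qed
  moreover have "0 \<le> A" using M by (simp add: A_def)
  ultimately show ?thesis using U(1) by blast
qed

section \<open>Large steps: a periodic orbit\<close>

lemma norm_one_minus_cis: "cmod (1 - cis (2 * x)) = 2 * \<bar>sin x\<bar>"
proof -
  have "(cmod (1 - cis (2 * x)))\<^sup>2 = (1 - cos (2 * x))\<^sup>2 + (sin (2 * x))\<^sup>2"
    by (simp add: cmod_power2)
  also have "\<dots> = 1 - 2 * cos (2 * x) + ((sin (2 * x))\<^sup>2 + (cos (2 * x))\<^sup>2)"
    by (simp only: power2_eq_square) (simp add: algebra_simps)
  also have "\<dots> = (2 * \<bar>sin x\<bar>)\<^sup>2"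
    unfolding sin_cos_squared_add by (simp add: cos_double_sin power_mult_distrib)
  finally show ?thesis by (rule power2_eq_imp_eq) auto
qed

lemma roots_of_unity_separated:
  fixes \<delta> :: real and K :: nat
  assumes \<delta>: "0 < \<delta>" and K: "2 \<le> K" "real K * \<delta> = pi" and d: "1 \<le> d" "d < K"
  shows "2 * sin \<delta> \<le> cmod (1 - cis (2 * \<delta>) ^ d)"
proof -
  have ineq: "\<delta> \<le> real e * \<delta>" if "1 \<le> e" for e :: nat
    using mult_right_mono[of 1 "real e" \<delta>] that \<delta> by simp
  have "sin \<delta> \<le> sin (real d * \<delta>)"
  proof (cases "real d * \<delta> \<le> pi / 2")
    case True
    moreover have "- (pi / 2) \<le> \<delta>" using \<delta> pi_ge_zero by linarith
    ultimately show ?thesis using ineq[OF d(1)] by (intro sin_monotone_2pi_le) auto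
  next
    case False
    have e: "pi - real d * \<delta> = real (K - d) * \<delta>"
      using d K(2) by (simp add: of_nat_diff algebra_simps)
    have "sin \<delta> \<le> sin (pi - real d * \<delta>)"
    proof (rule sin_monotone_2pi_le)
      show "- (pi / 2) \<le> \<delta>" using \<delta> pi_ge_zero by linarith
      show "\<delta> \<le> pi - real d * \<delta>" using ineq[of "K - d"] d unfolding e by simp
      show "pi - real d * \<delta> \<le> pi / 2" using False by simp
    qed
    then show ?thesis by simp
  qed
  moreover have "cmod (1 - cis (2 * \<delta>) ^ d) = 2 * \<bar>sin (real d * \<delta>)\<bar>"
    using norm_one_minus_cis[of "real d * \<delta>"] by (simp add: Complex.DeMoivre mult.left_commute)
  ultimately show ?thesis by simp
qed

text \<open>
  Halving the angle divides \<open>(sin \<delta>)\<^sup>2\<close> by at most \<open>4\<close>, so among the angles \<open>\<pi> / 2\<^sup>j\<close> there is one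
  that hits the window. The angle \<open>\<pi> / 2\<close> itself is too large because \<open>a < 2\<close>.
\<close>

lemma resonant_angle_exists:
  fixes a :: real
  assumes "0 < a" "a < 2"
  shows "\<exists>\<delta> K. 0 < \<delta> \<and> \<delta> \<le> pi / 2 \<and> (2::nat) \<le> K \<and> real K * \<delta> = pi \<and>
    7 / 32 * a \<le> 2 * (sin \<delta>)\<^sup>2 \<and> 2 * (sin \<delta>)\<^sup>2 \<le> 7 / 8 * a"
proof -
  define P where "P j \<longleftrightarrow> 2 * (sin (pi / 2 ^ Suc j))\<^sup>2 \<le> 7 / 8 * a" for j :: nat
  have "\<not> P 0" using assms by (simp add: P_def)
  have "\<exists>j. P j"
  proof -
    have "0 < sqrt (7 / 16 * a) / pi" using assms by simp
    then obtain j where j: "(1 / 2) ^ j < sqrt (7 / 16 * a) / pi"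
      using real_arch_pow_inv[of "sqrt (7 / 16 * a) / pi" "1 / 2"] by auto
    have "\<bar>sin (pi / 2 ^ Suc j)\<bar> \<le> pi / 2 ^ Suc j"
      using abs_sin_x_le_abs_x[of "pi / 2 ^ Suc j"] by simp
    also have "\<dots> \<le> pi * (1 / 2) ^ j" by (simp add: power_one_over field_simps)
    also have "\<dots> \<le> sqrt (7 / 16 * a)" using j by (simp add: field_simps)
    finally have "\<bar>sin (pi / 2 ^ Suc j)\<bar> \<le> sqrt (7 / 16 * a)" .
    then have "\<bar>sin (pi / 2 ^ Suc j)\<bar>\<^sup>2 \<le> (sqrt (7 / 16 * a))\<^sup>2" by (intro power_mono) auto
    then have "P j" using assms by (simp add: P_def)
    then show ?thesis ..
  qed
  then have L: "P (LEAST j. P j)" by (rule LeastI_ex)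
  then obtain i where i: "(LEAST j. P j) = Suc i" using \<open>\<not> P 0\<close> by (metis not0_implies_Suc)
  have nP: "\<not> P i" using not_less_Least[of i P] i by simp
  define \<delta> where "\<delta> = pi / 2 ^ Suc (Suc i)"
  have "2 * \<delta> = pi / 2 ^ Suc i" by (simp add: \<delta>_def)
  then have "7 / 8 * a < 2 * (sin (2 * \<delta>))\<^sup>2" using nP by (simp add: P_def)
  also have "(sin (2 * \<delta>))\<^sup>2 = 4 * (sin \<delta>)\<^sup>2 * (cos \<delta>)\<^sup>2" by (simp add: sin_double power_mult_distrib)
  also have "\<dots> \<le> 4 * (sin \<delta>)\<^sup>2 * 1" by (intro mult_left_mono) (auto simp: abs_square_le_1)
  finally have lo: "7 / 32 * a \<le> 2 * (sin \<delta>)\<^sup>2" by simp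
  have hi: "2 * (sin \<delta>)\<^sup>2 \<le> 7 / 8 * a" using L unfolding i by (simp add: P_def \<delta>_def)
  have "(2::real) \<le> 2 ^ Suc (Suc i)" using power_increasing[of 1 "Suc (Suc i)" "2::real"] by simp
  then have "\<delta> \<le> pi / 2" unfolding \<delta>_def by (intro divide_left_mono) auto
  moreover have "(2::nat) \<le> 2 ^ Suc (Suc i)" by simp
  moreover have "real (2 ^ Suc (Suc i)) * \<delta> = pi" by (simp add: \<delta>_def)
  moreover have "0 < \<delta>" by (simp add: \<delta>_def)
  ultimately show ?thesis using lo hi by blast
qed

text \<open>
  The orbit runs through the vertices of a regular \<open>K\<close>-gon, that is, through multiples of the powers
  of \<open>z = exp (2 i \<delta>)\<close> with \<open>K \<delta> = \<pi>\<close>. The radial part of the recursion holds for a quadratic potential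
  with Hessian \<open>L\<close> if \<open>\<alpha> L = (1 + \<beta>) (1 - cos (2 \<delta>))\<close>; the friction is balanced by a tangential force
  of size \<open>(1 - \<beta>) sin (2 \<delta>) / \<alpha>\<close> times the radius, which bumps at the vertices provide. Since the
  distance of the vertices is of order \<open>sin \<delta>\<close>, the bumps change the Hessian by a multiple of
  \<open>(1 - \<beta>) / \<alpha>\<close> only, and this is at most \<open>\<kappa> / 8\<close> when \<open>\<alpha> \<kappa>\<close> is a large multiple of \<open>1 - \<beta>\<close>. The
  window for the angle places \<open>L\<close> between \<open>7/32 \<kappa>\<close> and \<open>7/8 \<kappa>\<close>, which leaves room for this change.

  The second orbit is the first one shifted by one step. The radius \<open>sc\<close> is proportional to the
  square root of \<open>n\<close>, so that the noise does not drive the chain out of the bumps within \<open>n\<close> steps.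
\<close>

lemma slow_mixing_large_step:
  "\<exists>C\<ge>1. \<forall>h \<gamma> \<kappa> :: real. 0 < h \<longrightarrow> 0 < \<gamma> \<longrightarrow> 11 \<le> \<kappa> \<longrightarrow> h\<^sup>2 * \<kappa> < 4 \<longrightarrow>
    C * (1 - exp (- \<gamma> * h)) < h\<^sup>2 * (1 + exp (- \<gamma> * h)) / 2 * \<kappa> \<longrightarrow>
    (\<exists>A\<ge>0. \<forall>n\<ge>1. \<exists>U \<in> (potentials \<kappa> :: (real ^ 2 \<Rightarrow> real) set). slow_mixing_at h \<gamma> U n (A * real n))"
proof -
  obtain MB where MB: "1 \<le> MB" and bumps: "\<forall>\<kappa> L w m (I::nat set) a l. finite I \<longrightarrow> 0 < w \<longrightarrow> 0 \<le> m \<longrightarrow> (\<forall>i\<in>I. norm (l i :: real ^ 2) \<le> m) \<longrightarrow>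
      (\<forall>i\<in>I. \<forall>j\<in>I. i \<noteq> j \<longrightarrow> 2 * w \<le> norm (a i - a j)) \<longrightarrow> 1 + MB * m / w \<le> L \<longrightarrow> L + MB * m / w \<le> \<kappa> \<longrightarrow>
      (\<exists>U\<in>potentials \<kappa>. \<exists>B. perturbed_quadratic L (MB * m) U B \<and> (\<forall>i\<in>I. \<forall>x. norm (x - a i) \<le> w / 3 \<longrightarrow> B x = l i))"
    using bumpy_quadratic_potential_exists[where 'a="real ^ 2" and 'i=nat] by (elim exE conjE) (rule that)
  show ?thesis
  proof (rule exI[of _ "16 * MB"], intro conjI allI impI)
    show "1 \<le> 16 * MB" using MB by simp
    fix h \<gamma> \<kappa> :: real
    assume h: "0 < h" and \<gamma>: "0 < \<gamma>" and \<kappa>: "11 \<le> \<kappa>" and stable: "h\<^sup>2 * \<kappa> < 4"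
      and large: "16 * MB * (1 - exp (- \<gamma> * h)) < h\<^sup>2 * (1 + exp (- \<gamma> * h)) / 2 * \<kappa>"
    define \<beta> where "\<beta> = exp (- \<gamma> * h)"
    define \<alpha> where "\<alpha> = h\<^sup>2 * (1 + \<beta>) / 2"
    have \<beta>: "0 < \<beta>" "\<beta> < 1" using h \<gamma> by (auto simp: \<beta>_def)
    have \<alpha>: "0 < \<alpha>" using h \<beta> by (simp add: \<alpha>_def add_pos_pos)
    have large': "16 * MB * (1 - \<beta>) < \<alpha> * \<kappa>" using large by (simp add: \<beta>_def \<alpha>_def)
    define a where "a = h\<^sup>2 * \<kappa> / 2"
    have a: "0 < a" "a < 2" using h \<kappa> stable by (auto simp: a_def)
    obtain \<delta> and K :: nat where \<delta>: "0 < \<delta>" "\<delta> \<le> pi / 2" and K: "2 \<le> K" "real K * \<delta> = pi"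
      and res: "7 / 32 * a \<le> 2 * (sin \<delta>)\<^sup>2" "2 * (sin \<delta>)\<^sup>2 \<le> 7 / 8 * a"
      using resonant_angle_exists[OF a] by blast
    have sin: "0 < sin \<delta>" using \<delta> pi_gt_zero by (intro sin_gt_zero) auto
    have cos: "0 \<le> cos \<delta>" "cos \<delta> \<le> 1" using \<delta> by (auto intro: cos_ge_zero)
    define z where "z = cis (2 * \<delta>)"
    have zK: "z ^ K = 1"
    proof -
      have "z ^ K = cis (real K * (2 * \<delta>))" unfolding z_def by (rule Complex.DeMoivre)
      also have "real K * (2 * \<delta>) = 2 * pi" using K(2) by (simp add: mult.left_commute)
      finally show ?thesis by simp
    qed
    have zmod: "z ^ k = z ^ (k mod K)" for k
    proof -
      have "z ^ k = z ^ (K * (k div K) + k mod K)" by simp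
      also have "\<dots> = z ^ (k mod K)" unfolding power_add power_mult zK by simp
      finally show ?thesis .
    qed
    have z1: "cmod z = 1" by (simp add: z_def)
    have zsep: "2 * sin \<delta> \<le> cmod (z ^ i - z ^ (i + d))" if "1 \<le> d" "d < K" for i d
    proof -
      have "cmod (z ^ i - z ^ (i + d)) = cmod (z ^ i) * cmod (1 - z ^ d)"
        unfolding norm_mult[symmetric] by (simp add: power_add algebra_simps)
      then show ?thesis
        using roots_of_unity_separated[OF \<delta>(1) K that] by (simp add: z1 norm_power z_def[symmetric])
    qed
    \<comment> \<open>the recursion satisfied by the powers of \<open>z\<close>: resonance of the heavy ball with a rotating force\<close>
    have zrec: "z\<^sup>2 = z + of_real \<beta> * (z - 1) - of_real ((1 + \<beta>) * (2 * (sin \<delta>)\<^sup>2)) * z + of_real ((1 - \<beta>) * sin (2 * \<delta>)) * (\<i> * z)"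
    proof -
      have c2: "cos (2 * \<delta>) = 1 - 2 * (sin \<delta>)\<^sup>2" by (rule cos_double_sin)
      have "z = 1 + of_real \<beta> * (1 - cnj z) - of_real ((1 + \<beta>) * (2 * (sin \<delta>)\<^sup>2)) + of_real ((1 - \<beta>) * sin (2 * \<delta>)) * \<i>"
        by (simp add: z_def complex_eq_iff c2) (simp add: algebra_simps)
      then have "z * z = (1 + of_real \<beta> * (1 - cnj z) - of_real ((1 + \<beta>) * (2 * (sin \<delta>)\<^sup>2)) + of_real ((1 - \<beta>) * sin (2 * \<delta>)) * \<i>) * z"
        by (rule arg_cong)
      also have "\<dots> = z + of_real \<beta> * (z - cnj z * z) - of_real ((1 + \<beta>) * (2 * (sin \<delta>)\<^sup>2)) * z + of_real ((1 - \<beta>) * sin (2 * \<delta>)) * (\<i> * z)"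
        by (simp only: ring_distribs mult_1_left mult.assoc)
      also have "cnj z * z = 1" by (simp add: z_def cis_cnj cis_mult)
      finally show ?thesis by (simp add: power2_eq_square)
    qed
    define L where "L = (1 + \<beta>) * (2 * (sin \<delta>)\<^sup>2) / \<alpha>"
    have \<alpha>a: "\<alpha> * \<kappa> = (1 + \<beta>) * a" by (simp add: \<alpha>_def a_def)
    have L1: "7 / 32 * \<kappa> \<le> L"
    proof -
      have "\<alpha> * (7 / 32 * \<kappa>) = 7 / 32 * (\<alpha> * \<kappa>)" by simp
      also have "\<dots> = (1 + \<beta>) * (7 / 32 * a)" unfolding \<alpha>a by simp
      also have "\<dots> \<le> (1 + \<beta>) * (2 * (sin \<delta>)\<^sup>2)" using res \<beta> by (intro mult_left_mono) auto
      finally show ?thesis using \<alpha> by (simp add: L_def pos_le_divide_eq mult.commute)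
    qed
    have L2: "L \<le> 7 / 8 * \<kappa>"
    proof -
      have "(1 + \<beta>) * (2 * (sin \<delta>)\<^sup>2) \<le> (1 + \<beta>) * (7 / 8 * a)" using res \<beta> by (intro mult_left_mono) auto
      also have "\<dots> = 7 / 8 * (\<alpha> * \<kappa>)" unfolding \<alpha>a by simp
      also have "\<dots> = \<alpha> * (7 / 8 * \<kappa>)" by simp
      finally show ?thesis using \<alpha> by (simp add: L_def pos_divide_le_eq mult.commute)
    qed
    have L0: "0 < L" using L1 \<kappa> by linarith
    have "h\<^sup>2 * L \<le> h\<^sup>2 * \<kappa>" using L2 \<kappa> by (intro mult_left_mono) auto
    then have hL: "h\<^sup>2 * L < 4" using stable by simp
    obtain M where M: "0 < M" and crit: "\<forall>(U :: real ^ 2 \<Rightarrow> real) B \<Lambda> o1 o2 n r. perturbed_quadratic L \<Lambda> U B \<longrightarrow>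
      (\<forall>ob\<in>{o1, o2}. heavy_ball_orbit \<beta> \<alpha> (gradient U) ob \<and> constant_near_orbit r B ob) \<longrightarrow>
      2 * r < norm (o1 (Suc n) - o2 (Suc n)) \<longrightarrow> 0 < r \<longrightarrow> M * real n \<le> r\<^sup>2 \<longrightarrow>
      slow_mixing_at h \<gamma> U n (M * (1 + (norm (o1 0) + norm (o1 1) + norm (o2 0) + norm (o2 1)) + \<Lambda>))"
      using baoab_slow_mixing_criterion[OF h \<gamma> L0 hL \<beta>_def \<alpha>_def] by (elim exE conjE) (rule that)
    define m1 where "m1 = (1 - \<beta>) * sin (2 * \<delta>) / \<alpha>"
    have s2: "0 \<le> sin (2 * \<delta>)" "sin (2 * \<delta>) \<le> 2 * sin \<delta>"
      using sin cos by (auto simp: sin_double mult_left_le)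
    have m1: "0 \<le> m1" using \<beta> \<alpha> s2 by (simp add: m1_def)
    define A where "A = M * (1 + (4 + MB * m1) * (3 * (1 + M) / sin \<delta>))"
    have "\<exists>U \<in> (potentials \<kappa> :: (real ^ 2 \<Rightarrow> real) set). slow_mixing_at h \<gamma> U n (A * real n)" if n: "1 \<le> n" for n
    proof -
      define \<rho> where "\<rho> = sqrt (M * real n)"
      have \<rho>: "0 < \<rho>" "\<rho>\<^sup>2 = M * real n" using M n by (auto simp: \<rho>_def)
      define sc where "sc = 3 * \<rho> / sin \<delta>"
      define w where "w = 3 * \<rho>"
      have sc: "0 < sc" "sc * sin \<delta> = w" using \<rho> sin by (auto simp: sc_def w_def)
      have w: "0 < w" "w / 3 = \<rho>" using \<rho> by (auto simp: w_def)
      define m where "m = sc * m1"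
      define ob where "ob k = sc *\<^sub>R plane (z ^ k)" for k
      define l where "l k = (- m) *\<^sub>R plane (\<i> * z ^ k)" for k
      have m: "0 \<le> m" using sc m1 by (simp add: m_def)
      have lm: "\<forall>i\<in>{..<K}. norm (l i) \<le> m"
        using m by (simp add: l_def norm_plane norm_mult norm_power z1)
      have obn: "norm (ob k) = sc" for k using sc by (simp add: ob_def norm_plane norm_power z1)
      have obd: "norm (ob i - ob j) = sc * cmod (z ^ i - z ^ j)" for i j
        using sc by (simp add: ob_def norm_plane scaleR_diff_right[symmetric] plane_diff[symmetric])
      have sep1: "2 * w \<le> norm (ob i - ob (i + d))" if "1 \<le> d" "d < K" for i d
        unfolding obd sc(2)[symmetric] using mult_left_mono[OF zsep[OF that, of i], of sc] sc(1) by simp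
      have sep: "\<forall>i\<in>{..<K}. \<forall>j\<in>{..<K}. i \<noteq> j \<longrightarrow> 2 * w \<le> norm (ob i - ob j)"
      proof (intro ballI impI)
        fix i j assume ij: "i \<in> {..<K}" "j \<in> {..<K}" "i \<noteq> j"
        show "2 * w \<le> norm (ob i - ob j)"
        proof (cases "i < j")
          case True
          then show ?thesis using sep1[of "j - i" i] ij by simp
        next
          case False
          then show ?thesis using sep1[of "i - j" j] ij by (simp add: norm_minus_commute)
        qed
      qed
      have mw: "MB * m / w \<le> \<kappa> / 8"
      proof -
        have "m / w = m1 / sin \<delta>" unfolding m_def sc(2)[symmetric] using sc(1) by simp
        also have "\<dots> = (1 - \<beta>) / \<alpha> * (sin (2 * \<delta>) / sin \<delta>)" by (simp add: m1_def)
        also have "\<dots> \<le> (1 - \<beta>) / \<alpha> * 2" using s2 sin \<beta> \<alpha> by (intro mult_left_mono) (auto simp: divide_le_eq)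
        finally have "MB * (m / w) \<le> MB * ((1 - \<beta>) / \<alpha> * 2)" using MB by (intro mult_left_mono) auto
        also have "\<dots> = (16 * MB * (1 - \<beta>)) / \<alpha> / 8" by simp
        also have "\<dots> \<le> \<kappa> / 8" using large' \<alpha> by (intro divide_right_mono) (auto simp: pos_divide_le_eq mult.commute)
        finally show ?thesis by simp
      qed
      have Lb: "1 + MB * m / w \<le> L" "L + MB * m / w \<le> \<kappa>" using mw L1 L2 \<kappa> by linarith+
      obtain U B where U: "U \<in> potentials \<kappa>" and UB: "perturbed_quadratic L (MB * m) U B"
        and flat: "\<forall>i\<in>{..<K}. \<forall>x. norm (x - ob i) \<le> w / 3 \<longrightarrow> B x = l i"
        using bumps[THEN spec, THEN spec, THEN spec, THEN spec, THEN spec, THEN spec, THEN spec,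
            THEN mp, THEN mp, THEN mp, THEN mp, THEN mp, THEN mp, THEN mp, OF finite_lessThan w(1) m lm sep Lb]
        by (elim bexE exE conjE) (rule that)
      have grad: "gradient U x = L *\<^sub>R x + B x" for x using UB by (simp add: perturbed_quadratic_def)
      have K0: "0 < K" using K by simp
      have obl: "ob k = ob (k mod K)" "l k = l (k mod K)" for k
        unfolding ob_def l_def using zmod[of k] by simp_all
      have Bl: "B x = l k" if "norm (x - ob k) \<le> \<rho>" for x k
        using flat that K0 w(2) obl[of k] by (metis lessThan_iff mod_less_divisor)
      have Bo: "B (ob k) = l k" for k using Bl[of "ob k" k] \<rho> by simp
      have orb: "heavy_ball_orbit \<beta> \<alpha> (gradient U) ob"
        unfolding heavy_ball_orbit_def
      proof
        fix k
        have "z ^ Suc (Suc k) = z ^ k * z\<^sup>2" by (simp add: power2_eq_square)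
        also have "\<dots> = z ^ Suc k + of_real \<beta> * (z ^ Suc k - z ^ k) - of_real ((1 + \<beta>) * (2 * (sin \<delta>)\<^sup>2)) * z ^ Suc k
            + of_real ((1 - \<beta>) * sin (2 * \<delta>)) * (\<i> * z ^ Suc k)"
          unfolding zrec by (simp only: ring_distribs mult_1_right mult_1_left power_Suc2 mult_ac)
        also have "(1 + \<beta>) * (2 * (sin \<delta>)\<^sup>2) = \<alpha> * L" using \<alpha> by (simp add: L_def)
        also have "(1 - \<beta>) * sin (2 * \<delta>) = \<alpha> * m1" using \<alpha> by (simp add: m1_def)
        finally have "plane (z ^ Suc (Suc k)) = plane (z ^ Suc k) + \<beta> *\<^sub>R (plane (z ^ Suc k) - plane (z ^ k))
            - (\<alpha> * L) *\<^sub>R plane (z ^ Suc k) + (\<alpha> * m1) *\<^sub>R plane (\<i> * z ^ Suc k)"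
          by (simp only: plane_add plane_diff plane_scale)
        then have "ob (Suc (Suc k)) = ob (Suc k) + \<beta> *\<^sub>R (ob (Suc k) - ob k) - \<alpha> *\<^sub>R (L *\<^sub>R ob (Suc k) + l (Suc k))"
          unfolding ob_def l_def m_def by (simp only:) (simp add: algebra_simps)
        then show "ob (Suc (Suc k)) = ob (Suc k) + \<beta> *\<^sub>R (ob (Suc k) - ob k) - \<alpha> *\<^sub>R gradient U (ob (Suc k))"
          by (simp only: grad Bo)
      qed
      let ?o2 = "\<lambda>k. ob (Suc k)"
      have obs: "\<forall>o'\<in>{ob, ?o2}. heavy_ball_orbit \<beta> \<alpha> (gradient U) o' \<and> constant_near_orbit \<rho> B o'"
      proof -
        have "heavy_ball_orbit \<beta> \<alpha> (gradient U) ?o2" using orb unfolding heavy_ball_orbit_def by blast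
        moreover have "B x = B (ob k)" if "norm (x - ob k) \<le> \<rho>" for x k using Bl[OF that] Bo by simp
        ultimately show ?thesis using orb unfolding constant_near_orbit_def by blast
      qed
      have sepn: "2 * \<rho> < norm (ob (Suc n) - ?o2 (Suc n))"
        using sep1[of 1 "Suc n"] K \<rho> by (simp add: w_def)
      have slow: "slow_mixing_at h \<gamma> U n (M * (1 + (norm (ob 0) + norm (ob 1) + norm (?o2 0) + norm (?o2 1)) + MB * m))"
        using crit[THEN spec, THEN spec, THEN spec, THEN spec, THEN spec, THEN spec, THEN spec,
          THEN mp, THEN mp, THEN mp, THEN mp, THEN mp, OF UB obs sepn \<rho>(1) eq_refl[OF \<rho>(2)[symmetric]]] .
      have "M * (1 + (norm (ob 0) + norm (ob 1) + norm (?o2 0) + norm (?o2 1)) + MB * m) \<le> A * real n"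
      proof -
        have \<rho>n: "\<rho> \<le> (1 + M) * real n"
        proof (rule power2_le_imp_le)
          have "M * real n \<le> (1 + M)\<^sup>2 * (real n)\<^sup>2"
            using M n by (intro mult_mono) (auto simp: power2_eq_square algebra_simps)
          then show "\<rho>\<^sup>2 \<le> ((1 + M) * real n)\<^sup>2" by (simp add: \<rho>(2) power_mult_distrib)
        qed (use M in simp)
        have scn: "sc \<le> 3 * (1 + M) / sin \<delta> * real n"
        proof -
          have "3 * \<rho> / sin \<delta> \<le> 3 * ((1 + M) * real n) / sin \<delta>"
            using \<rho>n sin by (intro divide_right_mono) auto
          then show ?thesis by (simp add: sc_def algebra_simps)
        qed
        have "1 + (norm (ob 0) + norm (ob 1) + norm (?o2 0) + norm (?o2 1)) + MB * m = 1 + (4 + MB * m1) * sc"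
          by (simp add: obn m_def algebra_simps)
        also have "\<dots> \<le> real n + (4 + MB * m1) * (3 * (1 + M) / sin \<delta> * real n)"
          using n MB m1 by (intro add_mono mult_left_mono scn) auto
        also have "\<dots> = (1 + (4 + MB * m1) * (3 * (1 + M) / sin \<delta>)) * real n" by (simp add: algebra_simps)
        finally have "M * (1 + (norm (ob 0) + norm (ob 1) + norm (?o2 0) + norm (?o2 1)) + MB * m)
            \<le> M * ((1 + (4 + MB * m1) * (3 * (1 + M) / sin \<delta>)) * real n)"
          using M by (intro mult_left_mono) auto
        then show ?thesis by (simp only: A_def mult.assoc)
      qed
      with U show ?thesis using slow_mixing_at_mono[OF slow] by blast
    qed
    moreover have "0 \<le> A" using M MB m1 sin by (simp add: A_def)
    ultimately show "\<exists>A\<ge>0. \<forall>n\<ge>1. \<exists>U \<in> (potentials \<kappa> :: (real ^ 2 \<Rightarrow> real) set). slow_mixing_at h \<gamma> U n (A * real n)" by blast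
  qed
qed

section \<open>Conclusion\<close>

text \<open>
  In both regimes the starting points satisfy \<open>1 + W2 \<le> (1 + A) n exp (q n)\<close> with \<open>q = 16 C' / \<kappa>\<close>.
  The bound to be refuted is therefore at most a constant times \<open>n\<^sup>b exp (- (c / \<tau> \<kappa> - b q) n)\<close>. As
  \<open>\<tau> \<kappa> = o(\<kappa>)\<close>, the exponent is negative for large \<open>\<kappa>\<close>, and then for large \<open>n\<close> the bound drops
  below \<open>1/4\<close>.
\<close>

lemma no_accelerated_bound:
  fixes h \<gamma> :: "real \<Rightarrow> real \<Rightarrow> nat \<Rightarrow> real"
    and C c a b \<kappa>\<^sub>0 :: real
    and \<tau> :: "real \<Rightarrow> real"
  assumes rule: "tuning_rule h \<gamma>" and stable: "numerically_stable h"
    and C: "C > 0" and c: "c > 0" and b: "b \<ge> 0"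
    and \<tau>: "\<forall>\<kappa>>1. \<tau> \<kappa> > 0" and \<tau>o: "\<tau> \<in> o[at_top](\<lambda>\<kappa>. \<kappa>)"
    and \<kappa>0: "\<kappa>\<^sub>0 > 1"
  shows "\<exists>\<kappa>\<ge>\<kappa>\<^sub>0. \<exists>U \<in> (potentials \<kappa> :: (real ^ 2 \<Rightarrow> real) set). \<exists>\<pi>.
            unique_invariant_law (baoab_kernel (h 1 \<kappa> 2) (\<gamma> 1 \<kappa> 2) U) \<pi> \<and>
            (\<exists>z n. ennreal (tv_dist (apply_kernel (baoab_kernel (h 1 \<kappa> 2) (\<gamma> 1 \<kappa> 2) U) n (dirac z)) \<pi>)
                 > ennreal (C * \<kappa> powr a) * epowr (1 + W2 (dirac z) \<pi>) b
                     * ennreal (exp (- (c * real n / \<tau> \<kappa>))))"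
proof -
  obtain C' where C': "1 \<le> C'" and large: "\<forall>h \<gamma> \<kappa> :: real. 0 < h \<longrightarrow> 0 < \<gamma> \<longrightarrow> 11 \<le> \<kappa> \<longrightarrow> h\<^sup>2 * \<kappa> < 4 \<longrightarrow>
    C' * (1 - exp (- \<gamma> * h)) < h\<^sup>2 * (1 + exp (- \<gamma> * h)) / 2 * \<kappa> \<longrightarrow>
    (\<exists>A\<ge>0. \<forall>n\<ge>1. \<exists>U \<in> (potentials \<kappa> :: (real ^ 2 \<Rightarrow> real) set). slow_mixing_at h \<gamma> U n (A * real n))"
    using slow_mixing_large_step by (elim exE conjE) (rule that)
  \<comment> \<open>\<open>\<kappa>\<close> so large that the growth \<open>16 b C' / \<kappa>\<close> of the starting points loses against the rate \<open>c / \<tau> \<kappa>\<close>\<close>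
  define \<delta> where "\<delta> = c / (16 * b * C' + 1)"
  have bC: "0 \<le> 16 * b * C'" using b C' by simp
  have \<delta>: "0 < \<delta>" unfolding \<delta>_def by (rule divide_pos_pos) (use c bC in linarith)+
  have "eventually (\<lambda>\<kappa>. \<bar>\<tau> \<kappa>\<bar> \<le> \<delta> * \<bar>\<kappa>\<bar>) at_top"
    using landau_o.smallD[OF \<tau>o \<delta>] by simp
  then obtain k0 where k0: "\<And>\<kappa>. k0 \<le> \<kappa> \<Longrightarrow> \<bar>\<tau> \<kappa>\<bar> \<le> \<delta> * \<bar>\<kappa>\<bar>"
    unfolding eventually_at_top_linorder by blast
  define \<kappa> where "\<kappa> = max (max \<kappa>\<^sub>0 k0) (16 * C')"
  have \<kappa>: "\<kappa>\<^sub>0 \<le> \<kappa>" "k0 \<le> \<kappa>" "16 * C' \<le> \<kappa>" by (auto simp: \<kappa>_def)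
  have \<kappa>11: "11 \<le> \<kappa>" using \<kappa>(3) C' by linarith
  have \<kappa>1: "1 < \<kappa>" using \<kappa>11 by simp
  have \<tau>\<kappa>: "0 < \<tau> \<kappa>" "\<tau> \<kappa> \<le> \<delta> * \<kappa>" using \<tau> k0[OF \<kappa>(2)] \<kappa>1 by auto
  define q where "q = 16 * C' / \<kappa>"
  define d where "d = c / \<tau> \<kappa> - b * q"
  have q: "0 \<le> q" using C' \<kappa>1 by (simp add: q_def)
  have d: "0 < d"
  proof -
    have "b * q * \<tau> \<kappa> \<le> b * q * (\<delta> * \<kappa>)" using \<tau>\<kappa> b q by (intro mult_left_mono) auto
    also have "\<dots> = 16 * b * C' * \<delta>" using \<kappa>1 by (simp add: q_def)
    also have "\<dots> < c"
      using c bC by (simp add: \<delta>_def pos_divide_less_eq algebra_simps)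
    finally show ?thesis using \<tau>\<kappa> by (simp add: d_def pos_less_divide_eq)
  qed
  let ?h = "h 1 \<kappa> 2" and ?\<gamma> = "\<gamma> 1 \<kappa> 2"
  have h: "0 < ?h" "?h < 2 / sqrt \<kappa>" using stable \<kappa>1 by (auto simp: numerically_stable_def)
  have \<gamma>: "0 < ?\<gamma>" using rule \<kappa>1 by (auto simp: tuning_rule_def)
  have h4: "?h\<^sup>2 * \<kappa> < 4"
  proof -
    have "?h * sqrt \<kappa> < 2" using h \<kappa>1 by (simp add: pos_less_divide_eq)
    then have "(?h * sqrt \<kappa>)\<^sup>2 < 2\<^sup>2" using h \<kappa>1 by (intro power_strict_mono) auto
    then show ?thesis using \<kappa>1 by (simp add: power_mult_distrib)
  qed
  obtain A where A: "0 \<le> A" and slow: "\<forall>n\<ge>1. \<exists>U \<in> (potentials \<kappa> :: (real ^ 2 \<Rightarrow> real) set).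
    slow_mixing_at ?h ?\<gamma> U n (A * real n * exp (q * real n))"
  proof (cases "C' * (1 - exp (- ?\<gamma> * ?h)) < ?h\<^sup>2 * (1 + exp (- ?\<gamma> * ?h)) / 2 * \<kappa>")
    case True
    obtain A where A: "0 \<le> A" and s: "\<forall>n\<ge>1. \<exists>U \<in> (potentials \<kappa> :: (real ^ 2 \<Rightarrow> real) set).
      slow_mixing_at ?h ?\<gamma> U n (A * real n)"
      using large[rule_format, OF h(1) \<gamma> \<kappa>11 h4 True] by blast
    have "A * real n \<le> A * real n * exp (q * real n)" for n
      using A q mult_left_mono[of 1 "exp (q * real n)" "A * real n"] by simp
    with s have "\<forall>n\<ge>1. \<exists>U \<in> (potentials \<kappa> :: (real ^ 2 \<Rightarrow> real) set).
      slow_mixing_at ?h ?\<gamma> U n (A * real n * exp (q * real n))"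
      using slow_mixing_at_mono by blast
    with A show ?thesis by (rule that)
  next
    case False
    then have "?h\<^sup>2 * (1 + exp (- ?\<gamma> * ?h)) / 2 * \<kappa> \<le> C' * (1 - exp (- ?\<gamma> * ?h))" by simp
    from slow_mixing_small_step[OF h(1) \<gamma> C' \<kappa>(3) h4 this] show ?thesis
      unfolding q_def[symmetric] by (elim exE conjE) (rule that)
  qed
  define G where "G = C * \<kappa> powr a * (1 + A) powr b"
  have "(\<lambda>n. G * (real n powr b * exp (- d * real n))) \<longlonglongrightarrow> G * 0"
  proof (rule tendsto_mult_left)
    show "(\<lambda>n. real n powr b * exp (- d * real n)) \<longlonglongrightarrow> 0"
      using d by real_asymp
  qed
  then have "eventually (\<lambda>n. G * (real n powr b * exp (- d * real n)) < 1 / 4) sequentially"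
    by (rule order_tendstoD) simp
  then obtain n where n: "1 \<le> n" "G * (real n powr b * exp (- d * real n)) < 1 / 4"
    unfolding eventually_sequentially by (meson max.cobounded1 max.cobounded2)
  obtain U \<pi> z where U: "U \<in> (potentials \<kappa> :: (real ^ 2 \<Rightarrow> real) set)" and \<pi>: "unique_invariant_law (baoab_kernel ?h ?\<gamma> U) \<pi>"
    and tv: "1 / 4 \<le> tv_dist (apply_kernel (baoab_kernel ?h ?\<gamma> U) n (dirac z)) \<pi>"
    and W: "W2 (dirac z) \<pi> \<le> ennreal (A * real n * exp (q * real n))"
    using slow n(1) unfolding slow_mixing_at_def by blast
  let ?x = "(1 + A) * real n * exp (q * real n)"
  have "1 + W2 (dirac z) \<pi> \<le> ennreal ?x"
  proof -
    have "1 + W2 (dirac z) \<pi> \<le> ennreal 1 + ennreal (A * real n * exp (q * real n))"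
      using W by (simp add: add_left_mono)
    also have "\<dots> = ennreal (1 + A * real n * exp (q * real n))" using A by (intro ennreal_plus[symmetric]) auto
    also have "\<dots> \<le> ennreal ?x"
    proof (rule ennreal_leI)
      have "1 * 1 \<le> real n * exp (q * real n)" using n(1) q by (intro mult_mono) auto
      then show "1 + A * real n * exp (q * real n) \<le> ?x" by (simp add: algebra_simps)
    qed
    finally show ?thesis .
  qed
  then have fin: "1 + W2 (dirac z) \<pi> \<noteq> \<infinity>" and e: "enn2real (1 + W2 (dirac z) \<pi>) \<le> ?x"
    using A by (auto simp: top_unique intro: enn2real_leI)
  have "ennreal (C * \<kappa> powr a) * epowr (1 + W2 (dirac z) \<pi>) b * ennreal (exp (- (c * real n / \<tau> \<kappa>)))
      \<le> ennreal (C * \<kappa> powr a) * ennreal (?x powr b) * ennreal (exp (- (c * real n / \<tau> \<kappa>)))"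
    using fin e b by (intro mult_left_mono mult_right_mono) (auto simp: epowr_def intro!: ennreal_leI powr_mono2)
  also have "\<dots> = ennreal (C * \<kappa> powr a * ?x powr b * exp (- (c * real n / \<tau> \<kappa>)))"
    using C by (simp add: ennreal_mult[symmetric])
  also have "C * \<kappa> powr a * ?x powr b * exp (- (c * real n / \<tau> \<kappa>)) = G * (real n powr b * exp (- d * real n))"
  proof -
    have "?x powr b = (1 + A) powr b * real n powr b * exp (b * (q * real n))"
      using A by (simp add: powr_mult powr_def[of "exp _"])
    moreover have "exp (b * (q * real n)) * exp (- (c * real n / \<tau> \<kappa>)) = exp (- d * real n)"
      by (simp add: exp_add[symmetric] d_def algebra_simps)
    ultimately show ?thesis by (simp add: G_def mult_ac) 
  qed
  also have "ennreal (G * (real n powr b * exp (- d * real n))) < ennreal (1 / 4)"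
    using n(2) by (intro ennreal_lessI) auto
  also have "\<dots> \<le> ennreal (tv_dist (apply_kernel (baoab_kernel ?h ?\<gamma> U) n (dirac z)) \<pi>)"
    using tv by (rule ennreal_leI)
  finally show ?thesis using \<kappa>(1) U \<pi> by blast
qed

theorem corollary6p4:
  fixes h \<gamma> :: "real \<Rightarrow> real \<Rightarrow> nat \<Rightarrow> real"
    and C c a b \<kappa>\<^sub>0 :: real
    and \<tau> :: "real \<Rightarrow> real"
  assumes "tuning_rule h \<gamma>" and "numerically_stable h"
    and "C > 0" and "c > 0" and "a \<ge> 0" and "b \<ge> 0"
    and "\<forall>\<kappa>>1. \<tau> \<kappa> > 0" and "\<tau> \<in> o[at_top](\<lambda>\<kappa>. \<kappa>)"
    and "\<kappa>\<^sub>0 > 1"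
  shows "(\<exists>\<kappa>\<ge>\<kappa>\<^sub>0. \<exists>U \<in> (potentials \<kappa> :: (real ^ 2 \<Rightarrow> real) set). \<exists>\<pi>.
            unique_invariant_law (baoab_kernel (h 1 \<kappa> 2) (\<gamma> 1 \<kappa> 2) U) \<pi> \<and>
            (\<exists>z n. ennreal (tv_dist (apply_kernel (baoab_kernel (h 1 \<kappa> 2) (\<gamma> 1 \<kappa> 2) U) n (dirac z)) \<pi>)
                 > ennreal (C * \<kappa> powr a) * epowr (1 + W2 (dirac z) \<pi>) b
                     * ennreal (exp (- (c * real n / \<tau> \<kappa>)))))
       \<and> (\<forall>\<alpha><1. \<not> (\<forall>\<kappa>\<ge>\<kappa>\<^sub>0. \<forall>U \<in> (potentials \<kappa> :: (real ^ 2 \<Rightarrow> real) set). \<forall>\<pi>.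
            unique_invariant_law (baoab_kernel (h 1 \<kappa> 2) (\<gamma> 1 \<kappa> 2) U) \<pi> \<longrightarrow>
            (\<forall>z n. ennreal (tv_dist (apply_kernel (baoab_kernel (h 1 \<kappa> 2) (\<gamma> 1 \<kappa> 2) U) n (dirac z)) \<pi>)
                 \<le> ennreal (C * \<kappa> powr a) * epowr (1 + W2 (dirac z) \<pi>) b
                     * ennreal (exp (- (c * real n / \<kappa> powr \<alpha>))))))"
proof (intro conjI allI impI)
  fix \<alpha> :: real
  assume \<alpha>: "\<alpha> < 1"
  have "(\<lambda>\<kappa>. \<kappa> powr \<alpha>) \<in> o[at_top](\<lambda>\<kappa>::real. \<kappa>)"
    using \<alpha> by real_asymp
  moreover have "\<forall>\<kappa>>1. \<kappa> powr \<alpha> > 0" by simp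
  ultimately show "\<not> (\<forall>\<kappa>\<ge>\<kappa>\<^sub>0. \<forall>U \<in> (potentials \<kappa> :: (real ^ 2 \<Rightarrow> real) set). \<forall>\<pi>.
            unique_invariant_law (baoab_kernel (h 1 \<kappa> 2) (\<gamma> 1 \<kappa> 2) U) \<pi> \<longrightarrow>
            (\<forall>z n. ennreal (tv_dist (apply_kernel (baoab_kernel (h 1 \<kappa> 2) (\<gamma> 1 \<kappa> 2) U) n (dirac z)) \<pi>)
                 \<le> ennreal (C * \<kappa> powr a) * epowr (1 + W2 (dirac z) \<pi>) b
                     * ennreal (exp (- (c * real n / \<kappa> powr \<alpha>)))))"
    using no_accelerated_bound[OF assms(1-4,6) _ _ assms(9), of "\<lambda>\<kappa>. \<kappa> powr \<alpha>" a] by (meson leD)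
qed (rule no_accelerated_bound[OF assms(1-4,6-9)])

end
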